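(* Let $p>1$ and let $\phi$ be a finite energy solution to $$-\partial_t^2\phi+\partial_x^2\phi=|\phi|^{p-1}\phi\quad\text{in }\mathbb{R}^{1+1},\qquad \phi(0,x)=\phi_0(x),\qquad \partial_t\phi(0,x)=\phi_1(x).$$ Then $$\int_0^{+\infty}\int_{-t-1}^{t+1}\frac{\big((t+1)^2-x^2\big)|\phi(t,x)|^{p+1}}{(t+1)^3}\,dx\,dt\le C<\infty$$ for some constant $C$ depending only on $p$ and the energy $\mathcal{E}_0[\phi]$.
   Context: The energy is $\mathcal{E}_0[\phi]=\int_{\mathbb{R}}\big(|\partial_x\phi_0|^2+|\phi_1|^2+\frac{2}{p+1}|\phi_0|^{p+1}\big)dx$. Functions are real-valued. A finite energy solution is a solution with $\mathcal{E}_0[\phi]<\infty$, understood in the energy space: $\phi$ is a continuous function of $(t,x)\in\mathbb{R}\times\mathbb{R}$ with $\phi\in C_t L_x^{p+1}(\mathbb{R})$, $\partial_x\phi,\partial_t\phi\in C_tL_x^2(\mathbb{R})$, solving the equation in the sense of distributions and attaining the initial data at $t=0$. *)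

theory Defs
  imports "HOL-Analysis.Analysis"
begin

primrec C_k :: "nat \<Rightarrow> ('a::euclidean_space \<Rightarrow> real) \<Rightarrow> bool" where
  "C_k 0 f \<longleftrightarrow> continuous_on UNIV f"
| "C_k (Suc k) f \<longleftrightarrow>
     (\<exists>f'. (\<forall>x. (f has_derivative f' x) (at x)) \<and> (\<forall>e. C_k k (\<lambda>x. f' x e)))"

definition test_fun :: "('a::euclidean_space \<Rightarrow> real) \<Rightarrow> bool" where
  "test_fun \<psi> \<longleftrightarrow> (\<forall>k. C_k k \<psi>) \<and> compact (closure {x. \<psi> x \<noteq> 0})"

definition dir_deriv :: "'a::euclidean_space \<Rightarrow> ('a \<Rightarrow> real) \<Rightarrow> 'a \<Rightarrow> real" where
  "dir_deriv e f x = frechet_derivative f (at x) e"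

definition locally_integrable :: "('a::euclidean_space \<Rightarrow> real) \<Rightarrow> bool" where
  "locally_integrable f \<longleftrightarrow> (\<forall>K. compact K \<longrightarrow> set_integrable lborel K f)"

definition has_weak_deriv ::
    "'a::euclidean_space \<Rightarrow> ('a \<Rightarrow> real) \<Rightarrow> ('a \<Rightarrow> real) \<Rightarrow> bool" where
  "has_weak_deriv e f g \<longleftrightarrow> locally_integrable f \<and> locally_integrable g \<and>
     (\<forall>\<psi>. test_fun \<psi> \<longrightarrow>
        (LINT x|lborel. f x * dir_deriv e \<psi> x) = - (LINT x|lborel. g x * \<psi> x))"

(* Points of the plane are pairs (t, x).  C_t_Lq q F says that t \<mapsto> F(t, \<cdot>) is a continuous
   map from the line into L^q; F is a jointly Borel representative. *)
definition C_t_Lq :: "real \<Rightarrow> (real \<times> real \<Rightarrow> real) \<Rightarrow> bool" where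
  "C_t_Lq q F \<longleftrightarrow> F \<in> borel_measurable borel \<and>
     (\<forall>t. (\<integral>\<^sup>+x. ennreal (\<bar>F (t, x)\<bar> powr q) \<partial>lborel) < \<infinity>) \<and>
     (\<forall>t. ((\<lambda>s. \<integral>\<^sup>+x. ennreal (\<bar>F (s, x) - F (t, x)\<bar> powr q) \<partial>lborel) \<longlongrightarrow> 0) (at t))"

(* The weak derivative is unique up to null sets, so the choice made by SOME does not affect
   the value; data without a weak derivative have infinite energy. *)
definition energy :: "real \<Rightarrow> (real \<Rightarrow> real) \<Rightarrow> (real \<Rightarrow> real) \<Rightarrow> ennreal" where
  "energy p \<phi>\<^sub>0 \<phi>\<^sub>1 =
     (if \<exists>g. has_weak_deriv 1 \<phi>\<^sub>0 g
      then (\<integral>\<^sup>+x. ennreal (\<bar>(SOME g. has_weak_deriv 1 \<phi>\<^sub>0 g) x\<bar>\<^sup>2 + \<bar>\<phi>\<^sub>1 x\<bar>\<^sup>2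
              + 2 / (p + 1) * \<bar>\<phi>\<^sub>0 x\<bar> powr (p + 1)) \<partial>lborel)
      else \<infinity>)"

definition distributional_solution :: "real \<Rightarrow> (real \<times> real \<Rightarrow> real) \<Rightarrow> bool" where
  "distributional_solution p \<phi> \<longleftrightarrow>
     (\<forall>\<psi>. test_fun \<psi> \<longrightarrow>
        (LINT z|lborel. \<phi> z * (- dir_deriv (1, 0) (dir_deriv (1, 0) \<psi>) z
                              + dir_deriv (0, 1) (dir_deriv (0, 1) \<psi>) z))
        = (LINT z|lborel. \<bar>\<phi> z\<bar> powr (p - 1) * \<phi> z * \<psi> z))"

(* \<phi>\<^sub>t and \<phi>\<^sub>x are determined up to a null set on every time slice, because they are continuous
   in time with values in L^2; hence the condition on \<phi>\<^sub>t at t = 0 is meaningful. *)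
definition finite_energy_solution ::
    "real \<Rightarrow> (real \<Rightarrow> real) \<Rightarrow> (real \<Rightarrow> real) \<Rightarrow> (real \<times> real \<Rightarrow> real) \<Rightarrow> bool" where
  "finite_energy_solution p \<phi>\<^sub>0 \<phi>\<^sub>1 \<phi> \<longleftrightarrow>
     continuous_on UNIV \<phi> \<and> C_t_Lq (p + 1) \<phi> \<and>
     (\<exists>\<phi>\<^sub>x. has_weak_deriv (0, 1) \<phi> \<phi>\<^sub>x \<and> C_t_Lq 2 \<phi>\<^sub>x) \<and>
     (\<exists>\<phi>\<^sub>t. has_weak_deriv (1, 0) \<phi> \<phi>\<^sub>t \<and> C_t_Lq 2 \<phi>\<^sub>t \<and>
           (AE x in lborel. \<phi>\<^sub>t (0, x) = \<phi>\<^sub>1 x)) \<and>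
     (\<forall>x. \<phi> (0, x) = \<phi>\<^sub>0 x) \<and>
     distributional_solution p \<phi> \<and>
     energy p \<phi>\<^sub>0 \<phi>\<^sub>1 < \<infinity>"

end

theory Submission
  imports Defs
begin

text \<open>
  Write \<open>V = |u|\<^sup>p\<^sup>+\<^sup>1/(p+1)\<close>, \<open>e = (u\<^sub>t\<^sup>2 + u\<^sub>x\<^sup>2)/2 + V\<close>, \<open>T = t + 1\<close>, and let \<open>\<sigma>\<close> be \<open>x/T\<close> clamped to \<open>[-1, 1]\<close>.
  Multiply the equation by \<open>a u\<^sub>t + b u\<^sub>x + w u\<close> with \<open>a = (1 + \<sigma>\<^sup>2)/2\<close>, \<open>b = \<sigma>\<close>, \<open>w = (1 - \<sigma>\<^sup>2)/(2T)\<close>. Inside the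
  cone \<open>|x| < T\<close> the bulk term becomes \<open>-T\<^sup>-\<^sup>1 ((\<sigma> u\<^sub>t + u\<^sub>x)\<^sup>2 + (p-1)/2 (1 - \<sigma>\<^sup>2) V)\<close>, up to errors of size
  \<open>T\<^sup>-\<^sup>2 |u| (|u\<^sub>t| + |u\<^sub>x|)\<close>. The latter are integrable in time: by Young's inequality they are at most
  \<open>T\<^sup>-\<^sup>3\<^sup>/\<^sup>2 e + T\<^sup>-\<^sup>5\<^sup>/\<^sup>2 u\<^sup>2\<close>, and \<open>u\<^sup>2 \<le> 1 + |u|\<^sup>p\<^sup>+\<^sup>1\<close> where the cone has width \<open>2T\<close>. Outside the cone the
  multiplier is \<open>\<partial>\<^sub>t \<plusminus> \<partial>\<^sub>x\<close>, with no bulk term. Since \<open>(1 - \<sigma>\<^sup>2)/T\<close> is the desired weight and the boundary terms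
  are controlled by the energy, the estimate follows for smooth solutions.

  A finite energy solution is mollified in space-time, which gives a smooth solution up to an error that
  is uniformly small on compact sets. A cutoff decreasing along \<open>t + |x|\<close> localizes to such
  sets; its derivative contributes a term with the good sign. Fatou's lemma removes the regularization.
\<close>

section \<open>Smooth functions and mollifiers\<close>

text \<open>Inside the cone the first-order part of the multiplier has a positive definite kinetic
  form, but leaves the potential with the wrong sign, as \<open>(1 - \<sigma>^2) V / T\<close>. The
  term \<open>w u\<close> trades one against the other: it adds \<open>w (u_t^2 - u_x^2)\<close> and
  \<open>- (p + 1) w V\<close>. The chosen \<open>w\<close> is the largest coefficient for which the
  kinetic form stays semidefinite, which is why that form degenerates to a perfect square. The net
  coefficient \<open>(p - 1) / 2\<close> of the potential is positive because \<open>p > 1\<close>,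
  and it puts \<open>p - 1\<close> into the denominator of the constant. The pair
  \<open>(a, b)\<close> is causal, \<open>a - |b| = (1 - |\<sigma>|)^2 / 2\<close>, so flux through
  characteristic cutoffs has a sign. Only the initial energy of the rough solution is given, and its
  conservation cannot be assumed. The energy inequality is therefore proved for the mollification
  itself, which solves the equation only up to an error \<delta>. As the constant must not depend on
  the size \<open>R\<close> of the region, \<delta> is chosen after \<open>R\<close> with
  \<open>\<delta> R^2 <= 1 / 2\<close>; the error accumulated over an area comparable to
  \<open>R^2\<close> then stays bounded.\<close>

lemma C_k_SucD: "C_k (Suc k) f \<Longrightarrow> C_k k f"
proof (induction k arbitrary: f)
  case 0
  then obtain f' where "\<And>x. (f has_derivative f' x) (at x)" by auto
  then show ?case
    by (auto intro!: continuous_at_imp_continuous_on has_derivative_continuous)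
next
  case (Suc k)
  then obtain f' where "\<forall>x. (f has_derivative f' x) (at x)" "\<forall>e. C_k (Suc k) (\<lambda>x. f' x e)"
    by (subst (asm) C_k.simps) blast
  then show ?case using Suc.IH by (subst C_k.simps) blast
qed

lemma C_k_const: "C_k k (\<lambda>x. c)"
proof (induction k arbitrary: c)
  case (Suc k)
  then show ?case by (auto intro!: exI[of _ "\<lambda>x e. 0"])
qed auto

lemma C_k_add: "C_k k f \<Longrightarrow> C_k k g \<Longrightarrow> C_k k (\<lambda>x. f x + g x)"
proof (induction k arbitrary: f g)
  case 0
  then show ?case by (auto intro!: continuous_intros)
next
  case (Suc k)
  then obtain f' g' where *: "\<forall>x. (f has_derivative f' x) (at x)" "\<forall>e. C_k k (\<lambda>x. f' x e)"
    "\<forall>x. (g has_derivative g' x) (at x)" "\<forall>e. C_k k (\<lambda>x. g' x e)"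
    by auto
  show ?case
    using * Suc.IH
    by (auto intro!: exI[of _ "\<lambda>x e. f' x e + g' x e"] derivative_intros)
qed

lemma C_k_mult: "C_k k f \<Longrightarrow> C_k k g \<Longrightarrow> C_k k (\<lambda>x. f x * g x)"
proof (induction k arbitrary: f g)
  case 0
  then show ?case by (auto intro!: continuous_intros)
next
  case (Suc k)
  then obtain f' g' where *: "\<forall>x. (f has_derivative f' x) (at x)" "\<forall>e. C_k k (\<lambda>x. f' x e)"
    "\<forall>x. (g has_derivative g' x) (at x)" "\<forall>e. C_k k (\<lambda>x. g' x e)"
    by auto
  have "C_k k f" "C_k k g" using Suc.prems C_k_SucD by blast+
  then have "\<forall>e. C_k k (\<lambda>x. f x * g' x e + f' x e * g x)"
    using * by (auto intro!: C_k_add Suc.IH)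
  moreover have "\<forall>x. ((\<lambda>x. f x * g x) has_derivative (\<lambda>e. f x * g' x e + f' x e * g x)) (at x)"
    using * by (auto intro!: has_derivative_mult)
  ultimately show ?case
    by (auto intro!: exI[of _ "\<lambda>x e. f x * g' x e + f' x e * g x"])
qed

lemma C_k_affine:
  fixes L :: "'a::euclidean_space \<Rightarrow> 'b::euclidean_space"
  assumes L: "bounded_linear L"
  shows "C_k k f \<Longrightarrow> C_k k (\<lambda>x. f (c + L x))"
proof (induction k arbitrary: f)
  case 0
  have "continuous_on UNIV (\<lambda>x. c + L x)"
    using L by (intro continuous_intros linear_continuous_on)
  with 0 show ?case
    using continuous_on_compose2[of UNIV f UNIV "\<lambda>x. c + L x"] by auto
next
  case (Suc k)
  then obtain f' where *: "\<forall>x. (f has_derivative f' x) (at x)" "\<forall>e. C_k k (\<lambda>x. f' x e)"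
    by auto
  have "((\<lambda>x. f (c + L x)) has_derivative (\<lambda>e. f' (c + L x) (L e))) (at x)" for x
  proof -
    have "((\<lambda>x. c + L x) has_derivative (\<lambda>e. 0 + L e)) (at x)"
      by (intro derivative_intros bounded_linear_imp_has_derivative L)
    then show ?thesis
      using has_derivative_compose[of "\<lambda>x. c + L x" L x UNIV f "f' (c + L x)"] * by simp
  qed
  moreover have "\<forall>e. C_k k (\<lambda>x. f' (c + L x) (L e))"
  proof
    fix e
    show "C_k k (\<lambda>x. f' (c + L x) (L e))"
      using Suc.IH[of "\<lambda>y. f' y (L e)"] * by auto
  qed
  ultimately show ?case
    by (auto intro!: exI[of _ "\<lambda>x e. f' (c + L x) (L e)"])
qed

definition smooth :: "('a::euclidean_space \<Rightarrow> real) \<Rightarrow> bool" where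
  "smooth f \<longleftrightarrow> (\<forall>k. C_k k f)"

lemma smooth_const: "smooth (\<lambda>x. c)"
  and smooth_mult: "smooth f \<Longrightarrow> smooth g \<Longrightarrow> smooth (\<lambda>x. f x * g x)"
  and smooth_affine: "bounded_linear L \<Longrightarrow> smooth h \<Longrightarrow> smooth (\<lambda>x. h (c + L x))"
  by (auto simp: smooth_def intro: C_k_const C_k_mult C_k_affine)

lemma smooth_continuous_on: "smooth f \<Longrightarrow> continuous_on A f"
  by (metis C_k.simps(1) UNIV_I continuous_on_subset smooth_def subsetI)

lemma smooth_DERIV:
  fixes f :: "real \<Rightarrow> real"
  assumes "smooth f"
  shows "(f has_real_derivative deriv f x) (at x)"
proof -
  have "C_k (Suc 0) f" using assms smooth_def by blast
  then have "f differentiable (at x)" by (auto simp: differentiable_def)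
  then show ?thesis
    using DERIV_deriv_iff_real_differentiable by blast
qed

lemma smooth_deriv:
  fixes f :: "real \<Rightarrow> real"
  assumes "smooth f"
  shows "smooth (deriv f)"
  unfolding smooth_def
proof
  fix k
  have "C_k (Suc k) f" using assms smooth_def by blast
  then obtain f' where f': "\<And>x. (f has_derivative f' x) (at x)" "\<And>e. C_k k (\<lambda>x. f' x e)"
    by auto
  have "f' x 1 = deriv f x" for x
    using has_derivative_unique[OF f'(1)[of x] smooth_DERIV[OF assms, of x, unfolded has_field_derivative_def]]
    by simp
  then show "C_k k (deriv f)" using f'(2)[of 1] by simp
qed

text \<open>The family of the functions \<open>P(1/x) exp (-1/x)\<close>, extended by zero, is closed under
  differentiation.\<close>

definition flat :: "real poly \<Rightarrow> real \<Rightarrow> real" where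
  "flat P x = (if x > 0 then poly P (1 / x) * exp (- (1 / x)) else 0)"

lemma poly_over_exp_tendsto_0: "((\<lambda>y::real. poly P y * exp (- y)) \<longlongrightarrow> 0) at_top"
proof -
  have "((\<lambda>y::real. \<Sum>i\<le>degree P. coeff P i * (y ^ i / exp y)) \<longlongrightarrow> (\<Sum>i\<le>degree P. coeff P i * 0)) at_top"
    by (intro tendsto_sum tendsto_mult tendsto_const tendsto_power_div_exp_0)
  then show ?thesis
    by (simp add: poly_altdef sum_distrib_right exp_minus divide_inverse mult.assoc)
qed

text \<open>Substitute \<open>y = 1 / x\<close>: since \<open>dy/dx = - y^2\<close>, the derivative
  of \<open>P(y) exp (- y)\<close> is \<open>y^2 (P - P')(y) exp (- y)\<close>, and
  \<open>[:0, 0, 1:]\<close> is the polynomial \<open>y^2\<close>. At the origin the difference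
  quotient from the right is \<open>y P(y) exp (- y)\<close>, which tends to 0.\<close>

lemma flat_has_derivative:
  "(flat P has_real_derivative flat ([:0, 0, 1:] * (P - pderiv P)) x) (at x)"
proof -
  consider "x > 0" | "x < 0" | "x = 0" by linarith
  then show ?thesis
  proof cases
    case 1
    have "((\<lambda>x. poly P (1 / x) * exp (- (1 / x))) has_real_derivative
        flat ([:0, 0, 1:] * (P - pderiv P)) x) (at x)"
      using 1
      apply (auto intro!: derivative_eq_intros DERIV_chain'[OF _ poly_DERIV] simp: flat_def)
      apply (simp add: field_simps power2_eq_square)
      done
    then show ?thesis
      by (rule has_field_derivative_transform_within_open[of _ _ _ "{0<..}"])
        (use 1 in \<open>auto simp: flat_def\<close>)
  next
    case 2
    have "((\<lambda>x. 0) has_real_derivative flat ([:0, 0, 1:] * (P - pderiv P)) x) (at x)"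
      using 2 by (simp add: flat_def)
    then show ?thesis
      by (rule has_field_derivative_transform_within_open[of _ _ _ "{..<0}"])
        (use 2 in \<open>auto simp: flat_def\<close>)
  next
    case 3
    have "((\<lambda>y. flat P y / y) \<longlongrightarrow> 0) (at_right 0)"
    proof -
      have "((\<lambda>y. poly (pCons 0 P) (inverse y) * exp (- inverse y)) \<longlongrightarrow> 0) (at_right 0)"
        by (rule filterlim_compose[OF poly_over_exp_tendsto_0 filterlim_inverse_at_top_right])
      moreover have "\<forall>\<^sub>F y in at_right 0.
          poly (pCons 0 P) (inverse y) * exp (- inverse y) = flat P y / y"
        using eventually_at_right_less[of 0]
        by eventually_elim (auto simp: flat_def divide_inverse)
      ultimately show ?thesis by (rule Lim_transform_eventually)
    qed
    moreover have "((\<lambda>y. flat P y / y) \<longlongrightarrow> 0) (at_left 0)"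
    proof -
      have "\<forall>\<^sub>F y in at_left (0::real). 0 = flat P y / y"
        using eventually_at_left_real[of "-1" 0]
        by (auto simp: flat_def elim: eventually_mono)
      then show ?thesis by (rule Lim_transform_eventually[OF tendsto_const])
    qed
    ultimately have "((\<lambda>y. flat P y / y) \<longlongrightarrow> 0) (at 0)"
      by (simp only: filterlim_at_split)
    moreover have "flat Q 0 = 0" for Q
      by (simp add: flat_def)
    ultimately show ?thesis
      unfolding 3 DERIV_def by simp
  qed
qed

lemma smooth_flat: "smooth (flat P)"
proof -
  have "C_k k (flat P)" for k
  proof (induction k arbitrary: P)
    case 0
    show ?case
      using DERIV_isCont[OF flat_has_derivative] by (simp add: continuous_at_imp_continuous_on)
  next
    case (Suc k)
    show ?case
      using flat_has_derivative[of P] Suc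
      by (auto simp: has_field_derivative_def
          intro!: exI[of _ "\<lambda>x e. flat ([:0, 0, 1:] * (P - pderiv P)) x * e"] C_k_mult C_k_const)
  qed
  then show ?thesis by (simp add: smooth_def)
qed

section \<open>Compactly supported smooth kernels of unit integral\<close>

definition mollifier :: "real \<Rightarrow> (real \<Rightarrow> real) \<Rightarrow> bool" where
  "mollifier \<epsilon> k \<longleftrightarrow> smooth k \<and> (\<forall>x. 0 \<le> k x) \<and> (\<forall>x. \<bar>x\<bar> > \<epsilon> \<longrightarrow> k x = 0) \<and>
     has_bochner_integral lborel k 1"

lemma ex_mollifier:
  assumes "\<epsilon> > 0"
  shows "\<exists>k. mollifier \<epsilon> k"
proof -
  \<comment> \<open>A product of two functions \<open>exp (- 1 / y)\<close>, positive exactly for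
    \<open>|x| < \<epsilon>\<close>. The arguments have the form \<open>c + L x\<close> to match
    \<open>smooth_affine\<close>.\<close>
  define h where "h x = flat 1 (\<epsilon> + x) * flat 1 (\<epsilon> + - x)" for x
  have "smooth h"
    unfolding h_def
    by (intro smooth_mult smooth_affine smooth_flat bounded_linear_ident bounded_linear_minus)
  have nonneg: "0 \<le> h x" for x by (simp add: h_def flat_def)
  have supp: "h x = 0" if "\<bar>x\<bar> > \<epsilon>" for x using that by (auto simp: h_def flat_def)
  have cont: "continuous_on A h" for A using \<open>smooth h\<close> smooth_continuous_on by blast
  have "set_integrable lborel {-\<epsilon>..\<epsilon>} h"
    by (intro borel_integrable_atLeastAtMost' cont)
  moreover have "(\<lambda>x. indicator {-\<epsilon>..\<epsilon>} x *\<^sub>R h x) = h"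
    using supp by (force simp: indicator_def)
  ultimately have int: "integrable lborel h" by (simp add: set_integrable_def)
  define c where "c = integral\<^sup>L lborel h"
  have "c \<noteq> 0"
  proof
    assume "c = 0"
    then have "AE x in lborel. h x = 0"
      using integral_nonneg_eq_0_iff_AE[OF int] nonneg c_def by simp
    moreover have "h x \<noteq> 0" if "x \<in> {0<..<\<epsilon>}" for x using that by (simp add: h_def flat_def)
    ultimately have "AE x in lborel. x \<notin> {0<..<\<epsilon>}" by (auto elim: eventually_mono)
    then have "emeasure lborel {0<..<\<epsilon>} = 0"
      by (subst (asm) AE_iff_measurable[of "{0<..<\<epsilon>}"]) auto
    then show False using assms by simp
  qed
  then have "c > 0" using nonneg c_def by (simp add: order_less_le)
  have "mollifier \<epsilon> (\<lambda>x. (1 / c) * h x)"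
    unfolding mollifier_def
    using smooth_mult[OF smooth_const \<open>smooth h\<close>, of "1 / c"] nonneg supp \<open>c > 0\<close> int
    by (simp add: has_bochner_integral_iff c_def[symmetric])
  then show ?thesis by blast
qed

lemma dir_deriv_eq: "(f has_derivative f') (at x) \<Longrightarrow> dir_deriv e f x = f' e"
  by (metis dir_deriv_def frechet_derivative_at)

section \<open>The divergence theorem for Lipschitz vector fields\<close>

text \<open>Continuous functions with bounded partial derivatives \<open>a_t\<close>, \<open>a_x\<close> off finitely many points of every
  horizontal and vertical segment of \<open>[0, \<tau>] \<times> [-R, R]\<close>. The finite sets may depend on the segment, which
  admits the kinks of the multiplier along the light cones.\<close>

definition pw_diff ::
    "real \<Rightarrow> real \<Rightarrow> (real \<times> real \<Rightarrow> real) \<Rightarrow> (real \<times> real \<Rightarrow> real) \<Rightarrow> (real \<times> real \<Rightarrow> real) \<Rightarrow> bool"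
  where "pw_diff \<tau> R a a_t a_x \<longleftrightarrow>
    continuous_on ({0..\<tau>} \<times> {-R..R}) a \<and>
    a \<in> borel_measurable borel \<and> a_t \<in> borel_measurable borel \<and> a_x \<in> borel_measurable borel \<and>
    bounded (a_t ` ({0..\<tau>} \<times> {-R..R})) \<and> bounded (a_x ` ({0..\<tau>} \<times> {-R..R})) \<and>
    (\<forall>x\<in>{-R..R}. \<exists>S. finite S \<and>
       (\<forall>t\<in>{0<..<\<tau>} - S. ((\<lambda>t. a (t, x)) has_real_derivative a_t (t, x)) (at t))) \<and>
    (\<forall>t\<in>{0..\<tau>}. \<exists>S. finite S \<and>
       (\<forall>x\<in>{-R<..<R} - S. ((\<lambda>x. a (t, x)) has_real_derivative a_x (t, x)) (at x)))"

lemma pw_diffI: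
  assumes "continuous_on ({0..\<tau>} \<times> {-R..R}) a"
    and "a \<in> borel_measurable borel" "a_t \<in> borel_measurable borel" "a_x \<in> borel_measurable borel"
    and "\<And>z. z \<in> {0..\<tau>} \<times> {-R..R} \<Longrightarrow> \<bar>a_t z\<bar> \<le> M" "\<And>z. z \<in> {0..\<tau>} \<times> {-R..R} \<Longrightarrow> \<bar>a_x z\<bar> \<le> M"
    and "\<And>x. finite (S x)"
    and "\<And>t x. x \<in> {-R..R} \<Longrightarrow> t \<in> {0<..<\<tau>} - S x \<Longrightarrow>
           ((\<lambda>t. a (t, x)) has_real_derivative a_t (t, x)) (at t)"
    and "\<And>t. finite (S' t)"
    and "\<And>t x. t \<in> {0..\<tau>} \<Longrightarrow> x \<in> {-R<..<R} - S' t \<Longrightarrow>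
           ((\<lambda>x. a (t, x)) has_real_derivative a_x (t, x)) (at x)"
  shows "pw_diff \<tau> R a a_t a_x"
proof -
  have "bounded (a_t ` ({0..\<tau>} \<times> {-R..R}))" "bounded (a_x ` ({0..\<tau>} \<times> {-R..R}))"
    unfolding bounded_iff using assms(5,6) by (auto intro!: exI[of _ M])
  moreover have "\<exists>S. finite S \<and>
      (\<forall>t\<in>{0<..<\<tau>} - S. ((\<lambda>t. a (t, x)) has_real_derivative a_t (t, x)) (at t))"
    if "x \<in> {-R..R}" for x
    using assms(7,8) that by (intro exI[of _ "S x"] conjI ballI)
  moreover have "\<exists>S. finite S \<and>
      (\<forall>x\<in>{-R<..<R} - S. ((\<lambda>x. a (t, x)) has_real_derivative a_x (t, x)) (at x))"
    if "t \<in> {0..\<tau>}" for t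
    using assms(9,10) that by (intro exI[of _ "S' t"] conjI ballI)
  ultimately show ?thesis
    unfolding pw_diff_def using assms(1-4) by (intro conjI ballI)
qed

lemma pw_diffE:
  assumes "pw_diff \<tau> R a a_t a_x" "x \<in> {-R..R}"
  obtains S where "finite S"
    "\<And>t. t \<in> {0<..<\<tau>} - S \<Longrightarrow> ((\<lambda>t. a (t, x)) has_real_derivative a_t (t, x)) (at t)"
proof -
  have "\<forall>x\<in>{-R..R}. \<exists>S. finite S \<and>
      (\<forall>t\<in>{0<..<\<tau>} - S. ((\<lambda>t. a (t, x)) has_real_derivative a_t (t, x)) (at t))"
    using assms(1) unfolding pw_diff_def by (elim conjE) assumption
  then show ?thesis using assms(2) that by blast
qed

lemma pw_diffE':
  assumes "pw_diff \<tau> R a a_t a_x" "t \<in> {0..\<tau>}"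
  obtains S where "finite S"
    "\<And>x. x \<in> {-R<..<R} - S \<Longrightarrow> ((\<lambda>x. a (t, x)) has_real_derivative a_x (t, x)) (at x)"
proof -
  have "\<forall>t\<in>{0..\<tau>}. \<exists>S. finite S \<and>
      (\<forall>x\<in>{-R<..<R} - S. ((\<lambda>x. a (t, x)) has_real_derivative a_x (t, x)) (at x))"
    using assms(1) unfolding pw_diff_def by (elim conjE) assumption
  then show ?thesis using assms(2) that by blast
qed

lemma pw_diffD:
  assumes "pw_diff \<tau> R a a_t a_x"
  shows "continuous_on ({0..\<tau>} \<times> {-R..R}) a"
    and "a \<in> borel_measurable borel"
    and "a_t \<in> borel_measurable borel"
    and "a_x \<in> borel_measurable borel"
    and "bounded (a_t ` ({0..\<tau>} \<times> {-R..R}))"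
    and "bounded (a_x ` ({0..\<tau>} \<times> {-R..R}))"
  using assms by (simp_all only: pw_diff_def)

lemma pw_diff_continuous:
  assumes "pw_diff \<tau> R a a_t a_x"
  shows "t \<in> {0..\<tau>} \<Longrightarrow> continuous_on {-R..R} (\<lambda>x. a (t, x))"
    and "x \<in> {-R..R} \<Longrightarrow> continuous_on {0..\<tau>} (\<lambda>t. a (t, x))"
proof -
  have "continuous_on ({0..\<tau>} \<times> {-R..R}) a" using assms by (rule pw_diffD)
  then show "t \<in> {0..\<tau>} \<Longrightarrow> continuous_on {-R..R} (\<lambda>x. a (t, x))"
    "x \<in> {-R..R} \<Longrightarrow> continuous_on {0..\<tau>} (\<lambda>t. a (t, x))"
    by (auto intro!: continuous_on_compose2[of "{0..\<tau>} \<times> {-R..R}" a] continuous_intros)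
qed

lemma pw_diff_C1:
  assumes "continuous_on UNIV a" "continuous_on UNIV a_t" "continuous_on UNIV a_x"
    and "\<And>t x. ((\<lambda>t. a (t, x)) has_real_derivative a_t (t, x)) (at t)"
    and "\<And>t x. ((\<lambda>x. a (t, x)) has_real_derivative a_x (t, x)) (at x)"
  shows "pw_diff \<tau> R a a_t a_x"
proof -
  have "bounded (g ` ({0..\<tau>} \<times> {-R..R}))" if "continuous_on UNIV g" for g :: "real \<times> real \<Rightarrow> real"
    by (intro compact_imp_bounded compact_continuous_image compact_Times compact_Icc
        continuous_on_subset[OF that subset_UNIV])
  then show ?thesis
    using assms unfolding pw_diff_def
    by (intro conjI ballI borel_measurable_continuous_onI exI[of _ "{}"])
      (auto intro: continuous_on_subset)
qed

lemma pw_diff_bounded: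
  assumes "pw_diff \<tau> R a a_t a_x"
  shows "bounded (a ` ({0..\<tau>} \<times> {-R..R}))"
  by (intro compact_imp_bounded compact_continuous_image pw_diffD[OF assms] compact_Times compact_Icc)

lemma bounded_image_add:
  fixes f g :: "'a \<Rightarrow> real"
  assumes "bounded (f ` S)" "bounded (g ` S)"
  shows "bounded ((\<lambda>z. f z + g z) ` S)"
  by (rule bounded_plus_comp[OF assms])

lemma bounded_image_mult:
  fixes f g :: "'a \<Rightarrow> real"
  assumes "bounded (f ` S)" "bounded (g ` S)"
  shows "bounded ((\<lambda>z. f z * g z) ` S)"
proof -
  obtain B C where "\<And>z. z \<in> S \<Longrightarrow> \<bar>f z\<bar> \<le> B" "\<And>z. z \<in> S \<Longrightarrow> \<bar>g z\<bar> \<le> C"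
    using assms unfolding bounded_iff by (metis imageI real_norm_def)
  then have "\<bar>f z * g z\<bar> \<le> B * C" if "z \<in> S" for z
    unfolding abs_mult using that by (meson abs_ge_zero mult_mono order_trans)
  then show ?thesis by (auto simp: bounded_iff)
qed

lemma pw_diff_add:
  assumes a: "pw_diff \<tau> R a a_t a_x" and b: "pw_diff \<tau> R b b_t b_x"
  shows "pw_diff \<tau> R (\<lambda>z. a z + b z) (\<lambda>z. a_t z + b_t z) (\<lambda>z. a_x z + b_x z)"
  unfolding pw_diff_def
proof (intro conjI ballI)
  fix x assume "x \<in> {-R..R}"
  then have x: "x \<in> {-R..R}" .
  obtain S where "finite S"
    "\<And>t. t \<in> {0<..<\<tau>} - S \<Longrightarrow> ((\<lambda>t. a (t, x)) has_real_derivative a_t (t, x)) (at t)"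
    using pw_diffE[OF a x] by blast
  moreover obtain S' where "finite S'"
    "\<And>t. t \<in> {0<..<\<tau>} - S' \<Longrightarrow> ((\<lambda>t. b (t, x)) has_real_derivative b_t (t, x)) (at t)"
    using pw_diffE[OF b x] by blast
  ultimately show "\<exists>S. finite S \<and> (\<forall>t\<in>{0<..<\<tau>} - S.
      ((\<lambda>t. a (t, x) + b (t, x)) has_real_derivative a_t (t, x) + b_t (t, x)) (at t))"
    by (intro exI[of _ "S \<union> S'"]) (auto intro!: DERIV_add)
next
  fix t assume "t \<in> {0..\<tau>}"
  then have t: "t \<in> {0..\<tau>}" .
  obtain S where "finite S"
    "\<And>x. x \<in> {-R<..<R} - S \<Longrightarrow> ((\<lambda>x. a (t, x)) has_real_derivative a_x (t, x)) (at x)"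
    using pw_diffE'[OF a t] by blast
  moreover obtain S' where "finite S'"
    "\<And>x. x \<in> {-R<..<R} - S' \<Longrightarrow> ((\<lambda>x. b (t, x)) has_real_derivative b_x (t, x)) (at x)"
    using pw_diffE'[OF b t] by blast
  ultimately show "\<exists>S. finite S \<and> (\<forall>x\<in>{-R<..<R} - S.
      ((\<lambda>x. a (t, x) + b (t, x)) has_real_derivative a_x (t, x) + b_x (t, x)) (at x))"
    by (intro exI[of _ "S \<union> S'"]) (auto intro!: DERIV_add)
qed (intro continuous_intros bounded_image_add borel_measurable_add pw_diffD[OF a] pw_diffD[OF b])+

lemma pw_diff_mult:
  assumes a: "pw_diff \<tau> R a a_t a_x" and b: "pw_diff \<tau> R b b_t b_x"
  shows "pw_diff \<tau> R (\<lambda>z. a z * b z) (\<lambda>z. a_t z * b z + b_t z * a z) (\<lambda>z. a_x z * b z + b_x z * a z)"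
  unfolding pw_diff_def
proof (intro conjI ballI)
  fix x assume "x \<in> {-R..R}"
  then have x: "x \<in> {-R..R}" .
  obtain S where "finite S"
    "\<And>t. t \<in> {0<..<\<tau>} - S \<Longrightarrow> ((\<lambda>t. a (t, x)) has_real_derivative a_t (t, x)) (at t)"
    using pw_diffE[OF a x] by blast
  moreover obtain S' where "finite S'"
    "\<And>t. t \<in> {0<..<\<tau>} - S' \<Longrightarrow> ((\<lambda>t. b (t, x)) has_real_derivative b_t (t, x)) (at t)"
    using pw_diffE[OF b x] by blast
  ultimately show "\<exists>S. finite S \<and> (\<forall>t\<in>{0<..<\<tau>} - S.
      ((\<lambda>t. a (t, x) * b (t, x)) has_real_derivative
        a_t (t, x) * b (t, x) + b_t (t, x) * a (t, x)) (at t))"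
    by (intro exI[of _ "S \<union> S'"]) (auto intro!: DERIV_mult)
next
  fix t assume "t \<in> {0..\<tau>}"
  then have t: "t \<in> {0..\<tau>}" .
  obtain S where "finite S"
    "\<And>x. x \<in> {-R<..<R} - S \<Longrightarrow> ((\<lambda>x. a (t, x)) has_real_derivative a_x (t, x)) (at x)"
    using pw_diffE'[OF a t] by blast
  moreover obtain S' where "finite S'"
    "\<And>x. x \<in> {-R<..<R} - S' \<Longrightarrow> ((\<lambda>x. b (t, x)) has_real_derivative b_x (t, x)) (at x)"
    using pw_diffE'[OF b t] by blast
  ultimately show "\<exists>S. finite S \<and> (\<forall>x\<in>{-R<..<R} - S.
      ((\<lambda>x. a (t, x) * b (t, x)) has_real_derivative
        a_x (t, x) * b (t, x) + b_x (t, x) * a (t, x)) (at x))"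
    by (intro exI[of _ "S \<union> S'"]) (auto intro!: DERIV_mult)
qed (intro continuous_intros bounded_image_add bounded_image_mult borel_measurable_add
      borel_measurable_times pw_diffD[OF a] pw_diffD[OF b] pw_diff_bounded[OF a]
      pw_diff_bounded[OF b])+

lemma pw_diff_const: "pw_diff \<tau> R (\<lambda>z. c) (\<lambda>z. 0) (\<lambda>z. 0)"
  by (rule pw_diff_C1) (auto intro!: continuous_intros)

lemma pw_diff_cmult:
  assumes "pw_diff \<tau> R a a_t a_x"
  shows "pw_diff \<tau> R (\<lambda>z. c * a z) (\<lambda>z. c * a_t z) (\<lambda>z. c * a_x z)"
  using pw_diff_mult[OF pw_diff_const[of \<tau> R c] assms] by (simp add: mult.commute)

lemma pw_diff_diff:
  assumes "pw_diff \<tau> R a a_t a_x" "pw_diff \<tau> R b b_t b_x"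
  shows "pw_diff \<tau> R (\<lambda>z. a z - b z) (\<lambda>z. a_t z - b_t z) (\<lambda>z. a_x z - b_x z)"
  using pw_diff_add[OF assms(1) pw_diff_cmult[OF assms(2), of "-1"]] by simp

section \<open>Integration of piecewise derivatives over segments and rectangles\<close>

lemma set_integrable_bounded_real:
  fixes g :: "real \<Rightarrow> real"
  assumes "g \<in> borel_measurable borel" "\<And>x. x \<in> {a..b} \<Longrightarrow> \<bar>g x\<bar> \<le> M"
  shows "set_integrable lborel {a..b} g"
  unfolding set_integrable_def
  by (rule integrableI_bounded_set[where A = "{a..b}" and B = M])
    (use assms in \<open>auto simp: emeasure_lborel_Icc_eq\<close>)

lemma integral_of_piecewise_derivative:
  fixes g g' :: "real \<Rightarrow> real"
  assumes "a \<le> b" "continuous_on {a..b} g" "finite S"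
    and "\<And>x. x \<in> {a<..<b} - S \<Longrightarrow> (g has_real_derivative g' x) (at x)"
    and "set_integrable lborel {a..b} g'"
  shows "(LINT x:{a..b}|lborel. g' x) = g b - g a"
proof -
  have "(g' has_integral (g b - g a)) {a..b}"
    using assms by (intro fundamental_theorem_of_calculus_interior_strong[where S = S])
      (auto simp: has_real_derivative_iff_has_vector_derivative)
  then show ?thesis
    using set_borel_integral_eq_integral(2)[OF assms(5)] by (simp add: integral_unique)
qed

text \<open>Fubini lets each derivative be integrated first along its own direction, where the
  fundamental theorem of calculus tolerates finitely many kinks. The flux \<open>H\<close> vanishes
  on the lateral sides, so only the two time slices remain.\<close>

theorem divergence_identity:
  assumes "0 \<le> \<tau>" "0 \<le> R"
    and G: "pw_diff \<tau> R G Gt Gx" and H: "pw_diff \<tau> R H Ht Hx"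
    and zero: "\<And>t. t \<in> {0..\<tau>} \<Longrightarrow> H (t, R) = 0 \<and> H (t, - R) = 0"
  shows "(LINT x:{-R..R}|lborel. G (\<tau>, x)) - (LINT x:{-R..R}|lborel. G (0, x)) =
      (LINT t:{0..\<tau>}|lborel. (LINT x:{-R..R}|lborel. Gt (t, x) - Hx (t, x)))"
    and "set_integrable lborel {0..\<tau>} (\<lambda>t. LINT x:{-R..R}|lborel. Gt (t, x) - Hx (t, x))"
    and "\<And>t. t \<in> {0..\<tau>} \<Longrightarrow> set_integrable lborel {-R..R} (\<lambda>x. Gt (t, x) - Hx (t, x))"
proof -
  have [measurable]: "Gt \<in> borel_measurable borel" "Hx \<in> borel_measurable borel"
      "G \<in> borel_measurable borel"
    using pw_diffD(2-4)[OF G] pw_diffD(2-4)[OF H] by auto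
  obtain M where M: "\<And>z. z \<in> {0..\<tau>} \<times> {-R..R} \<Longrightarrow> \<bar>Gt z\<bar> \<le> M"
    using pw_diffD(5)[OF G] unfolding bounded_iff by (metis imageI real_norm_def)
  obtain N where N: "\<And>z. z \<in> {0..\<tau>} \<times> {-R..R} \<Longrightarrow> \<bar>Hx z\<bar> \<le> N"
    using pw_diffD(6)[OF H] unfolding bounded_iff by (metis imageI real_norm_def)
  have int: "integrable (lborel \<Otimes>\<^sub>M lborel)
      (\<lambda>(t, x). indicator {0..\<tau>} t * indicator {-R..R} x * g (t, x))"
    if "g \<in> borel_measurable borel" "\<And>z. z \<in> {0..\<tau>} \<times> {-R..R} \<Longrightarrow> \<bar>g z\<bar> \<le> K"
    for g :: "real \<times> real \<Rightarrow> real" and K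
  proof (rule integrableI_bounded_set[where A = "{0..\<tau>} \<times> {-R..R}" and B = K])
    have [measurable]: "g \<in> borel_measurable (borel \<Otimes>\<^sub>M borel)"
      using that(1) by (simp add: borel_prod)
    show "(\<lambda>(t, x). indicator {0..\<tau>} t * indicator {-R..R} x * g (t, x))
        \<in> borel_measurable (lborel \<Otimes>\<^sub>M lborel)"
      by measurable
    show "emeasure (lborel \<Otimes>\<^sub>M lborel) ({0..\<tau>} \<times> {-R..R}) < \<infinity>"
      using \<open>0 \<le> \<tau>\<close> \<open>0 \<le> R\<close> by (simp add: lborel.emeasure_pair_measure_Times ennreal_mult_less_top)
  qed (use that in \<open>auto intro!: AE_I2 simp: indicator_def\<close>)
  have slice: "(LINT t:{0..\<tau>}|lborel. Gt (t, x)) = G (\<tau>, x) - G (0, x)" if x: "x \<in> {-R..R}" for x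
  proof -
    obtain S where "finite S"
      "\<And>t. t \<in> {0<..<\<tau>} - S \<Longrightarrow> ((\<lambda>t. G (t, x)) has_real_derivative Gt (t, x)) (at t)"
      using pw_diffE[OF G x] by blast
    moreover have "continuous_on {0..\<tau>} (\<lambda>t. G (t, x))"
      using pw_diff_continuous(2)[OF G x] .
    moreover have "set_integrable lborel {0..\<tau>} (\<lambda>t. Gt (t, x))"
      using M x by (intro set_integrable_bounded_real[where M = M]) auto
    ultimately show ?thesis
      using \<open>0 \<le> \<tau>\<close> by (intro integral_of_piecewise_derivative)
  qed
  have slice': "(LINT x:{-R..R}|lborel. Hx (t, x)) = 0" if t: "t \<in> {0..\<tau>}" for t
  proof -
    obtain S where "finite S"
      "\<And>x. x \<in> {-R<..<R} - S \<Longrightarrow> ((\<lambda>x. H (t, x)) has_real_derivative Hx (t, x)) (at x)"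
      using pw_diffE'[OF H t] by blast
    moreover have "continuous_on {-R..R} (\<lambda>x. H (t, x))"
      using pw_diff_continuous(1)[OF H t] .
    moreover have "set_integrable lborel {-R..R} (\<lambda>x. Hx (t, x))"
      using N t by (intro set_integrable_bounded_real[where M = N]) auto
    ultimately have "(LINT x:{-R..R}|lborel. Hx (t, x)) = H (t, R) - H (t, - R)"
      using \<open>0 \<le> R\<close> by (intro integral_of_piecewise_derivative) auto
    then show ?thesis using zero t by simp
  qed
  have int_slices: "set_integrable lborel {-R..R} (\<lambda>x. Gt (t, x))"
    "set_integrable lborel {-R..R} (\<lambda>x. Hx (t, x))" if "t \<in> {0..\<tau>}" for t
    using M N that
    by (intro set_integrable_bounded_real[where M = M] set_integrable_bounded_real[where M = N]; simp)+
  then show "set_integrable lborel {-R..R} (\<lambda>x. Gt (t, x) - Hx (t, x))" if "t \<in> {0..\<tau>}" for t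
    using that by (intro set_integral_diff) auto
  \<comment> \<open>The \<open>Hx\<close> part integrates to zero on every slice, so the double
    integral is that of \<open>Gt\<close> alone; the indicators give it the form to which Fubini
    applies.\<close>
  have eq: "indicator {0..\<tau>} t *\<^sub>R (LINT x:{-R..R}|lborel. Gt (t, x) - Hx (t, x)) =
      (\<integral>x. indicator {0..\<tau>} t * indicator {-R..R} x * Gt (t, x) \<partial>lborel)" for t
  proof (cases "t \<in> {0..\<tau>}")
    case True
    note int_slices[OF True]
    then have "(LINT x:{-R..R}|lborel. Gt (t, x) - Hx (t, x)) = (LINT x:{-R..R}|lborel. Gt (t, x))"
      using slice'[OF True] by (simp add: set_integral_diff(2))
    then show ?thesis
      using True by (simp add: set_lebesgue_integral_def)
  qed auto
  note I = int[of Gt M, OF _ M]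
  have "(LINT x:{-R..R}|lborel. G (\<tau>, x)) - (LINT x:{-R..R}|lborel. G (0, x)) =
      (LINT x:{-R..R}|lborel. G (\<tau>, x) - G (0, x))"
  proof (rule set_integral_diff(2)[symmetric])
    have "set_integrable lborel {-R..R} (\<lambda>x. G (t, x))" if "t \<in> {0..\<tau>}" for t
      using pw_diff_continuous(1)[OF G that] by (rule borel_integrable_atLeastAtMost')
    then show "set_integrable lborel {-R..R} (\<lambda>x. G (\<tau>, x))"
      "set_integrable lborel {-R..R} (\<lambda>x. G (0, x))"
      using \<open>0 \<le> \<tau>\<close> by auto
  qed
  also have "\<dots> = (\<integral>x. \<integral>t. indicator {0..\<tau>} t * indicator {-R..R} x * Gt (t, x) \<partial>lborel \<partial>lborel)"
    unfolding set_lebesgue_integral_def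
  proof (rule Bochner_Integration.integral_cong[OF refl])
    fix x
    show "indicator {-R..R} x *\<^sub>R (G (\<tau>, x) - G (0, x)) =
        (\<integral>t. indicator {0..\<tau>} t * indicator {-R..R} x * Gt (t, x) \<partial>lborel)"
      using slice[of x] by (cases "x \<in> {-R..R}") (auto simp: set_lebesgue_integral_def)
  qed
  also have "\<dots> = (\<integral>t. \<integral>x. indicator {0..\<tau>} t * indicator {-R..R} x * Gt (t, x) \<partial>lborel \<partial>lborel)"
    using lborel_pair.Fubini_integral[OF I] by (simp add: case_prod_unfold)
  also have "\<dots> = (LINT t:{0..\<tau>}|lborel. (LINT x:{-R..R}|lborel. Gt (t, x) - Hx (t, x)))"
    by (simp only: set_lebesgue_integral_def[of lborel "{0..\<tau>}"] eq)
  finally show "(LINT x:{-R..R}|lborel. G (\<tau>, x)) - (LINT x:{-R..R}|lborel. G (0, x)) =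
      (LINT t:{0..\<tau>}|lborel. (LINT x:{-R..R}|lborel. Gt (t, x) - Hx (t, x)))" .
  show "set_integrable lborel {0..\<tau>} (\<lambda>t. LINT x:{-R..R}|lborel. Gt (t, x) - Hx (t, x))"
    unfolding set_integrable_def eq
    using lborel_pair.integrable_fst[OF I] by simp
qed

section \<open>Multiplier identities\<close>

definition nonlin :: "real \<Rightarrow> real \<Rightarrow> real" where
  "nonlin p u = \<bar>u\<bar> powr (p - 1) * u"

definition potential :: "real \<Rightarrow> real \<Rightarrow> real" where
  "potential p u = \<bar>u\<bar> powr (p + 1) / (p + 1)"

lemma nonlin_mult_self:
  assumes "p > 1"
  shows "nonlin p u * u = (p + 1) * potential p u"
proof -
  have "\<bar>u\<bar> powr (p + 1) = \<bar>u\<bar> powr ((p - 1) + 2)" by (simp add: add.commute)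
  also have "\<dots> = \<bar>u\<bar> powr (p - 1) * u\<^sup>2"
    by (cases "u = 0") (simp_all only: powr_add, simp_all)
  finally have "\<bar>u\<bar> powr (p + 1) = \<bar>u\<bar> powr (p - 1) * u\<^sup>2" .
  then show ?thesis
    using assms by (simp add: nonlin_def potential_def power2_eq_square)
qed

lemma potential_nonneg: "p > 1 \<Longrightarrow> 0 \<le> potential p u"
  by (simp add: potential_def)

lemma potential_has_derivative:
  assumes "p > 1"
  shows "(potential p has_real_derivative nonlin p u) (at u)"
proof -
  consider "u > 0" | "u < 0" | "u = 0" by linarith
  then show ?thesis
  proof cases
    case 1
    have "((\<lambda>u. u powr (p + 1) / (p + 1)) has_real_derivative (p + 1) * u powr p / (p + 1)) (at u)"
      using 1 has_real_derivative_powr[of u "p + 1"] by (intro DERIV_cdivide) simp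
    then have "((\<lambda>u. u powr (p + 1) / (p + 1)) has_real_derivative nonlin p u) (at u)"
      using 1 assms by (simp add: nonlin_def powr_diff)
    then show ?thesis
      by (rule has_field_derivative_transform_within_open[of _ _ _ "{0<..}"])
        (use 1 in \<open>auto simp: potential_def\<close>)
  next
    case 2
    have "((\<lambda>u. (- u) powr (p + 1) / (p + 1)) has_real_derivative
        ((p + 1) * (- u) powr p * (- 1)) / (p + 1)) (at u)"
      using 2 DERIV_chain2[OF has_real_derivative_powr[of "- u" "p + 1"] DERIV_minus[OF DERIV_ident]]
      by (intro DERIV_cdivide) simp
    then have "((\<lambda>u. (- u) powr (p + 1) / (p + 1)) has_real_derivative nonlin p u) (at u)"
      using 2 assms by (simp add: nonlin_def powr_diff)
    then show ?thesis
      by (rule has_field_derivative_transform_within_open[of _ _ _ "{..<0}"])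
        (use 2 in \<open>auto simp: potential_def\<close>)
  next
    case 3
    \<comment> \<open>At the origin, where the modulus has a kink, the difference quotient has
      absolute value \<open>|h|^p / (p + 1)\<close>.\<close>
    have "((\<lambda>h::real. \<bar>h\<bar> powr p / (p + 1)) \<longlongrightarrow> \<bar>0\<bar> powr p / (p + 1)) (at 0)"
      using assms by (intro tendsto_intros) auto
    moreover have "\<bar>h\<bar> powr p / (p + 1) = \<bar>potential p h / h\<bar>" for h
      using assms by (cases "h = 0") (auto simp: potential_def powr_add abs_mult)
    ultimately have "((\<lambda>h. potential p h / h) \<longlongrightarrow> 0) (at 0)"
      by (intro tendsto_rabs_zero_cancel[of "\<lambda>h. potential p h / h"]) (use assms in simp)
    then show ?thesis
      using 3 assms by (simp add: DERIV_def potential_def nonlin_def)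
  qed
qed

lemma continuous_on_nonlin: "p > 1 \<Longrightarrow> continuous_on S f \<Longrightarrow> continuous_on S (\<lambda>z. nonlin p (f z))"
  unfolding nonlin_def by (intro continuous_intros continuous_on_powr') auto

lemma continuous_on_potential: "p > 1 \<Longrightarrow> continuous_on S f \<Longrightarrow> continuous_on S (\<lambda>z. potential p (f z))"
  unfolding potential_def by (intro continuous_intros continuous_on_powr') auto

lemma square_le_potential:
  assumes "p > 1"
  shows "u\<^sup>2 \<le> 1 + (p + 1) * potential p u"
proof (cases "\<bar>u\<bar> \<le> 1")
  case True
  then have "u\<^sup>2 \<le> 1" by (simp add: abs_square_le_1)
  then show ?thesis using potential_nonneg[OF assms, of u] assms by (simp add: add_increasing2)
next
  case False
  then have "\<bar>u\<bar> powr 2 \<le> \<bar>u\<bar> powr (p + 1)"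
    using assms by (intro powr_mono) auto
  then show ?thesis using assms False by (simp add: potential_def)
qed

text \<open>A classical solution up to an error \<open>\<delta>\<close> in the nonlinearity on \<open>[0, R] \<times> [-R, R]\<close>; the
  mollifications of a finite energy solution are of this kind.\<close>

locale regular_solution =
  fixes p \<delta> R E :: real and u u_t u_x u_tt u_tx u_xx f :: "real \<times> real \<Rightarrow> real"
  assumes p: "p > 1" and \<delta>: "\<delta> \<ge> 0" and R: "R > 0"
    and cont: "continuous_on UNIV u" "continuous_on UNIV u_t" "continuous_on UNIV u_x"
      "continuous_on UNIV u_tt" "continuous_on UNIV u_tx" "continuous_on UNIV u_xx"
      "continuous_on UNIV f"
    and der: "\<And>t x. ((\<lambda>t. u (t, x)) has_real_derivative u_t (t, x)) (at t)"
      "\<And>t x. ((\<lambda>x. u (t, x)) has_real_derivative u_x (t, x)) (at x)"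
      "\<And>t x. ((\<lambda>t. u_t (t, x)) has_real_derivative u_tt (t, x)) (at t)"
      "\<And>t x. ((\<lambda>x. u_t (t, x)) has_real_derivative u_tx (t, x)) (at x)"
      "\<And>t x. ((\<lambda>t. u_x (t, x)) has_real_derivative u_tx (t, x)) (at t)"
      "\<And>t x. ((\<lambda>x. u_x (t, x)) has_real_derivative u_xx (t, x)) (at x)"
    and wave: "\<And>z. u_tt z - u_xx z = - f z"
    and source: "\<And>z. z \<in> {0..R} \<times> {-R..R} \<Longrightarrow> \<bar>f z - nonlin p (u z)\<bar> \<le> \<delta>"
    and initial: "(LINT x:{-R..R}|lborel. ((u_t (0, x))\<^sup>2 + (u_x (0, x))\<^sup>2) / 2 + potential p (u (0, x))) \<le> E"
begin

definition V where "V z = potential p (u z)"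
text \<open>Energy density; squares are written as products so that \<open>pw_diff_mult\<close>
  applies syntactically.\<close>

definition e where "e z = (u_t z * u_t z + u_x z * u_x z) / 2 + V z"
definition m where "m z = u_t z * u_x z"
definition r where "r z = f z - nonlin p (u z)"

lemma V_nonneg: "0 \<le> V z"
  using potential_nonneg[OF p] by (simp add: V_def)

lemma e_ge_m: "\<bar>m z\<bar> + V z \<le> e z"
proof -
  have "0 \<le> (u_t z - u_x z)\<^sup>2" "0 \<le> (u_t z + u_x z)\<^sup>2" by simp_all
  then show ?thesis
    unfolding e_def m_def power2_eq_square by (simp add: algebra_simps abs_le_iff)
qed

lemma e_nonneg: "0 \<le> e z"
  using e_ge_m[of z] V_nonneg[of z] by linarith

lemma continuous_energy: "continuous_on S V" "continuous_on S e"
proof -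
  show V: "continuous_on S V" for S
    unfolding V_def using continuous_on_subset[OF cont(1)] p
    by (intro continuous_on_potential) auto
  show "continuous_on S e"
    unfolding e_def using cont(2,3)[THEN continuous_on_subset, OF subset_UNIV]
    by (intro continuous_intros V) auto
qed

lemma pw_diff_u: "pw_diff \<tau> \<rho> u u_t u_x" "pw_diff \<tau> \<rho> u_t u_tt u_tx" "pw_diff \<tau> \<rho> u_x u_tx u_xx"
  using cont der by (auto intro: pw_diff_C1)

lemma pw_diff_V: "pw_diff \<tau> \<rho> V (\<lambda>z. nonlin p (u z) * u_t z) (\<lambda>z. nonlin p (u z) * u_x z)"
  unfolding V_def
proof (rule pw_diff_C1)
  show "((\<lambda>t. potential p (u (t, x))) has_real_derivative nonlin p (u (t, x)) * u_t (t, x)) (at t)" for t x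
    using DERIV_chain2[OF potential_has_derivative[OF p] der(1)] .
  show "((\<lambda>x. potential p (u (t, x))) has_real_derivative nonlin p (u (t, x)) * u_x (t, x)) (at x)" for t x
    using DERIV_chain2[OF potential_has_derivative[OF p] der(2)] .
qed (intro continuous_intros continuous_on_potential continuous_on_nonlin cont p)+

lemma pw_diff_e:
  "pw_diff \<tau> \<rho> e (\<lambda>z. u_t z * u_tt z + u_x z * u_tx z + nonlin p (u z) * u_t z)
     (\<lambda>z. u_t z * u_tx z + u_x z * u_xx z + nonlin p (u z) * u_x z)"
proof -
  have "pw_diff \<tau> \<rho> (\<lambda>z. (1 / 2) * (u_t z * u_t z + u_x z * u_x z) + V z)
      (\<lambda>z. (1 / 2) * ((u_tt z * u_t z + u_tt z * u_t z) + (u_tx z * u_x z + u_tx z * u_x z))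
        + nonlin p (u z) * u_t z)
      (\<lambda>z. (1 / 2) * ((u_tx z * u_t z + u_tx z * u_t z) + (u_xx z * u_x z + u_xx z * u_x z))
        + nonlin p (u z) * u_x z)"
    by (intro pw_diff_add pw_diff_cmult pw_diff_mult pw_diff_u pw_diff_V)
  moreover have "(1 / 2) * (u_t z * u_t z + u_x z * u_x z) + V z = e z"
    "(1 / 2) * ((u_tt z * u_t z + u_tt z * u_t z) + (u_tx z * u_x z + u_tx z * u_x z))
        + nonlin p (u z) * u_t z = u_t z * u_tt z + u_x z * u_tx z + nonlin p (u z) * u_t z"
    "(1 / 2) * ((u_tx z * u_t z + u_tx z * u_t z) + (u_xx z * u_x z + u_xx z * u_x z))
        + nonlin p (u z) * u_x z = u_t z * u_tx z + u_x z * u_xx z + nonlin p (u z) * u_x z" for z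
    by (simp_all add: e_def algebra_simps)
  ultimately show ?thesis by (simp only:)
qed

lemma pw_diff_m:
  "pw_diff \<tau> \<rho> m (\<lambda>z. u_tt z * u_x z + u_tx z * u_t z) (\<lambda>z. u_tx z * u_x z + u_xx z * u_t z)"
  unfolding m_def[abs_def] by (intro pw_diff_mult pw_diff_u)

text \<open>The energy-momentum identity for the multiplier
  \<open>a \<partial>\<^sub>t u + b \<partial>\<^sub>x u + w u\<close>.\<close>

definition bulk where
  "bulk a_t a_x b_t b_x w w_t w_x a b z =
     (a_t z - b_x z) * e z + (b_t z - a_x z) * m z + 2 * b_x z * V z
     + w z * ((u_t z)\<^sup>2 - (u_x z)\<^sup>2 - (p + 1) * V z) + u z * (w_t z * u_t z - w_x z * u_x z)
     - r z * (a z * u_t z + b z * u_x z + w z * u z)"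

text \<open>Combines three balance laws: \<open>e_t = m_x - r u_t\<close>,
  \<open>m_t = (e - 2 V)_x - r u_x\<close>, and
  \<open>(u u_t)_t = (u u_x)_x + u_t^2 - u_x^2 - (p + 1) V - r u\<close>. Weighting them by
  \<open>a\<close>, \<open>b\<close>, \<open>w\<close> gives the density \<open>Q\<close>, the flux
  \<open>P\<close> below, and as remainder \<open>bulk\<close>.\<close>

lemma multiplier_identity:
  assumes "0 \<le> \<tau>" "0 \<le> \<rho>"
    and a: "pw_diff \<tau> \<rho> a a_t a_x" and b: "pw_diff \<tau> \<rho> b b_t b_x" and w: "pw_diff \<tau> \<rho> w w_t w_x"
    and zero: "\<forall>t\<in>{0..\<tau>}. \<forall>x. \<bar>x\<bar> = \<rho> \<longrightarrow> a (t, x) = 0 \<and> b (t, x) = 0 \<and> w (t, x) = 0"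
  defines "Q z \<equiv> a z * e z + b z * m z + w z * (u z * u_t z)"
  shows "(LINT x:{-\<rho>..\<rho>}|lborel. Q (\<tau>, x)) - (LINT x:{-\<rho>..\<rho>}|lborel. Q (0, x)) =
      (LINT t:{0..\<tau>}|lborel. (LINT x:{-\<rho>..\<rho>}|lborel. bulk a_t a_x b_t b_x w w_t w_x a b (t, x)))"
    and "set_integrable lborel {0..\<tau>}
      (\<lambda>t. LINT x:{-\<rho>..\<rho>}|lborel. bulk a_t a_x b_t b_x w w_t w_x a b (t, x))"
    and "\<And>t. t \<in> {0..\<tau>} \<Longrightarrow>
      set_integrable lborel {-\<rho>..\<rho>} (\<lambda>x. bulk a_t a_x b_t b_x w w_t w_x a b (t, x))"
    and "\<And>t. t \<in> {0..\<tau>} \<Longrightarrow> set_integrable lborel {-\<rho>..\<rho>} (\<lambda>x. Q (t, x))"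
proof -
  define P where "P z = a z * m z + b z * (e z - 2 * V z) + w z * (u z * u_x z)" for z
  have Q: "pw_diff \<tau> \<rho> Q
      (\<lambda>z. (a_t z * e z + (u_t z * u_tt z + u_x z * u_tx z + nonlin p (u z) * u_t z) * a z) +
         (b_t z * m z + (u_tt z * u_x z + u_tx z * u_t z) * b z) +
         (w_t z * (u z * u_t z) + (u_t z * u_t z + u_tt z * u z) * w z))
      (\<lambda>z. (a_x z * e z + (u_t z * u_tx z + u_x z * u_xx z + nonlin p (u z) * u_x z) * a z) +
         (b_x z * m z + (u_tx z * u_x z + u_xx z * u_t z) * b z) +
         (w_x z * (u z * u_t z) + (u_x z * u_t z + u_tx z * u z) * w z))"
    (is "pw_diff _ _ _ ?Qt _")
    unfolding Q_def by (intro pw_diff_add pw_diff_mult pw_diff_e pw_diff_m pw_diff_u a b w)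
  have P: "pw_diff \<tau> \<rho> P
      (\<lambda>z. (a_t z * m z + (u_tt z * u_x z + u_tx z * u_t z) * a z) +
         (b_t z * (e z - 2 * V z) + (u_t z * u_tt z + u_x z * u_tx z + nonlin p (u z) * u_t z
             - 2 * (nonlin p (u z) * u_t z)) * b z) +
         (w_t z * (u z * u_x z) + (u_t z * u_x z + u_tx z * u z) * w z))
      (\<lambda>z. (a_x z * m z + (u_tx z * u_x z + u_xx z * u_t z) * a z) +
         (b_x z * (e z - 2 * V z) + (u_t z * u_tx z + u_x z * u_xx z + nonlin p (u z) * u_x z
             - 2 * (nonlin p (u z) * u_x z)) * b z) +
         (w_x z * (u z * u_x z) + (u_x z * u_x z + u_xx z * u z) * w z))"
    (is "pw_diff _ _ _ _ ?Px")
    unfolding P_def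
    by (intro pw_diff_add pw_diff_diff pw_diff_cmult pw_diff_mult pw_diff_e pw_diff_m pw_diff_u pw_diff_V a b w)
  have eq: "?Qt z - ?Px z = bulk a_t a_x b_t b_x w w_t w_x a b z" for z
  proof -
    have u_tt: "u_tt z = u_xx z - f z" using wave[of z] by simp
    \<comment> \<open>All terms cancel algebraically except the potential term weighted by
      \<open>w\<close>, which needs the homogeneity
      \<open>nonlin p u * u = (p + 1) * potential p u\<close>.\<close>
    have "?Qt z - ?Px z - bulk a_t a_x b_t b_x w w_t w_x a b z =
        w z * ((p + 1) * V z - nonlin p (u z) * u z)"
      unfolding bulk_def e_def m_def r_def u_tt by (simp add: field_simps power2_eq_square)
    then show ?thesis
      using nonlin_mult_self[OF p] by (simp add: V_def)
  qed
  have "P (t, \<rho>) = 0 \<and> P (t, - \<rho>) = 0" if "t \<in> {0..\<tau>}" for t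
    using zero that \<open>0 \<le> \<rho>\<close> by (simp add: P_def)
  from divergence_identity[OF \<open>0 \<le> \<tau>\<close> \<open>0 \<le> \<rho>\<close> Q P this]
  show "(LINT x:{-\<rho>..\<rho>}|lborel. Q (\<tau>, x)) - (LINT x:{-\<rho>..\<rho>}|lborel. Q (0, x)) =
      (LINT t:{0..\<tau>}|lborel. (LINT x:{-\<rho>..\<rho>}|lborel. bulk a_t a_x b_t b_x w w_t w_x a b (t, x)))"
    "set_integrable lborel {0..\<tau>}
      (\<lambda>t. LINT x:{-\<rho>..\<rho>}|lborel. bulk a_t a_x b_t b_x w w_t w_x a b (t, x))"
    "\<And>t. t \<in> {0..\<tau>} \<Longrightarrow>
      set_integrable lborel {-\<rho>..\<rho>} (\<lambda>x. bulk a_t a_x b_t b_x w w_t w_x a b (t, x))"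
    unfolding eq by auto
  show "set_integrable lborel {-\<rho>..\<rho>} (\<lambda>x. Q (t, x))" if "t \<in> {0..\<tau>}" for t
    by (rule borel_integrable_atLeastAtMost'[OF pw_diff_continuous(1)[OF Q that]])
qed

end

section \<open>The multiplier\<close>

text \<open>The level sets \<open>t + |x| = const\<close> are characteristic, so
  \<open>|cutoff_x| <= - cutoff_t\<close>. Hence the energy flux produced by differentiating the
  cutoff is dominated by the energy it removes.\<close>

definition cutoff where "cutoff \<rho> z = max 0 (1 - (fst z + \<bar>snd z\<bar>) / \<rho>)" for \<rho> :: real and z :: "real \<times> real"
definition cutoff_t where "cutoff_t \<rho> z = (if fst z + \<bar>snd z\<bar> < \<rho> then - 1 / \<rho> else 0)" for \<rho> :: real and z :: "real \<times> real"
definition cutoff_x where "cutoff_x \<rho> z = (if fst z + \<bar>snd z\<bar> < \<rho> then - sgn (snd z) / \<rho> else 0)" for \<rho> :: real and z :: "real \<times> real"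

definition \<theta> where "\<theta> z = 1 / (fst z + 1)" for z :: "real \<times> real"
definition \<sigma> where "\<sigma> z = max (- 1) (min 1 (snd z / (fst z + 1)))" for z :: "real \<times> real"
definition \<sigma>_t where "\<sigma>_t z = (if \<bar>snd z\<bar> < fst z + 1 then - snd z / (fst z + 1)\<^sup>2 else 0)" for z :: "real \<times> real"
definition \<sigma>_x where "\<sigma>_x z = (if \<bar>snd z\<bar> < fst z + 1 then 1 / (fst z + 1) else 0)" for z :: "real \<times> real"

lemma clamp_eq: "\<bar>q\<bar> \<le> 1 \<Longrightarrow> max (- 1) (min 1 q) = q" for q :: real
  by auto

lemma pw_diff_cutoff:
  assumes \<rho>: "\<rho> > 0"
  shows "pw_diff \<tau> R (cutoff \<rho>) (cutoff_t \<rho>) (cutoff_x \<rho>)"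
proof (rule pw_diffI[where M = "1 / \<rho>" and S = "\<lambda>x. {\<rho> - \<bar>x\<bar>}" and S' = "\<lambda>t. {0, \<rho> - t, t - \<rho>}"])
  show "continuous_on ({0..\<tau>} \<times> {-R..R}) (cutoff \<rho>)"
    unfolding cutoff_def[abs_def] using \<rho> by (intro continuous_intros) auto
  show "cutoff \<rho> \<in> borel_measurable borel" "cutoff_t \<rho> \<in> borel_measurable borel"
    unfolding cutoff_def[abs_def] cutoff_t_def[abs_def] borel_prod[symmetric] by measurable
  have [measurable]: "(sgn :: real \<Rightarrow> real) \<in> borel_measurable borel"
    unfolding sgn_real_def[abs_def] by measurable
  show "cutoff_x \<rho> \<in> borel_measurable borel"
    unfolding cutoff_x_def[abs_def] borel_prod[symmetric] by measurable
  show "\<bar>cutoff_t \<rho> z\<bar> \<le> 1 / \<rho>" "\<bar>cutoff_x \<rho> z\<bar> \<le> 1 / \<rho>" for z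
    using \<rho> by (auto simp: cutoff_t_def cutoff_x_def abs_sgn_eq divide_simps)
next
  fix t x assume t: "t \<in> {0<..<\<tau>} - {\<rho> - \<bar>x\<bar>}"
  show "((\<lambda>t. cutoff \<rho> (t, x)) has_real_derivative cutoff_t \<rho> (t, x)) (at t)"
  proof (cases "t + \<bar>x\<bar> < \<rho>")
    case True
    have "((\<lambda>t. 1 - (t + \<bar>x\<bar>) / \<rho>) has_real_derivative 0 - (1 + 0) / \<rho>) (at t)"
      by (intro DERIV_diff DERIV_const DERIV_cdivide DERIV_add DERIV_ident)
    then have "((\<lambda>t. 1 - (t + \<bar>x\<bar>) / \<rho>) has_real_derivative cutoff_t \<rho> (t, x)) (at t)"
      using True by (simp add: cutoff_t_def)
    then show ?thesis
      by (rule has_field_derivative_transform_within_open[of _ _ _ "{..<\<rho> - \<bar>x\<bar>}"])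
        (use True \<rho> in \<open>auto simp: cutoff_def field_simps max_def\<close>)
  next
    case False
    have "((\<lambda>t. 0) has_real_derivative cutoff_t \<rho> (t, x)) (at t)"
      using False by (simp add: cutoff_t_def)
    then show ?thesis
      by (rule has_field_derivative_transform_within_open[of _ _ _ "{\<rho> - \<bar>x\<bar><..}"])
        (use False t \<rho> in \<open>auto simp: cutoff_def field_simps max_def\<close>)
  qed
next
  fix t x assume x: "x \<in> {-R<..<R} - {0, \<rho> - t, t - \<rho>}"
  show "((\<lambda>x. cutoff \<rho> (t, x)) has_real_derivative cutoff_x \<rho> (t, x)) (at x)"
  proof (cases "t + \<bar>x\<bar> < \<rho>")
    case True
    \<comment> \<open>Near \<open>x\<close>, which is not 0, the modulus of \<open>y\<close> is the
      linear function \<open>sgn x * y\<close>.\<close>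
    have "((\<lambda>y. 1 - (t + sgn x * y) / \<rho>) has_real_derivative 0 - (0 + sgn x * 1) / \<rho>) (at x)"
      by (intro DERIV_diff DERIV_const DERIV_cdivide DERIV_add DERIV_cmult DERIV_ident)
    then have "((\<lambda>y. 1 - (t + sgn x * y) / \<rho>) has_real_derivative cutoff_x \<rho> (t, x)) (at x)"
      using True by (simp add: cutoff_x_def)
    moreover have "open {y. 0 < sgn x * y \<and> t + \<bar>y\<bar> < \<rho>}"
      by (intro open_Collect_conj open_Collect_less continuous_intros)
    moreover have "x \<in> {y. 0 < sgn x * y \<and> t + \<bar>y\<bar> < \<rho>}"
      using x True by (simp flip: abs_sgn add: mult.commute)
    moreover have "1 - (t + sgn x * y) / \<rho> = cutoff \<rho> (t, y)"
      if "y \<in> {y. 0 < sgn x * y \<and> t + \<bar>y\<bar> < \<rho>}" for y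
    proof -
      have "sgn x * y = \<bar>y\<bar>" using that by (auto simp: sgn_real_def split: if_splits)
      then show ?thesis using that \<rho> by (simp add: cutoff_def field_simps)
    qed
    ultimately show ?thesis
      by (rule has_field_derivative_transform_within_open)
  next
    case False
    have "((\<lambda>t. 0) has_real_derivative cutoff_x \<rho> (t, x)) (at x)"
      using False by (simp add: cutoff_x_def)
    moreover have "open {y. \<rho> - t < \<bar>y\<bar>}"
      by (intro open_Collect_less continuous_intros)
    moreover have "x \<in> {y. \<rho> - t < \<bar>y\<bar>}"
      using x False by auto
    moreover have "0 = cutoff \<rho> (t, y)" if "y \<in> {y. \<rho> - t < \<bar>y\<bar>}" for y
      using that \<rho> by (auto simp: cutoff_def max_def field_simps)
    ultimately show ?thesis
      by (rule has_field_derivative_transform_within_open)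
  qed
qed auto

lemma pw_diff_\<theta>: "pw_diff \<tau> R \<theta> (\<lambda>z. - (\<theta> z)\<^sup>2) (\<lambda>z. 0)"
proof (rule pw_diffI[where M = 1 and S = "\<lambda>x. {}" and S' = "\<lambda>t. {}"])
  show "continuous_on ({0..\<tau>} \<times> {-R..R}) \<theta>"
    unfolding \<theta>_def[abs_def] by (intro continuous_intros) auto
  show "\<theta> \<in> borel_measurable borel" "(\<lambda>z. - (\<theta> z)\<^sup>2) \<in> borel_measurable borel"
    unfolding \<theta>_def[abs_def] borel_prod[symmetric] by measurable
  show "\<bar>- (\<theta> z)\<^sup>2\<bar> \<le> 1" if "z \<in> {0..\<tau>} \<times> {-R..R}" for z
    using that by (auto simp: \<theta>_def power_divide divide_simps)
  show "((\<lambda>t. \<theta> (t, x)) has_real_derivative - (\<theta> (t, x))\<^sup>2) (at t)"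
    if "t \<in> {0<..<\<tau>} - {}" for t x
    using that by (auto intro!: derivative_eq_intros simp: \<theta>_def power2_eq_square)
  show "((\<lambda>x. \<theta> (t, x)) has_real_derivative 0) (at x)" for t x
    by (simp add: \<theta>_def)
qed auto

lemma pw_diff_\<sigma>: "pw_diff \<tau> R \<sigma> \<sigma>_t \<sigma>_x"
proof (rule pw_diffI[where M = 1 and S = "\<lambda>x. {\<bar>x\<bar> - 1}" and S' = "\<lambda>t. {t + 1, - (t + 1)}"])
  show "continuous_on ({0..\<tau>} \<times> {-R..R}) \<sigma>"
    unfolding \<sigma>_def[abs_def] by (intro continuous_intros) auto
  show "\<sigma> \<in> borel_measurable borel" "\<sigma>_t \<in> borel_measurable borel" "\<sigma>_x \<in> borel_measurable borel"
    unfolding \<sigma>_def[abs_def] \<sigma>_t_def[abs_def] \<sigma>_x_def[abs_def] borel_prod[symmetric] by measurable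
  show "\<bar>\<sigma>_x z\<bar> \<le> 1" if "z \<in> {0..\<tau>} \<times> {-R..R}" for z
    using that by (auto simp: \<sigma>_x_def)
  show "\<bar>\<sigma>_t z\<bar> \<le> 1" if "z \<in> {0..\<tau>} \<times> {-R..R}" for z
  proof (cases "\<bar>snd z\<bar> < fst z + 1")
    case True
    have "fst z + 1 \<le> (fst z + 1)\<^sup>2" using that by (auto simp: power2_eq_square)
    then have "\<bar>snd z\<bar> \<le> (fst z + 1)\<^sup>2" using True by linarith
    moreover have "0 < (fst z + 1)\<^sup>2" using that by (auto simp: zero_less_power2)
    ultimately show ?thesis
      using True by (simp add: \<sigma>_t_def)
  qed (simp add: \<sigma>_t_def)
next
  fix t x assume t: "t \<in> {0<..<\<tau>} - {\<bar>x\<bar> - 1}"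
  show "((\<lambda>t. \<sigma> (t, x)) has_real_derivative \<sigma>_t (t, x)) (at t)"
  proof (cases "\<bar>x\<bar> < t + 1")
    case True
    have "((\<lambda>t. x / (t + 1)) has_real_derivative \<sigma>_t (t, x)) (at t)"
      using t True by (auto intro!: derivative_eq_intros simp: \<sigma>_t_def power2_eq_square)
    then show ?thesis
    proof (rule has_field_derivative_transform_within_open[of _ _ _ "{\<bar>x\<bar> - 1<..}"])
      show "x / (s + 1) = \<sigma> (s, x)" if "s \<in> {\<bar>x\<bar> - 1<..}" for s
      proof -
        have "\<bar>x / (s + 1)\<bar> \<le> 1" using that by (simp add: abs_divide)
        then show ?thesis by (simp add: \<sigma>_def clamp_eq del: abs_divide)
      qed
    qed (use True t in auto)
  next
    case False
    have "((\<lambda>t. sgn x) has_real_derivative \<sigma>_t (t, x)) (at t)"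
      using False by (simp add: \<sigma>_t_def)
    then show ?thesis
    proof (rule has_field_derivative_transform_within_open[of _ _ _ "{0<..<\<bar>x\<bar> - 1}"])
      show "sgn x = \<sigma> (s, x)" if "s \<in> {0<..<\<bar>x\<bar> - 1}" for s
        using that by (auto simp: \<sigma>_def sgn_real_def max_def min_def field_simps abs_if split: if_splits)
    qed (use False t in auto)
  qed
next
  fix t x assume t: "t \<in> {0..\<tau>}" and x: "x \<in> {-R<..<R} - {t + 1, - (t + 1)}"
  show "((\<lambda>x. \<sigma> (t, x)) has_real_derivative \<sigma>_x (t, x)) (at x)"
  proof (cases "\<bar>x\<bar> < t + 1")
    case True
    have "((\<lambda>x. x / (t + 1)) has_real_derivative \<sigma>_x (t, x)) (at x)"
      using t True by (auto intro!: derivative_eq_intros simp: \<sigma>_x_def)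
    then show ?thesis
    proof (rule has_field_derivative_transform_within_open[of _ _ _ "{-(t + 1)<..<t + 1}"])
      show "y / (t + 1) = \<sigma> (t, y)" if "y \<in> {-(t + 1)<..<t + 1}" for y
      proof -
        have "\<bar>y / (t + 1)\<bar> \<le> 1" using that t by (simp add: abs_divide abs_le_iff)
        then show ?thesis by (simp add: \<sigma>_def clamp_eq del: abs_divide)
      qed
    qed (use True in auto)
  next
    case False
    have "((\<lambda>y. sgn x) has_real_derivative \<sigma>_x (t, x)) (at x)"
      using False by (simp add: \<sigma>_x_def)
    moreover have "open {y. t + 1 < sgn x * y}"
      by (intro open_Collect_less continuous_intros)
    moreover have "x \<in> {y. t + 1 < sgn x * y}"
      using x t False by (auto simp: sgn_real_def)
    moreover have "sgn x = \<sigma> (t, y)" if "y \<in> {y. t + 1 < sgn x * y}" for y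
      using that t
      by (auto simp: \<sigma>_def sgn_real_def max_def min_def field_simps split: if_splits)
    ultimately show ?thesis
      by (rule has_field_derivative_transform_within_open)
  qed
qed auto

lemma cutoff_range:
  assumes "\<rho> > 0" "0 \<le> fst z"
  shows "0 \<le> cutoff \<rho> z" "cutoff \<rho> z \<le> 1" "fst z + \<bar>snd z\<bar> \<ge> \<rho> \<Longrightarrow> cutoff \<rho> z = 0"
    "fst z + \<bar>snd z\<bar> \<le> \<rho> / 2 \<Longrightarrow> 1 / 2 \<le> cutoff \<rho> z"
  using assms by (auto simp: cutoff_def max_def field_simps)

lemma \<sigma>_le_1: "\<bar>\<sigma> z\<bar> \<le> 1"
  by (auto simp: \<sigma>_def)

lemma \<sigma>_inside:
  assumes "\<bar>snd z\<bar> < fst z + 1"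
  shows "\<sigma> z = snd z * \<theta> z" "\<sigma>_t z = - \<sigma> z * \<theta> z" "\<sigma>_x z = \<theta> z"
proof -
  have "\<bar>snd z / (fst z + 1)\<bar> \<le> 1" using assms by (simp add: abs_divide)
  then show "\<sigma> z = snd z * \<theta> z" by (simp add: \<sigma>_def \<theta>_def clamp_eq del: abs_divide)
  then show "\<sigma>_t z = - \<sigma> z * \<theta> z" "\<sigma>_x z = \<theta> z"
    using assms by (simp_all add: \<sigma>_t_def \<sigma>_x_def \<theta>_def power2_eq_square)
qed

lemma \<sigma>_outside:
  assumes "0 \<le> fst z" "\<not> \<bar>snd z\<bar> < fst z + 1"
  shows "(\<sigma> z)\<^sup>2 = 1" "\<sigma>_t z = 0" "\<sigma>_x z = 0"
proof -
  have "\<sigma> z = 1 \<or> \<sigma> z = - 1"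
    using assms by (auto simp: \<sigma>_def max_def min_def field_simps abs_if split: if_splits)
  then show "(\<sigma> z)\<^sup>2 = 1" by auto
qed (use assms in \<open>auto simp: \<sigma>_t_def \<sigma>_x_def\<close>)

lemma \<sigma>_sgn: "0 \<le> fst z \<Longrightarrow> sgn (snd z) * \<sigma> z = \<bar>\<sigma> z\<bar>"
  by (auto simp: \<sigma>_def sgn_real_def max_def min_def field_simps abs_if)

section \<open>Pointwise bound of the bulk term\<close>

lemma young_weighted:
  fixes q c a b :: real
  assumes "0 < q" "c\<^sup>2 \<le> q * d"
  shows "c * (\<bar>a\<bar> * \<bar>b\<bar>) \<le> (q * a\<^sup>2 + d * b\<^sup>2) / 2"
proof -
  have "0 \<le> (q * \<bar>a\<bar> - c * \<bar>b\<bar>)\<^sup>2" by simp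
  then have "2 * q * (c * (\<bar>a\<bar> * \<bar>b\<bar>)) \<le> q\<^sup>2 * a\<^sup>2 + c\<^sup>2 * b\<^sup>2"
    by (simp add: power2_diff power_mult_distrib algebra_simps)
  also have "\<dots> \<le> q\<^sup>2 * a\<^sup>2 + (q * d) * b\<^sup>2"
    using assms(2) by (intro add_left_mono mult_right_mono) auto
  finally have "q * (2 * (c * (\<bar>a\<bar> * \<bar>b\<bar>))) \<le> q * (q * a\<^sup>2 + d * b\<^sup>2)"
    by (simp add: power2_eq_square algebra_simps)
  then show ?thesis using assms(1) by (simp add: mult_le_cancel_left_pos)
qed

text \<open>Here \<open>c\<close> and \<open>k\<close> stand for the indicators of the cone \<open>\<bar>x\<bar> < t + 1\<close> and of the support
  of the cutoff \<open>\<kappa>\<close>, \<open>g\<close> for the sign of \<open>x\<close>, \<open>s\<close> for \<open>\<sigma>\<close> and \<open>h\<close> for \<open>\<theta>\<close>. The kinetic part of the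
  bulk term collapses to the square \<open>(s u\<^sub>t + u\<^sub>x)\<^sup>2\<close>.\<close>

lemma bulk_estimate:
  fixes p \<delta> \<rho> h s g c k \<kappa> u ut ux V r q :: real
  defines "e \<equiv> (ut * ut + ux * ux) / 2 + V" and "m \<equiv> ut * ux"
  defines "\<alpha> \<equiv> (1 + s\<^sup>2) / 2" and "\<omega> \<equiv> (1 - s\<^sup>2) * h / 2"
  defines "st \<equiv> - c * s * h" and "sx \<equiv> c * h" and "\<kappa>t \<equiv> - k / \<rho>" and "\<kappa>x \<equiv> - k * g / \<rho>"
  defines "\<omega>t \<equiv> - s * st * h - (1 - s\<^sup>2) * h\<^sup>2 / 2" and "\<omega>x \<equiv> - s * sx * h"
  assumes p: "p > 1" and h: "0 < h" "h \<le> 1" and \<rho>: "1 / \<rho> \<le> h" "\<rho> > 0" and s: "\<bar>s\<bar> \<le> 1"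
    and c: "c = 1 \<or> c = 0 \<and> s\<^sup>2 = 1" and k: "k = 1 \<or> k = 0 \<and> \<kappa> = 0" and \<kappa>: "0 \<le> \<kappa>" "\<kappa> \<le> 1"
    and g: "\<bar>g\<bar> \<le> 1" "g * s = \<bar>s\<bar>"
    and V: "0 \<le> V" "u\<^sup>2 \<le> 1 + (p + 1) * V" and r: "\<bar>r\<bar> \<le> \<delta>" and q: "0 < q" "q\<^sup>2 * h = h ^ 4"
  shows "\<kappa>t * (\<alpha> * e + s * m + \<omega> * (u * ut)) - \<kappa>x * (\<alpha> * m + s * (e - 2 * V) + \<omega> * (u * ux))
     + \<kappa> * ((s * st - sx) * e + (st - s * sx) * m + 2 * sx * V + \<omega> * (ut\<^sup>2 - ux\<^sup>2 - (p + 1) * V))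
     + \<kappa> * (u * (\<omega>t * ut - \<omega>x * ux)) - r * (\<kappa> * (\<alpha> * ut + s * ux + \<omega> * u))
     \<le> - ((p - 1) / 2) * (\<kappa> * ((1 - s\<^sup>2) * h) * V) + (p + 2) * (2 * q + \<delta>) * (k * e) + 2 * q * h * c + 2 * \<delta>"
proof -
  define w where "w = \<bar>u\<bar> * (\<bar>ut\<bar> + \<bar>ux\<bar>)"
  have w: "0 \<le> w" by (simp add: w_def)
  have uw: "\<bar>u * ut\<bar> + \<bar>u * ux\<bar> = w" by (simp add: w_def abs_mult algebra_simps)
  have s2: "0 \<le> s\<^sup>2" "s\<^sup>2 \<le> 1" using s by (simp_all add: abs_square_le_1)
  have k01: "0 \<le> k" "k \<le> 1" and c01: "0 \<le> c" "c \<le> 1" using k c by auto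
  have \<delta>: "0 \<le> \<delta>" using r by linarith
  have e_ge: "\<bar>m\<bar> + V \<le> e"
  proof -
    have "0 \<le> (ut - ux)\<^sup>2" "0 \<le> (ut + ux)\<^sup>2" by simp_all
    then show ?thesis
      unfolding e_def m_def power2_eq_square by (simp add: algebra_simps abs_le_iff)
  qed
  then have e0: "0 \<le> e" using V by linarith
  have \<omega>: "0 \<le> \<omega>" "\<omega> \<le> c * h / 2" "\<omega> \<le> 1 / 2"
  proof -
    show "0 \<le> \<omega>" using s2 h by (simp add: \<omega>_def)
    have "(1 - s\<^sup>2) * h \<le> c * h" using c s2 h by (intro mult_right_mono) auto
    then show "\<omega> \<le> c * h / 2" by (simp add: \<omega>_def)
    moreover have "c * h \<le> 1" using c01 h by (simp add: mult_le_one)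
    ultimately show "\<omega> \<le> 1 / 2" by simp
  qed

  \<comment> \<open>Terms with a derivative of the cutoff. Because \<open>g * s = |s|\<close>, their
    quadratic part is a negative multiple of \<open>(\<alpha> - |s|) (e - g m) + 2 |s| V\<close>,
    which is nonnegative as \<open>\<alpha> - |s| = (1 - |s|)^2 / 2\<close>. Only the zeroth-order
    part survives; \<open>1 / \<rho> <= h\<close> supplies its second power of
    \<open>h\<close>.\<close>
  have A1: "\<kappa>t * (\<alpha> * e + s * m + \<omega> * (u * ut)) - \<kappa>x * (\<alpha> * m + s * (e - 2 * V) + \<omega> * (u * ux))
      \<le> k * c * (h\<^sup>2 * w)"
  proof -
    have "s = g * \<bar>s\<bar>"
      using g by (cases "s = 0") (auto simp: abs_if split: if_splits)
    then have sm: "s * m = \<bar>s\<bar> * (g * m)" by (metis mult.assoc mult.commute)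
    have "\<kappa>t * (\<alpha> * e + s * m + \<omega> * (u * ut)) - \<kappa>x * (\<alpha> * m + s * (e - 2 * V) + \<omega> * (u * ux)) =
        - (k / \<rho>) * (\<alpha> * (e - g * m) + s * m - (g * s) * (e - 2 * V) + \<omega> * (u * ut - g * (u * ux)))"
      unfolding \<kappa>t_def \<kappa>x_def using \<rho>(2) by (simp add: field_simps)
    also have "\<dots> =
        - (k / \<rho>) * ((\<alpha> - \<bar>s\<bar>) * (e - g * m) + 2 * \<bar>s\<bar> * V + \<omega> * (u * ut - g * (u * ux)))"
      unfolding sm g(2) by (simp add: algebra_simps)
    also have "\<dots> \<le> (k / \<rho>) * (\<omega> * w)"
    proof -
      have "\<alpha> - \<bar>s\<bar> = (1 - \<bar>s\<bar>)\<^sup>2 / 2" by (simp add: \<alpha>_def power2_diff)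
      then have "0 \<le> \<alpha> - \<bar>s\<bar>" by (simp only: zero_le_power2 divide_nonneg_pos zero_less_numeral)
      moreover have "g * m \<le> \<bar>m\<bar>"
        using g(1) by (metis abs_ge_zero abs_le_D1 abs_mult mult_left_le_one_le)
      then have "0 \<le> e - g * m" using e_ge V by linarith
      ultimately have "0 \<le> (\<alpha> - \<bar>s\<bar>) * (e - g * m) + 2 * \<bar>s\<bar> * V" using V by simp
      moreover have "- (u * ut - g * (u * ux)) \<le> w"
      proof -
        have "g * (u * ux) \<le> \<bar>u * ux\<bar>"
          using g(1) by (metis abs_ge_zero abs_le_D1 abs_mult mult_left_le_one_le)
        then show ?thesis using uw by linarith
      qed
      then have "\<omega> * - (u * ut - g * (u * ux)) \<le> \<omega> * w" using \<omega> by (intro mult_left_mono)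
      ultimately have "- ((\<alpha> - \<bar>s\<bar>) * (e - g * m) + 2 * \<bar>s\<bar> * V + \<omega> * (u * ut - g * (u * ux))) \<le> \<omega> * w"
        by linarith
      then have "(k / \<rho>) * - ((\<alpha> - \<bar>s\<bar>) * (e - g * m) + 2 * \<bar>s\<bar> * V + \<omega> * (u * ut - g * (u * ux)))
          \<le> (k / \<rho>) * (\<omega> * w)"
        using k01 \<rho> by (intro mult_left_mono) auto
      then show ?thesis by (simp only: mult_minus_left mult_minus_right)
    qed
    also have "\<dots> = k * ((1 / \<rho>) * \<omega>) * w" by simp
    also have "\<dots> \<le> k * (h * (c * h)) * w"
      using \<rho> \<omega> h k01 w c01 by (intro mult_right_mono mult_left_mono mult_mono) auto
    finally show ?thesis by (simp add: power2_eq_square mult_ac)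
  qed

  \<comment> \<open>Inside the cone the left side equals the right side minus
    \<open>\<kappa> h (s u_t + u_x)^2\<close>. Outside, \<open>c = 0\<close> and
    \<open>s^2 = 1\<close> make every coefficient vanish.\<close>
  have A2: "\<kappa> * ((s * st - sx) * e + (st - s * sx) * m + 2 * sx * V + \<omega> * (ut\<^sup>2 - ux\<^sup>2 - (p + 1) * V))
      \<le> - ((p - 1) / 2) * (\<kappa> * ((1 - s\<^sup>2) * h) * V)"
    using c
  proof
    assume "c = 1"
    then have "\<kappa> * ((s * st - sx) * e + (st - s * sx) * m + 2 * sx * V + \<omega> * (ut\<^sup>2 - ux\<^sup>2 - (p + 1) * V)) =
        - ((p - 1) / 2) * (\<kappa> * ((1 - s\<^sup>2) * h) * V) - \<kappa> * h * (s * ut + ux)\<^sup>2"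
      unfolding st_def sx_def e_def m_def \<omega>_def by (simp add: field_simps power2_eq_square)
    moreover have "0 \<le> \<kappa> * h * (s * ut + ux)\<^sup>2" using \<kappa> h by simp
    ultimately show ?thesis by linarith
  qed (simp add: st_def sx_def \<omega>_def)

  \<comment> \<open>The derivatives of \<omega> are of size \<open>h^2\<close> and vanish off the
    cone, where \<open>st\<close> and \<open>sx\<close> are 0 and \<open>s^2 = 1\<close>.\<close>
  have A3: "\<kappa> * (u * (\<omega>t * ut - \<omega>x * ux)) \<le> k * c * (h\<^sup>2 * w)"
  proof -
    have "\<bar>\<omega>t\<bar> \<le> c * h\<^sup>2" "\<bar>\<omega>x\<bar> \<le> c * h\<^sup>2"
    proof -
      have "\<omega>t = c * ((s\<^sup>2 - (1 - s\<^sup>2) / 2) * h\<^sup>2)"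
        using c unfolding \<omega>t_def st_def by (auto simp: power2_eq_square field_simps)
      moreover have "\<bar>s\<^sup>2 - (1 - s\<^sup>2) / 2\<bar> * h\<^sup>2 \<le> 1 * h\<^sup>2"
        using s2 by (intro mult_right_mono) (auto simp: abs_le_iff field_simps)
      ultimately show "\<bar>\<omega>t\<bar> \<le> c * h\<^sup>2"
        using c01 by (simp add: abs_mult mult_left_mono)
      have "\<bar>s\<bar> * (c * h\<^sup>2) \<le> 1 * (c * h\<^sup>2)" using s c01 by (intro mult_right_mono) auto
      then show "\<bar>\<omega>x\<bar> \<le> c * h\<^sup>2"
        using c01 h by (simp add: \<omega>x_def sx_def abs_mult power2_eq_square mult_ac)
    qed
    then have "\<bar>\<omega>t\<bar> * \<bar>u * ut\<bar> \<le> c * h\<^sup>2 * \<bar>u * ut\<bar>" "\<bar>\<omega>x\<bar> * \<bar>u * ux\<bar> \<le> c * h\<^sup>2 * \<bar>u * ux\<bar>"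
      by (auto intro!: mult_right_mono)
    then have "\<omega>t * (u * ut) \<le> c * h\<^sup>2 * \<bar>u * ut\<bar>" "- (\<omega>x * (u * ux)) \<le> c * h\<^sup>2 * \<bar>u * ux\<bar>"
      using abs_ge_self[of "\<omega>t * (u * ut)"] abs_ge_minus_self[of "\<omega>x * (u * ux)"]
      by (simp_all only: abs_mult[of \<omega>t] abs_mult[of \<omega>x])
    then have "u * (\<omega>t * ut - \<omega>x * ux) \<le> c * h\<^sup>2 * w"
      unfolding uw[symmetric] by (simp add: algebra_simps)
    then have "\<kappa> * (u * (\<omega>t * ut - \<omega>x * ux)) \<le> \<kappa> * (c * h\<^sup>2 * w)"
      using \<kappa> by (intro mult_left_mono)
    also have "\<dots> \<le> k * (c * h\<^sup>2 * w)"
      using k \<kappa> c01 w by (intro mult_right_mono) auto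
    finally show ?thesis by (simp add: mult_ac)
  qed

  \<comment> \<open>The residual multiplies quantities linear in \<open>u\<close>,
    \<open>ut\<close>, \<open>ux\<close>. Bounding them through \<open>2 |x| <= 1 + x^2\<close>
    leaves a constant besides the energy, whence the additive \<open>2 * \<delta>\<close>.\<close>
  have A4: "- (r * (\<kappa> * (\<alpha> * ut + s * ux + \<omega> * u))) \<le> 2 * \<delta> + (p + 2) * \<delta> * (k * e)"
  proof -
    have "\<bar>\<alpha> * ut + s * ux + \<omega> * u\<bar> \<le> 1 * \<bar>ut\<bar> + 1 * \<bar>ux\<bar> + 1 * \<bar>u\<bar>"
    proof -
      have "\<bar>\<alpha>\<bar> * \<bar>ut\<bar> \<le> 1 * \<bar>ut\<bar>" "\<bar>s\<bar> * \<bar>ux\<bar> \<le> 1 * \<bar>ux\<bar>" "\<bar>\<omega>\<bar> * \<bar>u\<bar> \<le> 1 * \<bar>u\<bar>"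
        using s2 s \<omega> by (intro mult_right_mono; simp add: \<alpha>_def)+
      moreover have "\<bar>\<alpha> * ut + s * ux + \<omega> * u\<bar> \<le> \<bar>\<alpha>\<bar> * \<bar>ut\<bar> + \<bar>s\<bar> * \<bar>ux\<bar> + \<bar>\<omega>\<bar> * \<bar>u\<bar>"
        unfolding abs_mult[symmetric] by linarith
      ultimately show ?thesis by linarith
    qed
    moreover have "\<bar>ut\<bar> + \<bar>ux\<bar> + \<bar>u\<bar> \<le> 2 + (e + (p + 1) * V / 2)"
    proof -
      define X where "X = (p + 1) * V"
      have *: "2 * \<bar>x\<bar> \<le> 1 + x * x" for x :: real
        using zero_le_power2[of "1 - \<bar>x\<bar>"] by (simp add: power2_eq_square algebra_simps)
      have "u * u \<le> 1 + X" using V(2) by (simp add: X_def power2_eq_square)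
      then have "\<bar>ut\<bar> + \<bar>ux\<bar> + \<bar>u\<bar> \<le> 2 + (((ut * ut + ux * ux) / 2 + V) + X / 2)"
        using V(1) *[of u] *[of ut] *[of ux] by argo
      then show ?thesis unfolding e_def X_def .
    qed
    moreover have "e + (p + 1) * V / 2 \<le> (p + 2) * e"
    proof -
      have "(p + 1) * V \<le> (p + 1) * e"
        using e_ge p by (intro mult_left_mono) auto
      then have "e + (p + 1) * V / 2 \<le> e + (p + 1) * e / 2" by simp
      also have "\<dots> = (p + 3) / 2 * e" by (simp add: field_simps)
      also have "\<dots> \<le> (p + 2) * e" using e0 p by (intro mult_right_mono) auto
      finally show ?thesis .
    qed
    ultimately have *: "\<bar>\<alpha> * ut + s * ux + \<omega> * u\<bar> \<le> 2 + (p + 2) * e"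
      by linarith
    have "- (r * (\<kappa> * (\<alpha> * ut + s * ux + \<omega> * u))) \<le> \<bar>r\<bar> * (\<kappa> * \<bar>\<alpha> * ut + s * ux + \<omega> * u\<bar>)"
      using abs_ge_minus_self[of "r * (\<kappa> * (\<alpha> * ut + s * ux + \<omega> * u))"] \<kappa>
      by (simp add: abs_mult)
    also have "\<dots> \<le> \<delta> * (k * (2 + (p + 2) * e))"
      using r * \<kappa> k \<delta> e0 p by (intro mult_mono) auto
    also have "\<dots> \<le> 2 * \<delta> + (p + 2) * \<delta> * (k * e)"
      using k01 \<delta> by (simp add: algebra_simps mult_left_le)
    finally show ?thesis .
  qed

  \<comment> \<open>The errors of \<open>A1\<close> and \<open>A3\<close> together. The hypotheses
    on \<open>q\<close> determine it as \<open>h^(3/2)\<close>; Young's inequality then distributes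
    \<open>h^4 = q * (q h)\<close> between the derivative and \<open>u\<close>, and both
    \<open>q\<close> and \<open>q h\<close> times the width \<open>2 / h\<close> of the cone are
    integrable in time.\<close>
  have A5: "2 * (k * c * (h\<^sup>2 * w)) \<le> (p + 2) * (2 * q) * (k * e) + 2 * q * h * c"
  proof -
    have qh: "(h\<^sup>2)\<^sup>2 \<le> q * (q * h)"
      using q(2)[symmetric] by (simp only: power2_eq_square power4_eq_xxxx mult.assoc order_refl)
    have "h\<^sup>2 * w = h\<^sup>2 * (\<bar>ut\<bar> * \<bar>u\<bar>) + h\<^sup>2 * (\<bar>ux\<bar> * \<bar>u\<bar>)"
      by (simp add: w_def algebra_simps)
    also have "\<dots> \<le> (q * ut\<^sup>2 + q * h * u\<^sup>2) / 2 + (q * ux\<^sup>2 + q * h * u\<^sup>2) / 2"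
      by (intro add_mono young_weighted q(1) qh)
    also have "\<dots> = q * ((ut * ut + ux * ux) / 2) + q * h * u\<^sup>2"
      by (simp add: power2_eq_square field_simps)
    also have "\<dots> \<le> q * e + q * h * (1 + (p + 1) * V)"
      using V q h by (intro add_mono mult_left_mono) (auto simp: e_def)
    also have "\<dots> \<le> q * ((p + 2) * e) + q * h"
    proof -
      have "(p + 1) * V \<le> (p + 1) * e" using e_ge p by (intro mult_left_mono) auto
      then have "q * h * ((p + 1) * V) \<le> q * 1 * ((p + 1) * e)"
        using q h V p by (intro mult_mono) auto
      then show ?thesis by (simp add: algebra_simps)
    qed
    finally have "h\<^sup>2 * w \<le> q * ((p + 2) * e) + q * h" .
    then have "k * c * (h\<^sup>2 * w) \<le> k * c * (q * ((p + 2) * e) + q * h)"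
      using k01 c01 by (intro mult_left_mono) auto
    also have "\<dots> = k * c * (q * ((p + 2) * e)) + k * c * (q * h)" by (simp add: algebra_simps)
    also have "\<dots> \<le> k * (q * ((p + 2) * e)) + c * (q * h)"
      using k01 c01 q h p e0 by (intro add_mono mult_right_mono) (auto simp: mult_left_le mult_left_le_one_le)
    finally show ?thesis by (simp add: algebra_simps)
  qed
  have "(p + 2) * (2 * q + \<delta>) * (k * e) = (p + 2) * (2 * q) * (k * e) + (p + 2) * \<delta> * (k * e)"
    by (simp add: algebra_simps)
  then show ?thesis
    using A1 A2 A3 A4 A5 by linarith
qed

section \<open>Energy estimates\<close>

lemma set_integral_Icc_const:
  fixes a b c :: real
  assumes "a \<le> b"
  shows "(LINT x:{a..b}|lborel. c) = (b - a) * c" "set_integrable lborel {a..b} (\<lambda>x. c)"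
  using assms by (simp_all add: set_lebesgue_integral_def set_integrable_bounded_real[where M = "\<bar>c\<bar>"])

context regular_solution
begin

lemma r_bound: "z \<in> {0..R} \<times> {-R..R} \<Longrightarrow> \<bar>r z\<bar> \<le> \<delta>"
  using source by (simp add: r_def)

lemma continuous_energy_slice:
  "continuous_on S (\<lambda>x. e (t, x))" "continuous_on S (\<lambda>x. V (t, x))"
  by (intro continuous_on_compose2[OF continuous_energy(2)[of UNIV]]
      continuous_on_compose2[OF continuous_energy(1)[of UNIV]] continuous_intros; simp)+

lemma set_integrable_bounded_mult_e:
  assumes "g \<in> borel_measurable borel" "\<And>x. x \<in> {a..b} \<Longrightarrow> \<bar>g x\<bar> \<le> K"
  shows "set_integrable lborel {a..b} (\<lambda>x. g x * e (t, x))" "set_integrable lborel {a..b} (\<lambda>x. g x * V (t, x))"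
proof -
  have "set_integrable lborel {a..b} (\<lambda>x. g x * w x)"
    if w: "continuous_on {a..b} w" and m: "w \<in> borel_measurable borel" for w :: "real \<Rightarrow> real"
  proof -
    have "bounded (w ` {a..b})"
      using w by (intro compact_imp_bounded compact_continuous_image) auto
    then obtain M where M: "\<And>x. x \<in> {a..b} \<Longrightarrow> \<bar>w x\<bar> \<le> M"
      unfolding bounded_iff by (metis imageI real_norm_def)
    show ?thesis
    proof (rule set_integrable_bounded_real[where M = "K * M"])
      fix x assume x: "x \<in> {a..b}"
      then show "\<bar>g x * w x\<bar> \<le> K * M"
        unfolding abs_mult using assms(2)[OF x] M[OF x] by (intro mult_mono) auto
    qed (use assms(1) m in simp)
  qed
  then show "set_integrable lborel {a..b} (\<lambda>x. g x * e (t, x))"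
    "set_integrable lborel {a..b} (\<lambda>x. g x * V (t, x))"
    using continuous_energy_slice borel_measurable_continuous_onI by blast+
qed

lemma measurable_slices:
  "(\<lambda>x. cutoff \<rho> (t, x)) \<in> borel_measurable borel"
  "(\<lambda>x. \<sigma> (t, x)) \<in> borel_measurable borel"
  unfolding cutoff_def \<sigma>_def fst_conv snd_conv by measurable

text \<open>The multiplier decreases in time slightly, by \<open>1 - \<delta> t\<close>, to absorb the error in the equation.\<close>

lemma energy_bound:
  assumes "1 \<le> R" "\<delta> * R\<^sup>2 \<le> 1 / 2" and t: "0 \<le> t" "t \<le> R"
  shows "(LINT x:{-R..R}|lborel. cutoff R (t, x) * e (t, x)) \<le> 2 * E + 1"
proof -
  define a where "a z = cutoff R z * (1 - \<delta> * fst z)" for z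
  define a_t where "a_t z = cutoff_t R z * (1 - \<delta> * fst z) + (- \<delta>) * cutoff R z" for z
  define a_x where "a_x z = cutoff_x R z * (1 - \<delta> * fst z) + 0 * cutoff R z" for z
  let ?B = "bulk a_t a_x (\<lambda>z. 0) (\<lambda>z. 0) (\<lambda>z. 0) (\<lambda>z. 0) (\<lambda>z. 0) a (\<lambda>z. 0)"
  have R0: "R > 0" using assms by simp
  have "\<delta> * R \<le> \<delta> * R\<^sup>2"
    using assms \<delta> by (intro mult_left_mono) (auto simp: power2_eq_square)
  then have \<delta>R: "\<delta> * R \<le> 1 / 2" using assms by simp
  have \<delta>s: "1 / 2 \<le> 1 - \<delta> * s \<and> 1 - \<delta> * s \<le> 1" if "s \<in> {0..R}" for s
  proof -
    have "\<delta> * s \<le> \<delta> * R" "0 \<le> \<delta> * s" using that \<delta> by (auto intro: mult_left_mono)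
    then show ?thesis using \<delta>R by linarith
  qed
  have "pw_diff t R (\<lambda>z. 1 - \<delta> * fst z) (\<lambda>z. - \<delta>) (\<lambda>z. 0)"
    by (rule pw_diff_C1) (auto intro!: continuous_intros derivative_eq_intros)
  then have a: "pw_diff t R a a_t a_x"
    unfolding a_def a_t_def a_x_def by (intro pw_diff_mult pw_diff_cutoff R0)
  have zero: "\<forall>s\<in>{0..t}. \<forall>x. \<bar>x\<bar> = R \<longrightarrow> a (s, x) = 0 \<and> (0::real) = 0 \<and> (0::real) = 0"
    using cutoff_range(3)[OF R0] by (simp add: a_def)
  note I = multiplier_identity[OF t(1) order.strict_implies_order[OF R0] a pw_diff_const[of t R 0] pw_diff_const[of t R 0] zero]
  \<comment> \<open>The \<open>- \<delta>\<close> from differentiating \<open>1 - \<delta> t\<close>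
    cancels the energy part of the residual; what remains is \<open>\<delta> / 2\<close>, from the
    constant in \<open>2 |u_t| <= 1 + u_t^2\<close>. The derivative of the cutoff contributes with a
    good sign because \<open>|m| <= e\<close>.\<close>
  have bulk: "?B z \<le> \<delta> / 2"
    if z: "z \<in> {0..t} \<times> {-R..R}" for z
  proof -
    have z': "z \<in> {0..R} \<times> {-R..R}" using z t by auto
    then have \<kappa>: "0 \<le> cutoff R z" "cutoff R z \<le> 1" using cutoff_range[OF R0, of z] by auto
    have d: "1 / 2 \<le> 1 - \<delta> * fst z" "1 - \<delta> * fst z \<le> 1" using \<delta>s[of "fst z"] z' by auto
    have "2 * \<bar>u_t z\<bar> \<le> 1 + u_t z * u_t z"
      using zero_le_power2[of "1 - \<bar>u_t z\<bar>"] by (simp add: power2_eq_square algebra_simps)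
    moreover have "u_t z * u_t z \<le> 2 * e z"
      unfolding e_def using V_nonneg[of z] zero_le_square[of "u_x z"] by (simp add: field_simps)
    ultimately have ut: "\<bar>u_t z\<bar> \<le> 1 / 2 + e z" by linarith
    have "- (r z * (a z * u_t z)) \<le> \<bar>r z\<bar> * (\<bar>a z\<bar> * \<bar>u_t z\<bar>)"
      using abs_ge_minus_self[of "r z * (a z * u_t z)"] by (simp only: abs_mult)
    also have "\<dots> \<le> \<delta> * (cutoff R z * (1 / 2 + e z))"
    proof (intro mult_mono)
      show "\<bar>a z\<bar> \<le> cutoff R z"
        unfolding a_def abs_mult using \<kappa> d by (intro mult_left_le[of "\<bar>1 - \<delta> * fst z\<bar>" "\<bar>cutoff R z\<bar>", THEN order_trans]) auto
    qed (use r_bound[OF z'] \<delta> \<kappa> ut e_nonneg[of z] in auto)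
    finally have r: "- (r z * (a z * u_t z)) \<le> \<delta> * (cutoff R z * (1 / 2 + e z))" .
    have "a_t z * e z - a_x z * m z \<le> - \<delta> * cutoff R z * e z"
    proof (cases "fst z + \<bar>snd z\<bar> < R")
      case True
      have "sgn (snd z) * m z \<le> \<bar>m z\<bar>"
        by (auto simp: sgn_real_def)
      then have "0 \<le> e z - sgn (snd z) * m z" using e_ge_m[of z] V_nonneg[of z] by linarith
      then have "0 \<le> (1 / R) * ((1 - \<delta> * fst z) * (e z - sgn (snd z) * m z))" using d R0 by simp
      moreover have "a_t z * e z - a_x z * m z = - \<delta> * cutoff R z * e z
          - (1 / R) * ((1 - \<delta> * fst z) * (e z - sgn (snd z) * m z))"
        using True R0 by (simp add: a_t_def a_x_def cutoff_t_def cutoff_x_def field_simps)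
      ultimately show ?thesis by linarith
    next
      case False
      then show ?thesis by (simp add: a_t_def a_x_def cutoff_t_def cutoff_x_def)
    qed
    then have "?B z
        \<le> - \<delta> * cutoff R z * e z + \<delta> * (cutoff R z * (1 / 2 + e z))"
      using r by (simp add: bulk_def)
    also have "\<dots> = \<delta> * cutoff R z / 2" by (simp add: algebra_simps)
    also have "\<dots> \<le> \<delta> / 2" using \<delta> \<kappa> by (simp add: mult_left_le)
    finally show ?thesis .
  qed
  \<comment> \<open>Integrating \<open>\<delta> / 2\<close> over a region of area at most
    \<open>2 * R * R\<close> gives at most \<open>\<delta> * R^2 <= 1 / 2\<close>, whatever
    \<open>R\<close> is.\<close>
  have "(LINT s:{0..t}|lborel. (LINT x:{-R..R}|lborel.
      ?B (s, x))) \<le> (LINT s:{0..t}|lborel. \<delta> * R)"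
  proof (rule set_integral_mono)
    fix s assume s: "s \<in> {0..t}"
    have "(LINT x:{-R..R}|lborel. ?B (s, x))
        \<le> (LINT x:{-R..R}|lborel. \<delta> / 2)"
      using I(3) s R0 set_integral_Icc_const(2) by (intro set_integral_mono bulk) auto
    then show "(LINT x:{-R..R}|lborel. ?B (s, x))
        \<le> \<delta> * R"
      using R0 by (simp add: set_integral_Icc_const mult.commute)
  qed (use I(2) R0 t set_integral_Icc_const(2) in auto)
  also have "\<dots> = t * (\<delta> * R)" using t by (simp add: set_integral_Icc_const)
  also have "\<dots> \<le> R * (\<delta> * R)" using t \<delta> R0 by (intro mult_right_mono) auto
  also have "\<dots> \<le> 1 / 2" using assms(2) by (simp add: power2_eq_square mult_ac)
  finally have est: "(LINT x:{-R..R}|lborel. a (t, x) * e (t, x)) \<le> (LINT x:{-R..R}|lborel. a (0, x) * e (0, x)) + 1 / 2"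
    using I(1) R0 by simp
  have "(LINT x:{-R..R}|lborel. a (0, x) * e (0, x)) \<le> (LINT x:{-R..R}|lborel. 1 * e (0, x))"
  proof (rule set_integral_mono)
    show "set_integrable lborel {-R..R} (\<lambda>x. a (0, x) * e (0, x))" using I(4)[of 0] R0 t by simp
    show "set_integrable lborel {-R..R} (\<lambda>x. 1 * e (0, x))"
      by (rule set_integrable_bounded_mult_e(1)[where K = 1]) auto
    show "a (0, x) * e (0, x) \<le> 1 * e (0, x)" for x
      using cutoff_range[OF R0, of "(0, x)"] e_nonneg by (intro mult_right_mono) (auto simp: a_def)
  qed
  also have "\<dots> \<le> E" using initial by (simp add: e_def V_def power2_eq_square)
  finally have "(LINT x:{-R..R}|lborel. a (t, x) * e (t, x)) \<le> E + 1 / 2" using est by simp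
  \<comment> \<open>The factor \<open>1 - \<delta> t >= 1 / 2\<close> is removed here, which doubles
    the bound \<open>E + 1 / 2\<close>.\<close>
  moreover have "(LINT x:{-R..R}|lborel. (1 / 2) * (cutoff R (t, x) * e (t, x)))
      \<le> (LINT x:{-R..R}|lborel. a (t, x) * e (t, x))"
  proof (rule set_integral_mono)
    show "set_integrable lborel {-R..R} (\<lambda>x. a (t, x) * e (t, x))" using I(4)[of t] R0 t by simp
    have "set_integrable lborel {-R..R} (\<lambda>x. cutoff R (t, x) * e (t, x))"
      using cutoff_range[OF R0] t
      by (intro set_integrable_bounded_mult_e(1)[where K = 1] measurable_slices) auto
    then show "set_integrable lborel {-R..R} (\<lambda>x. (1 / 2) * (cutoff R (t, x) * e (t, x)))" by simp
    show "(1 / 2) * (cutoff R (t, x) * e (t, x)) \<le> a (t, x) * e (t, x)" for x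
    proof -
      have "(1 / 2) * cutoff R (t, x) \<le> (1 - \<delta> * t) * cutoff R (t, x)"
        using \<delta>s[of t] t cutoff_range[OF R0, of "(t, x)"] by (intro mult_right_mono) auto
      then have "(1 / 2) * cutoff R (t, x) * e (t, x) \<le> (1 - \<delta> * t) * cutoff R (t, x) * e (t, x)"
        using e_nonneg by (rule mult_right_mono)
      then show ?thesis by (simp add: a_def mult_ac)
    qed
  qed
  ultimately show ?thesis by simp
qed

end

lemma integral_weight_le_2:
  assumes "0 \<le> \<tau>"
  shows "(LINT t:{0..\<tau>}|lborel. 1 / ((t + 1) * sqrt (t + 1))) \<le> 2"
    and "set_integrable lborel {0..\<tau>} (\<lambda>t. 1 / ((t + 1) * sqrt (t + 1)))"
proof -
  show int: "set_integrable lborel {0..\<tau>} (\<lambda>t. 1 / ((t + 1) * sqrt (t + 1)))"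
    by (intro borel_integrable_atLeastAtMost' continuous_intros) auto
  have "(LINT t:{0..\<tau>}|lborel. 1 / ((t + 1) * sqrt (t + 1))) = - 2 / sqrt (\<tau> + 1) - (- 2 / sqrt (0 + 1))"
  proof (rule integral_of_piecewise_derivative[where S = "{}"])
    show "continuous_on {0..\<tau>} (\<lambda>t. - 2 / sqrt (t + 1))"
      by (intro continuous_intros) auto
    show "((\<lambda>t. - 2 / sqrt (t + 1)) has_real_derivative 1 / ((t + 1) * sqrt (t + 1))) (at t)"
      if "t \<in> {0<..<\<tau>} - {}" for t
      using that by (auto intro!: derivative_eq_intros simp: field_simps)
  qed (use assms int in auto)
  then show "(LINT t:{0..\<tau>}|lborel. 1 / ((t + 1) * sqrt (t + 1))) \<le> 2"
    using assms by simp
qed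

text \<open>The left side is what the unsimplified product-rule derivatives of the multiplier
  produce in \<open>bulk\<close>; the right side regroups it into derivatives of the cutoff and
  derivatives of the multiplier proper, as \<open>bulk_estimate\<close> expects.\<close>

lemma multiplier_algebra:
  fixes p h s st sx \<kappa> \<kappa>t \<kappa>x u ut ux V e m r :: real
  shows "((\<kappa>t * (1 / 2 * (1 + s * s)) + (1 / 2 * (0 + (st * s + st * s))) * \<kappa>) - (\<kappa>x * s + sx * \<kappa>)) * e
     + ((\<kappa>t * s + st * \<kappa>) - (\<kappa>x * (1 / 2 * (1 + s * s)) + (1 / 2 * (0 + (sx * s + sx * s))) * \<kappa>)) * m
     + 2 * (\<kappa>x * s + sx * \<kappa>) * V
     + \<kappa> * (1 / 2 * ((1 - s * s) * h)) * (ut\<^sup>2 - ux\<^sup>2 - (p + 1) * V)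
     + u * ((\<kappa>t * (1 / 2 * ((1 - s * s) * h)) + (1 / 2 * ((0 - (st * s + st * s)) * h + - h\<^sup>2 * (1 - s * s))) * \<kappa>) * ut
          - (\<kappa>x * (1 / 2 * ((1 - s * s) * h)) + (1 / 2 * ((0 - (sx * s + sx * s)) * h + 0 * (1 - s * s))) * \<kappa>) * ux)
     - r * (\<kappa> * (1 / 2 * (1 + s * s)) * ut + \<kappa> * s * ux + \<kappa> * (1 / 2 * ((1 - s * s) * h)) * u)
   = \<kappa>t * ((1 + s\<^sup>2) / 2 * e + s * m + (1 - s\<^sup>2) * h / 2 * (u * ut))
     - \<kappa>x * ((1 + s\<^sup>2) / 2 * m + s * (e - 2 * V) + (1 - s\<^sup>2) * h / 2 * (u * ux))
     + \<kappa> * ((s * st - sx) * e + (st - s * sx) * m + 2 * sx * V + (1 - s\<^sup>2) * h / 2 * (ut\<^sup>2 - ux\<^sup>2 - (p + 1) * V))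
     + \<kappa> * (u * ((- s * st * h - (1 - s\<^sup>2) * h\<^sup>2 / 2) * ut - (- s * sx * h) * ux))
     - r * (\<kappa> * ((1 + s\<^sup>2) / 2 * ut + s * ux + (1 - s\<^sup>2) * h / 2 * u))"
  by (simp add: field_simps power2_eq_square)

section \<open>Bulk and boundary terms of the localized multiplier\<close>

context regular_solution
begin

definition cone :: "real \<times> real \<Rightarrow> real" where
  "cone z = (if \<bar>snd z\<bar> < fst z + 1 then 1 else 0)"

text \<open>The three coefficients times the cutoff. Their derivatives are kept in the exact shape
  generated by the rules \<open>pw_diff_mult\<close>, \<open>pw_diff_add\<close> and
  \<open>pw_diff_diff\<close>, including the zeros, so that these rules prove
  \<open>pw_diff_multipliers\<close> by unification.\<close>

definition \<alpha> where "\<alpha> \<rho> z = cutoff \<rho> z * (1 / 2 * (1 + \<sigma> z * \<sigma> z))"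
definition \<alpha>_t where "\<alpha>_t \<rho> z = cutoff_t \<rho> z * (1 / 2 * (1 + \<sigma> z * \<sigma> z))
  + (1 / 2 * (0 + (\<sigma>_t z * \<sigma> z + \<sigma>_t z * \<sigma> z))) * cutoff \<rho> z"
definition \<alpha>_x where "\<alpha>_x \<rho> z = cutoff_x \<rho> z * (1 / 2 * (1 + \<sigma> z * \<sigma> z))
  + (1 / 2 * (0 + (\<sigma>_x z * \<sigma> z + \<sigma>_x z * \<sigma> z))) * cutoff \<rho> z"
definition \<beta> where "\<beta> \<rho> z = cutoff \<rho> z * \<sigma> z"
definition \<beta>_t where "\<beta>_t \<rho> z = cutoff_t \<rho> z * \<sigma> z + \<sigma>_t z * cutoff \<rho> z"
definition \<beta>_x where "\<beta>_x \<rho> z = cutoff_x \<rho> z * \<sigma> z + \<sigma>_x z * cutoff \<rho> z"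
definition \<omega> where "\<omega> \<rho> z = cutoff \<rho> z * (1 / 2 * ((1 - \<sigma> z * \<sigma> z) * \<theta> z))"
definition \<omega>_t where "\<omega>_t \<rho> z = cutoff_t \<rho> z * (1 / 2 * ((1 - \<sigma> z * \<sigma> z) * \<theta> z))
  + (1 / 2 * ((0 - (\<sigma>_t z * \<sigma> z + \<sigma>_t z * \<sigma> z)) * \<theta> z + - (\<theta> z)\<^sup>2 * (1 - \<sigma> z * \<sigma> z))) * cutoff \<rho> z"
definition \<omega>_x where "\<omega>_x \<rho> z = cutoff_x \<rho> z * (1 / 2 * ((1 - \<sigma> z * \<sigma> z) * \<theta> z))
  + (1 / 2 * ((0 - (\<sigma>_x z * \<sigma> z + \<sigma>_x z * \<sigma> z)) * \<theta> z + 0 * (1 - \<sigma> z * \<sigma> z))) * cutoff \<rho> z"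

lemma pw_diff_multipliers:
  assumes "\<rho> > 0"
  shows "pw_diff \<tau> R' (\<alpha> \<rho>) (\<alpha>_t \<rho>) (\<alpha>_x \<rho>)" "pw_diff \<tau> R' (\<beta> \<rho>) (\<beta>_t \<rho>) (\<beta>_x \<rho>)"
    "pw_diff \<tau> R' (\<omega> \<rho>) (\<omega>_t \<rho>) (\<omega>_x \<rho>)"
  unfolding \<alpha>_def[abs_def] \<alpha>_t_def[abs_def] \<alpha>_x_def[abs_def] \<beta>_def[abs_def] \<beta>_t_def[abs_def] \<beta>_x_def[abs_def]
    \<omega>_def[abs_def] \<omega>_t_def[abs_def] \<omega>_x_def[abs_def]
  by (intro pw_diff_mult pw_diff_cmult pw_diff_add pw_diff_diff pw_diff_const pw_diff_cutoff pw_diff_\<sigma>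
      pw_diff_\<theta> assms)+

text \<open>The derivative of the cutoff does not become small where the cutoff does, so the errors
  are measured by the energy on the whole support. This is why a cutoff of larger radius is needed
  to control that energy.\<close>

definition in_cutoff :: "real \<Rightarrow> real \<times> real \<Rightarrow> real" where
  "in_cutoff \<rho> z = (if fst z + \<bar>snd z\<bar> < \<rho> then 1 else 0)"

text \<open>The condition \<open>fst z + 1 <= \<rho>\<close> makes the slope
  \<open>1 / \<rho>\<close> of the cutoff no larger than the weight \<theta>, so localization
  creates no error worse than those of the multiplier itself.\<close>

lemma bulk_le:
  assumes z: "z \<in> {0..R} \<times> {-R..R}" and \<rho>: "fst z + 1 \<le> \<rho>"
  shows "bulk (\<alpha>_t \<rho>) (\<alpha>_x \<rho>) (\<beta>_t \<rho>) (\<beta>_x \<rho>) (\<omega> \<rho>) (\<omega>_t \<rho>) (\<omega>_x \<rho>) (\<alpha> \<rho>) (\<beta> \<rho>) z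
    \<le> - ((p - 1) / 2) * (cutoff \<rho> z * ((1 - (\<sigma> z)\<^sup>2) * \<theta> z) * V z)
      + (p + 2) * (2 * (1 / ((fst z + 1) * sqrt (fst z + 1))) + \<delta>) * (in_cutoff \<rho> z * e z)
      + 2 * (1 / ((fst z + 1) * sqrt (fst z + 1))) * \<theta> z * cone z + 2 * \<delta>"
proof -
  define q where "q = 1 / ((fst z + 1) * sqrt (fst z + 1))"
  have T: "0 < fst z + 1" "\<rho> > 0" "0 \<le> fst z" using z \<rho> by auto
  have \<theta>: "0 < \<theta> z" "\<theta> z \<le> 1" using T by (auto simp: \<theta>_def)
  have q: "0 < q" "q\<^sup>2 * \<theta> z = \<theta> z ^ 4"
    using T by (auto simp: q_def \<theta>_def power_mult_distrib power_divide power4_eq_xxxx power2_eq_square)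
  have cone: "cone z = 1 \<or> cone z = 0 \<and> (\<sigma> z)\<^sup>2 = 1"
    using \<sigma>_outside(1)[OF T(3)] by (auto simp: cone_def)
  have in_cutoff: "in_cutoff \<rho> z = 1 \<or> in_cutoff \<rho> z = 0 \<and> cutoff \<rho> z = 0"
    using cutoff_range(3)[OF T(2,3)] by (auto simp: in_cutoff_def)
  have rho: "1 / \<rho> \<le> \<theta> z" using T \<rho> by (simp add: \<theta>_def frac_le)
  have st: "\<sigma>_t z = - cone z * \<sigma> z * \<theta> z" "\<sigma>_x z = cone z * \<theta> z"
    using \<sigma>_inside[of z] \<sigma>_outside[OF T(3)] by (auto simp: cone_def)
  have \<kappa>t: "cutoff_t \<rho> z = - in_cutoff \<rho> z / \<rho>" "cutoff_x \<rho> z = - in_cutoff \<rho> z * sgn (snd z) / \<rho>"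
    by (auto simp: cutoff_t_def cutoff_x_def in_cutoff_def)
  have V: "(u z)\<^sup>2 \<le> 1 + (p + 1) * V z" using square_le_potential[OF p] by (simp add: V_def)
  have sg: "\<bar>sgn (snd z)\<bar> \<le> 1" by (simp add: abs_sgn_eq)
  note B = bulk_estimate[OF p \<theta> rho T(2) \<sigma>_le_1 cone in_cutoff cutoff_range(1,2)[OF T(2,3)] sg
      \<sigma>_sgn[OF T(3)] V_nonneg V r_bound[OF z] q, of "u_t z" "u_x z"]
  show ?thesis
    unfolding q_def[symmetric] bulk_def \<alpha>_def \<alpha>_t_def \<alpha>_x_def \<beta>_def \<beta>_t_def \<beta>_x_def \<omega>_def \<omega>_t_def \<omega>_x_def
      multiplier_algebra
    using B unfolding e_def m_def st \<kappa>t .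
qed

text \<open>Young's inequality bounds the zeroth-order term by the energy and
  \<open>\<theta>^2 u^2\<close>. The constant in \<open>u^2 <= 1 + (p + 1) V\<close> leaves
  \<open>\<theta>^2 / 4\<close> on the cone, harmless since the cone has width
  \<open>2 / \<theta>\<close>.\<close>

lemma multipliers_bound:
  assumes "\<rho> > 0" "0 \<le> fst z"
  shows "\<bar>\<alpha> \<rho> z * e z + \<beta> \<rho> z * m z + \<omega> \<rho> z * (u z * u_t z)\<bar>
    \<le> (p + 4) * (in_cutoff \<rho> z * e z) + (\<theta> z)\<^sup>2 / 4 * cone z"
proof -
  let ?W = "1 / 2 * ((1 - \<sigma> z * \<sigma> z) * \<theta> z) * (u z * u_t z)"
  let ?X = "1 / 2 * (1 + \<sigma> z * \<sigma> z) * e z + \<sigma> z * m z + ?W"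
  have \<kappa>: "0 \<le> cutoff \<rho> z" "cutoff \<rho> z \<le> in_cutoff \<rho> z"
    using cutoff_range[OF assms] by (auto simp: in_cutoff_def)
  have s2: "0 \<le> \<sigma> z * \<sigma> z" "\<sigma> z * \<sigma> z \<le> 1" using \<sigma>_le_1[of z]
    by (simp_all add: abs_square_le_1 flip: power2_eq_square)
  have \<theta>: "0 < \<theta> z" "\<theta> z \<le> 1" using assms(2) by (auto simp: \<theta>_def)
  have c: "1 - \<sigma> z * \<sigma> z \<le> cone z"
    using \<sigma>_outside(1)[OF assms(2)] s2 by (auto simp: cone_def power2_eq_square)
  have cone: "0 \<le> cone z" "cone z \<le> 1" by (auto simp: cone_def)
  have m: "\<bar>m z\<bar> \<le> e z" using e_ge_m[of z] V_nonneg[of z] by linarith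
  have "\<bar>1 / 2 * (1 + \<sigma> z * \<sigma> z) * e z\<bar> \<le> 1 * e z"
    unfolding abs_mult[of _ "e z"] using s2 e_nonneg[of z] by (intro mult_mono) auto
  moreover have "\<bar>\<sigma> z * m z\<bar> \<le> 1 * e z"
    unfolding abs_mult using \<sigma>_le_1[of z] m by (intro mult_mono) auto
  moreover have "\<bar>?W\<bar> \<le> (p + 2) * e z + (\<theta> z)\<^sup>2 / 4 * cone z"
  proof -
    have "\<bar>?W\<bar> = (1 - \<sigma> z * \<sigma> z) / 2 * (\<theta> z * (\<bar>u_t z\<bar> * \<bar>u z\<bar>))"
      using s2 \<theta> by (simp add: abs_mult mult_ac)
    also have "\<dots> \<le> cone z / 2 * (\<theta> z * (\<bar>u_t z\<bar> * \<bar>u z\<bar>))"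
      using c \<theta> by (intro mult_right_mono) auto
    also have "\<dots> \<le> cone z / 2 * ((1 * (u_t z)\<^sup>2 + (\<theta> z)\<^sup>2 * (u z)\<^sup>2) / 2)"
      using cone by (intro mult_left_mono young_weighted) auto
    also have "\<dots> \<le> cone z / 2 * ((2 * e z + (\<theta> z)\<^sup>2 * (1 + (p + 1) * V z)) / 2)"
    proof -
      have "(u_t z)\<^sup>2 \<le> 2 * e z" "(u z)\<^sup>2 \<le> 1 + (p + 1) * V z"
        unfolding e_def using V_nonneg[of z] zero_le_square[of "u_x z"] square_le_potential[OF p]
        by (simp_all add: field_simps power2_eq_square V_def)
      then show ?thesis
        using cone by (intro mult_left_mono divide_right_mono add_mono) auto
    qed
    also have "\<dots> = cone z * (e z / 2 + (\<theta> z)\<^sup>2 * ((p + 1) * V z) / 4) + (\<theta> z)\<^sup>2 / 4 * cone z"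
      by (simp add: field_simps)
    also have "\<dots> \<le> 1 * (e z / 2 + 1 * ((p + 1) * e z) / 4) + (\<theta> z)\<^sup>2 / 4 * cone z"
    proof -
      have "(\<theta> z)\<^sup>2 \<le> 1" using \<theta> by (simp add: power_le_one)
      moreover have "V z \<le> e z" using e_ge_m[of z] by linarith
      ultimately show ?thesis
        using cone p e_nonneg[of z] V_nonneg[of z]
        by (intro add_mono mult_mono divide_right_mono) auto
    qed
    also have "\<dots> = (p + 3) / 4 * e z + (\<theta> z)\<^sup>2 / 4 * cone z" by (simp add: field_simps)
    also have "\<dots> \<le> (p + 2) * e z + (\<theta> z)\<^sup>2 / 4 * cone z"
      using p e_nonneg[of z] by (intro add_right_mono mult_right_mono) auto
    finally show ?thesis .
  qed
  ultimately have "\<bar>?X\<bar>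
      \<le> (p + 4) * e z + (\<theta> z)\<^sup>2 / 4 * cone z"
    by (simp add: algebra_simps)
  then have "cutoff \<rho> z * \<bar>?X\<bar>
      \<le> in_cutoff \<rho> z * ((p + 4) * e z + (\<theta> z)\<^sup>2 / 4 * cone z)"
    using \<kappa> by (intro mult_mono) auto
  also have "\<dots> \<le> (p + 4) * (in_cutoff \<rho> z * e z) + (\<theta> z)\<^sup>2 / 4 * cone z"
    using cone by (auto simp: in_cutoff_def algebra_simps)
  finally have "cutoff \<rho> z * \<bar>?X\<bar>
      \<le> (p + 4) * (in_cutoff \<rho> z * e z) + (\<theta> z)\<^sup>2 / 4 * cone z" .
  moreover have "\<alpha> \<rho> z * e z + \<beta> \<rho> z * m z + \<omega> \<rho> z * (u z * u_t z) =
      cutoff \<rho> z * (?X)"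
    by (simp add: \<alpha>_def \<beta>_def \<omega>_def algebra_simps)
  ultimately show ?thesis using \<kappa> by (simp add: abs_mult)
qed

end

section \<open>The weighted estimate for smooth approximate solutions\<close>

lemma set_integral_mono_set_nonneg:
  fixes f g :: "real \<Rightarrow> real"
  assumes "set_integrable lborel A f" "set_integrable lborel B g"
    and "\<And>x. x \<in> A \<Longrightarrow> x \<in> B \<Longrightarrow> f x \<le> g x" "\<And>x. x \<in> B \<Longrightarrow> 0 \<le> g x" "\<And>x. x \<in> A \<Longrightarrow> x \<notin> B \<Longrightarrow> f x \<le> 0"
  shows "(LINT x:A|lborel. f x) \<le> (LINT x:B|lborel. g x)"
  using assms unfolding set_lebesgue_integral_def set_integrable_def
  by (intro integral_mono) (auto simp: indicator_def)

context regular_solution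
begin

text \<open>On the support of the cutoff of radius \<open>R / 2\<close> the cutoff of radius
  \<open>R\<close> is at least 1/2, so passing to a sharp indicator costs a factor 2.\<close>

lemma local_energy_bound:
  assumes "1 \<le> R" "\<delta> * R\<^sup>2 \<le> 1 / 2" "0 \<le> t" "t \<le> R / 2"
  shows "(LINT x:{-(R / 2)..R / 2}|lborel. in_cutoff (R / 2) (t, x) * e (t, x)) \<le> 4 * E + 2"
    and "set_integrable lborel {-(R / 2)..R / 2} (\<lambda>x. in_cutoff (R / 2) (t, x) * e (t, x))"
proof -
  have R0: "R > 0" using assms by simp
  have [measurable]: "(\<lambda>x. in_cutoff (R / 2) (t, x)) \<in> borel_measurable borel"
    unfolding in_cutoff_def fst_conv snd_conv by measurable
  show int: "set_integrable lborel {-(R / 2)..R / 2} (\<lambda>x. in_cutoff (R / 2) (t, x) * e (t, x))"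
    by (rule set_integrable_bounded_mult_e(1)[where K = 1]) (auto simp: in_cutoff_def)
  have int': "set_integrable lborel {-R..R} (\<lambda>x. cutoff R (t, x) * e (t, x))"
    using cutoff_range[OF R0] assms
    by (intro set_integrable_bounded_mult_e(1)[where K = 1] measurable_slices) auto
  have nonneg: "0 \<le> cutoff R (t, x) * e (t, x)" for x
    using cutoff_range[OF R0, of "(t, x)"] assms e_nonneg by simp
  have "(LINT x:{-(R / 2)..R / 2}|lborel. in_cutoff (R / 2) (t, x) * e (t, x))
      \<le> (LINT x:{-R..R}|lborel. 2 * (cutoff R (t, x) * e (t, x)))"
  proof (rule set_integral_mono_set_nonneg[OF int])
    fix x
    have "in_cutoff (R / 2) (t, x) \<le> 2 * cutoff R (t, x)"
      using cutoff_range(1,4)[OF R0, of "(t, x)"] assms by (auto simp: in_cutoff_def)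
    then have "in_cutoff (R / 2) (t, x) * e (t, x) \<le> 2 * cutoff R (t, x) * e (t, x)"
      using e_nonneg by (rule mult_right_mono)
    then show "in_cutoff (R / 2) (t, x) * e (t, x) \<le> 2 * (cutoff R (t, x) * e (t, x))" by simp
  qed (use int' nonneg assms in auto)
  also have "\<dots> \<le> 2 * (2 * E + 1)"
    using energy_bound[OF assms(1,2,3)] assms by simp
  finally show "(LINT x:{-(R / 2)..R / 2}|lborel. in_cutoff (R / 2) (t, x) * e (t, x)) \<le> 4 * E + 2"
    by simp
qed

lemma cone_integral:
  assumes "0 \<le> t"
  shows "(LINT x:{-\<rho>..\<rho>}|lborel. cone (t, x)) \<le> 2 * (t + 1)"
    and "set_integrable lborel {-\<rho>..\<rho>} (\<lambda>x. cone (t, x))"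
proof -
  have [measurable]: "(\<lambda>x. cone (t, x)) \<in> borel_measurable borel"
    unfolding cone_def fst_conv snd_conv by measurable
  show int: "set_integrable lborel {-\<rho>..\<rho>} (\<lambda>x. cone (t, x))"
    by (rule set_integrable_bounded_real[where M = 1]) (auto simp: cone_def)
  have "(LINT x:{-\<rho>..\<rho>}|lborel. cone (t, x)) \<le> (LINT x:{-(t + 1)..t + 1}|lborel. 1)"
    using assms set_integral_Icc_const(2)[of "-(t + 1)" "t + 1" 1]
    by (intro set_integral_mono_set_nonneg int) (auto simp: cone_def)
  then show "(LINT x:{-\<rho>..\<rho>}|lborel. cone (t, x)) \<le> 2 * (t + 1)"
    using assms by (simp add: set_integral_Icc_const)
qed

text \<open>The multiplier is cut off at \<open>\<rho> = R / 2\<close>, so that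
  \<open>local_energy_bound\<close> controls the energy on its support. The condition
  \<open>8 * (\<tau> + 1) <= R\<close> gives \<open>t + |x| <= \<rho> / 2\<close> on the cone up to
  time \<tau>, where the cutoff is therefore at least 1/2. The bound is free of \<tau>,
  \<open>R\<close> and \<delta>, as the passage to the limit requires.\<close>

theorem weighted_estimate:
  assumes R1: "1 \<le> R" and \<delta>R: "\<delta> * R\<^sup>2 \<le> 1 / 2" and \<tau>: "0 \<le> \<tau>" and R\<tau>: "8 * (\<tau> + 1) \<le> R"
  shows "(\<integral>\<^sup>+t\<in>{0..\<tau>}. (\<integral>\<^sup>+x\<in>{- t - 1..t + 1}.
      ennreal (((t + 1)\<^sup>2 - x\<^sup>2) * \<bar>u (t, x)\<bar> powr (p + 1) / (t + 1) ^ 3) \<partial>lborel) \<partial>lborel)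
    \<le> ennreal (4 * (p + 1) / (p - 1) * ((7 * p + 18) * (4 * E + 2) + 12))"
proof -
  define \<rho> where "\<rho> = R / 2"
  define E' where "E' = 4 * E + 2"
  have \<rho>: "\<rho> > 0" "\<tau> + 1 \<le> \<rho>" "4 * (\<tau> + 1) \<le> \<rho>" using R\<tau> \<tau> R1 by (auto simp: \<rho>_def)
  let ?b = "bulk (\<alpha>_t \<rho>) (\<alpha>_x \<rho>) (\<beta>_t \<rho>) (\<beta>_x \<rho>) (\<omega> \<rho>) (\<omega>_t \<rho>) (\<omega>_x \<rho>) (\<alpha> \<rho>) (\<beta> \<rho>)"
  define B where "B t = (LINT x:{-\<rho>..\<rho>}|lborel. ?b (t, x))" for t
  define Q where "Q t = (LINT x:{-\<rho>..\<rho>}|lborel. \<alpha> \<rho> (t, x) * e (t, x) + \<beta> \<rho> (t, x) * m (t, x) + \<omega> \<rho> (t, x) * (u (t, x) * u_t (t, x)))" for t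
  define q where "q t = 1 / ((t + 1) * sqrt (t + 1))" for t :: real
  define l where "l z = cutoff \<rho> z * ((1 - (\<sigma> z)\<^sup>2) * \<theta> z) * V z" for z
  define L where "L t = (LINT x:{-\<rho>..\<rho>}|lborel. l (t, x))" for t
  have zero: "\<forall>t\<in>{0..\<tau>}. \<forall>x. \<bar>x\<bar> = \<rho> \<longrightarrow> \<alpha> \<rho> (t, x) = 0 \<and> \<beta> \<rho> (t, x) = 0 \<and> \<omega> \<rho> (t, x) = 0"
    using cutoff_range(3)[OF \<rho>(1)] by (simp add: \<alpha>_def \<beta>_def \<omega>_def)
  note I = multiplier_identity[OF \<tau> order.strict_implies_order[OF \<rho>(1)] pw_diff_multipliers[OF \<rho>(1)] zero]
  have id: "Q \<tau> - Q 0 = (LINT t:{0..\<tau>}|lborel. B t)" and Bint: "set_integrable lborel {0..\<tau>} B"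
    using I(1,2) by (simp_all add: Q_def B_def[abs_def])
  note en = local_energy_bound[OF R1 \<delta>R, folded \<rho>_def E'_def]
  \<comment> \<open>The locale assumes no sign of \<open>E\<close>; the energy bound itself supplies
    it.\<close>
  have E': "0 \<le> E'"
  proof -
    have "0 \<le> (LINT x:{-\<rho>..\<rho>}|lborel. in_cutoff \<rho> (0, x) * e (0, x))"
      unfolding set_lebesgue_integral_def
      using e_nonneg by (intro integral_nonneg_AE AE_I2) (auto simp: in_cutoff_def)
    then show ?thesis using en(1)[of 0] \<rho> by simp
  qed
  have Qle: "\<bar>Q t\<bar> \<le> (p + 4) * E' + 1" if t: "t \<in> {0..\<tau>}" for t
  proof -
    have t': "0 \<le> t" "t \<le> \<rho>" using t \<rho> by auto
    let ?Q = "\<lambda>x. \<alpha> \<rho> (t, x) * e (t, x) + \<beta> \<rho> (t, x) * m (t, x) + \<omega> \<rho> (t, x) * (u (t, x) * u_t (t, x))"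
    have iQ: "set_integrable lborel {-\<rho>..\<rho>} ?Q" using I(4)[OF t] by simp
    have "\<bar>Q t\<bar> \<le> (LINT x:{-\<rho>..\<rho>}|lborel. \<bar>?Q x\<bar>)"
      unfolding Q_def using set_integral_norm_bound[OF iQ] by simp
    also have "\<dots> \<le> (LINT x:{-\<rho>..\<rho>}|lborel.
        (p + 4) * (in_cutoff \<rho> (t, x) * e (t, x)) + (\<theta> (t, 0))\<^sup>2 / 4 * cone (t, x))"
    proof (rule set_integral_mono)
      show "set_integrable lborel {-\<rho>..\<rho>} (\<lambda>x. \<bar>?Q x\<bar>)" using set_integrable_abs[OF iQ] .
      show "set_integrable lborel {-\<rho>..\<rho>}
          (\<lambda>x. (p + 4) * (in_cutoff \<rho> (t, x) * e (t, x)) + (\<theta> (t, 0))\<^sup>2 / 4 * cone (t, x))"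
        using en(2)[OF t'] cone_integral(2)[OF t'(1)] by (intro set_integral_add set_integrable_mult_right)
      show "\<bar>?Q x\<bar> \<le> (p + 4) * (in_cutoff \<rho> (t, x) * e (t, x)) + (\<theta> (t, 0))\<^sup>2 / 4 * cone (t, x)" for x
        using multipliers_bound[OF \<rho>(1), of "(t, x)"] t' by (simp add: \<theta>_def)
    qed
    also have "\<dots> = (p + 4) * (LINT x:{-\<rho>..\<rho>}|lborel. in_cutoff \<rho> (t, x) * e (t, x))
        + (\<theta> (t, 0))\<^sup>2 / 4 * (LINT x:{-\<rho>..\<rho>}|lborel. cone (t, x))"
      using en(2)[OF t'] cone_integral(2)[OF t'(1), of \<rho>] by (subst set_integral_add) auto
    also have "\<dots> \<le> (p + 4) * E' + (\<theta> (t, 0))\<^sup>2 / 4 * (2 * (t + 1))"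
      using en(1)[OF t'] cone_integral(1)[OF t'(1)] p by (intro add_mono mult_left_mono) auto
    also have "(\<theta> (t, 0))\<^sup>2 / 4 * (2 * (t + 1)) \<le> 1"
    proof -
      have "\<theta> (t, 0) * (t + 1) = 1" "\<theta> (t, 0) \<le> 1" using t' by (simp_all add: \<theta>_def)
      moreover have "(\<theta> (t, 0))\<^sup>2 / 4 * (2 * (t + 1)) = \<theta> (t, 0) / 2 * (\<theta> (t, 0) * (t + 1))"
        by (simp add: power2_eq_square)
      ultimately show ?thesis by simp
    qed
    finally show ?thesis by simp
  qed
  have li: "set_integrable lborel {-\<rho>..\<rho>} (\<lambda>x. l (t, x))" and l0: "0 \<le> l (t, x)" if "0 \<le> t" for t x
  proof -
    have 1: "0 \<le> cutoff \<rho> (t, x)" "cutoff \<rho> (t, x) \<le> 1" for x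
      using cutoff_range[OF \<rho>(1), of "(t, x)"] that by auto
    have 2: "0 \<le> 1 - (\<sigma> (t, x))\<^sup>2" "1 - (\<sigma> (t, x))\<^sup>2 \<le> 1" for x
      using \<sigma>_le_1[of "(t, x)"] by (auto simp: abs_square_le_1)
    have 3: "0 \<le> \<theta> (t, x)" "\<theta> (t, x) \<le> 1" for x using that by (auto simp: \<theta>_def)
    have "\<bar>cutoff \<rho> (t, x) * ((1 - (\<sigma> (t, x))\<^sup>2) * \<theta> (t, x))\<bar> \<le> 1" for x
      using 1[of x] 2[of x] 3[of x] by (simp add: abs_mult mult_le_one)
    moreover have "(\<lambda>x. cutoff \<rho> (t, x) * ((1 - (\<sigma> (t, x))\<^sup>2) * \<theta> (t, x))) \<in> borel_measurable borel"
      using measurable_slices[where t = t] by (simp add: \<theta>_def)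
    ultimately show "set_integrable lborel {-\<rho>..\<rho>} (\<lambda>x. l (t, x))"
      unfolding l_def by (intro set_integrable_bounded_mult_e(2)[where K = 1])
    show "0 \<le> l (t, x)" unfolding l_def using 1[of x] 2[of x] 3[of x] V_nonneg by simp
  qed
  \<comment> \<open>Time density of all errors: \<open>E'\<close> bounds the energy of a slice;
    \<open>4 * q t\<close> comes from the cone, whose width \<open>2 * (t + 1)\<close> cancels
    \<theta>; \<open>4 * \<delta> * \<rho>\<close> is \<open>2 * \<delta>\<close> integrated over
    length \<open>2 * \<rho>\<close>.\<close>
  define N where "N t = (p + 2) * (2 * q t + \<delta>) * E' + 4 * q t + 4 * \<delta> * \<rho>" for t
  have key: "(p - 1) / 2 * L t \<le> N t - B t" if t: "t \<in> {0..\<tau>}" for t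
  proof -
    have t': "0 \<le> t" "t \<le> \<rho>" using t \<rho> by auto
    have q0: "0 < q t" using t' by (simp add: q_def)
    note int = en(2)[OF t'] cone_integral(2)[OF t'(1), of \<rho>] li[OF t'(1)] set_integral_Icc_const(2)[of "-\<rho>" \<rho> "2 * \<delta>"]
    have "B t \<le> (LINT x:{-\<rho>..\<rho>}|lborel. - ((p - 1) / 2) * l (t, x)
        + (p + 2) * (2 * q t + \<delta>) * (in_cutoff \<rho> (t, x) * e (t, x)) + 2 * q t * \<theta> (t, 0) * cone (t, x) + 2 * \<delta>)"
      unfolding B_def
    proof (rule set_integral_mono)
      show "set_integrable lborel {-\<rho>..\<rho>} (\<lambda>x. - ((p - 1) / 2) * l (t, x)
        + (p + 2) * (2 * q t + \<delta>) * (in_cutoff \<rho> (t, x) * e (t, x)) + 2 * q t * \<theta> (t, 0) * cone (t, x) + 2 * \<delta>)"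
        using int \<rho> by (intro set_integral_add set_integrable_mult_right) auto
      fix x assume x: "x \<in> {-\<rho>..\<rho>}"
      then have "(t, x) \<in> {0..R} \<times> {-R..R}" using t' \<rho> by (auto simp: \<rho>_def)
      from bulk_le[OF this, of \<rho>]
      show "?b (t, x)
        \<le> - ((p - 1) / 2) * l (t, x) + (p + 2) * (2 * q t + \<delta>) * (in_cutoff \<rho> (t, x) * e (t, x))
          + 2 * q t * \<theta> (t, 0) * cone (t, x) + 2 * \<delta>"
        using t \<rho>(2) by (simp add: l_def q_def \<theta>_def)
    qed (use I(3)[OF t] in simp)
    also have "\<dots> = - ((p - 1) / 2) * L t + (p + 2) * (2 * q t + \<delta>) * (LINT x:{-\<rho>..\<rho>}|lborel. in_cutoff \<rho> (t, x) * e (t, x))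
        + 2 * q t * \<theta> (t, 0) * (LINT x:{-\<rho>..\<rho>}|lborel. cone (t, x)) + 4 * \<delta> * \<rho>"
    proof -
      note i = set_integrable_mult_right[OF int(1), of "(p + 2) * (2 * q t + \<delta>)"]
        set_integrable_mult_right[OF int(2), of "2 * q t * \<theta> (t, 0)"]
        set_integrable_mult_right[OF int(3), of "- ((p - 1) / 2)"]
      have "(LINT x:{-\<rho>..\<rho>}|lborel. 2 * \<delta>) = 4 * \<delta> * \<rho>" using \<rho> by (simp add: set_integral_Icc_const)
      moreover have "set_integrable lborel {-\<rho>..\<rho>} (\<lambda>x. 2 * \<delta>)" using int(4) \<rho> by simp
      ultimately show ?thesis
        using i by (simp only: set_integral_add(1,2) set_integral_mult_right L_def)
    qed
    also have "\<dots> \<le> - ((p - 1) / 2) * L t + (p + 2) * (2 * q t + \<delta>) * E' + 2 * q t * \<theta> (t, 0) * (2 * (t + 1)) + 4 * \<delta> * \<rho>"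
      using en(1)[OF t'] cone_integral(1)[OF t'(1), of \<rho>] p \<delta> q0 t'
      by (intro add_mono mult_left_mono order_refl) (auto simp: \<theta>_def)
    also have "2 * q t * \<theta> (t, 0) * (2 * (t + 1)) = 4 * q t * (\<theta> (t, 0) * (t + 1))" by simp
    also have "\<theta> (t, 0) * (t + 1) = 1" using t' by (simp add: \<theta>_def)
    finally show ?thesis by (simp add: N_def)
  qed
  have Nint: "set_integrable lborel {0..\<tau>} N" and Nle: "(LINT t:{0..\<tau>}|lborel. N t) \<le> (p + 2) * 5 * E' + 10"
  proof -
    define c d where "c = 2 * (p + 2) * E' + 4" and "d = (p + 2) * \<delta> * E' + 4 * \<delta> * \<rho>"
    have N: "N = (\<lambda>t. c * q t + d)"
      by (simp add: fun_eq_iff N_def c_def d_def algebra_simps)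
    note qi = integral_weight_le_2[OF \<tau>, folded q_def]
    have a: "set_integrable lborel {0..\<tau>} (\<lambda>t. c * q t)" "set_integrable lborel {0..\<tau>} (\<lambda>t. d)"
      using qi(2) set_integral_Icc_const(2)[OF \<tau>] by simp_all
    have b: "(LINT t:{0..\<tau>}|lborel. d) = (\<tau> - 0) * d" by (rule set_integral_Icc_const[OF \<tau>])
    show "set_integrable lborel {0..\<tau>} N" unfolding N by (intro set_integral_add a)
    have "(LINT t:{0..\<tau>}|lborel. N t) = c * (LINT t:{0..\<tau>}|lborel. q t) + \<tau> * d"
      unfolding N using set_integral_add(2)[OF a] b by simp
    also have "\<dots> \<le> c * 2 + \<tau> * d"
      using qi(1) E' p by (intro add_right_mono mult_left_mono) (auto simp: c_def)
    \<comment> \<open>The size of the region drops out here: both \<open>\<delta> * \<tau>\<close>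
      and \<open>\<delta> * \<tau> * \<rho>\<close> are at most
      \<open>\<delta> * R^2\<close>.\<close>
    also have "\<tau> * d \<le> (p + 2) * E' + 2"
    proof -
      have "\<delta> * \<tau> \<le> \<delta> * R\<^sup>2" "\<delta> * (\<tau> * \<rho>) \<le> \<delta> * R\<^sup>2"
      proof -
        have "\<tau> \<le> R" using R\<tau> \<tau> by simp
        also have "\<dots> \<le> R\<^sup>2" using R1 by (simp add: power2_eq_square)
        finally have "\<tau> \<le> R\<^sup>2" .
        moreover have "\<tau> * \<rho> \<le> R\<^sup>2"
          unfolding power2_eq_square using R\<tau> \<tau> R1 by (intro mult_mono) (auto simp: \<rho>_def)
        ultimately show "\<delta> * \<tau> \<le> \<delta> * R\<^sup>2" "\<delta> * (\<tau> * \<rho>) \<le> \<delta> * R\<^sup>2"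
          using \<delta> by (auto intro: mult_left_mono)
      qed
      then have 1: "\<delta> * \<tau> \<le> 1" "\<delta> * (\<tau> * \<rho>) \<le> 1 / 2" using \<delta>R by linarith+
      have "\<tau> * d = (\<delta> * \<tau>) * ((p + 2) * E') + 4 * (\<delta> * (\<tau> * \<rho>))" by (simp add: d_def algebra_simps)
      also have "\<dots> \<le> 1 * ((p + 2) * E') + 4 * (1 / 2)"
        using 1 p E' by (intro add_mono mult_right_mono mult_left_mono) auto
      finally show ?thesis by simp
    qed
    finally show "(LINT t:{0..\<tau>}|lborel. N t) \<le> (p + 2) * 5 * E' + 10"
      by (simp add: c_def algebra_simps)
  qed
  \<comment> \<open>The factor \<open>p + 1\<close> converts \<open>V\<close> into the power of
    \<open>u\<close>, 2 undoes the lower bound 1/2 of the cutoff, and \<open>2 / (p - 1)\<close>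
    inverts the coefficient of the bulk term.\<close>
  define K where "K = 4 * (p + 1) / (p - 1)"
  have K: "0 \<le> K" "2 * (p + 1) = K * ((p - 1) / 2)" using p by (auto simp: K_def field_simps)
  have L0: "0 \<le> L t" if "0 \<le> t" for t
    unfolding L_def set_lebesgue_integral_def using l0[OF that] by (intro integral_nonneg_AE AE_I2) auto
  have inner: "(\<integral>\<^sup>+x\<in>{- t - 1..t + 1}.
      ennreal (((t + 1)\<^sup>2 - x\<^sup>2) * \<bar>u (t, x)\<bar> powr (p + 1) / (t + 1) ^ 3) \<partial>lborel)
    \<le> ennreal (K * (N t - B t))" if t: "t \<in> {0..\<tau>}" for t
  proof -
    have "(\<integral>\<^sup>+x\<in>{- t - 1..t + 1}. ennreal (((t + 1)\<^sup>2 - x\<^sup>2) * \<bar>u (t, x)\<bar> powr (p + 1) / (t + 1) ^ 3) \<partial>lborel)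
        \<le> (\<integral>\<^sup>+x. ennreal (2 * (p + 1) * (indicator {-\<rho>..\<rho>} x * l (t, x))) \<partial>lborel)"
    proof (rule nn_integral_mono)
      fix x
      show "ennreal (((t + 1)\<^sup>2 - x\<^sup>2) * \<bar>u (t, x)\<bar> powr (p + 1) / (t + 1) ^ 3) * indicator {- t - 1..t + 1} x
          \<le> ennreal (2 * (p + 1) * (indicator {-\<rho>..\<rho>} x * l (t, x)))"
      proof (cases "\<bar>x\<bar> \<le> t + 1")
        case True
        have T: "0 < t + 1" using t by simp
        have \<kappa>: "1 / 2 \<le> cutoff \<rho> (t, x)"
          using cutoff_range(4)[OF \<rho>(1), of "(t, x)"] True t \<rho>(3) by simp
        have \<sigma>\<theta>: "((t + 1)\<^sup>2 - x\<^sup>2) / (t + 1) ^ 3 = (1 - (\<sigma> (t, x))\<^sup>2) * \<theta> (t, x)"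
        proof (cases "\<bar>x\<bar> < t + 1")
          case True
          then have "\<sigma> (t, x) = x / (t + 1)" using \<sigma>_inside(1)[of "(t, x)"] by (simp add: \<theta>_def)
          moreover have "(T\<^sup>2 - x\<^sup>2) / T ^ 3 = (1 - (x / T)\<^sup>2) * (1 / T)" if "0 < T" for T :: real
            using that by (simp add: power3_eq_cube power2_eq_square field_simps)
          ultimately show ?thesis using T by (simp add: \<theta>_def)
        next
          \<comment> \<open>On the edge of the cone both weights vanish.\<close>
          case False
          then have "\<bar>x\<bar> = \<bar>t + 1\<bar>" using \<open>\<bar>x\<bar> \<le> t + 1\<close> by simp
          then have "(t + 1)\<^sup>2 = x\<^sup>2" by (metis power2_abs)
          then show ?thesis using \<sigma>_outside(1)[of "(t, x)"] False t by simp
        qed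
        have w0: "0 \<le> (1 - (\<sigma> (t, x))\<^sup>2) * \<theta> (t, x) * ((p + 1) * V (t, x))"
          using \<sigma>_le_1[of "(t, x)"] T p V_nonneg by (auto simp: \<theta>_def abs_square_le_1)
        have "((t + 1)\<^sup>2 - x\<^sup>2) * \<bar>u (t, x)\<bar> powr (p + 1) / (t + 1) ^ 3
            = ((t + 1)\<^sup>2 - x\<^sup>2) / (t + 1) ^ 3 * \<bar>u (t, x)\<bar> powr (p + 1)" by simp
        also have "\<dots> = (1 - (\<sigma> (t, x))\<^sup>2) * \<theta> (t, x) * ((p + 1) * V (t, x))"
          unfolding \<sigma>\<theta> using p by (simp add: V_def potential_def)
        also have "\<dots> = (2 * (1 / 2)) * ((1 - (\<sigma> (t, x))\<^sup>2) * \<theta> (t, x) * ((p + 1) * V (t, x)))" by simp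
        also have "\<dots> \<le> (2 * cutoff \<rho> (t, x)) * ((1 - (\<sigma> (t, x))\<^sup>2) * \<theta> (t, x) * ((p + 1) * V (t, x)))"
          using \<kappa> w0 by (intro mult_right_mono mult_left_mono) auto
        also have "\<dots> = 2 * (p + 1) * (indicator {-\<rho>..\<rho>} x * l (t, x))"
          using True t \<rho>(2) by (simp add: l_def indicator_def abs_le_iff)
        finally show ?thesis using True by (simp add: indicator_def ennreal_leI)
      next
        case False
        then have "x \<notin> {- t - 1..t + 1}" by auto
        then show ?thesis by simp
      qed
    qed
    also have "\<dots> = ennreal (\<integral>x. 2 * (p + 1) * (indicator {-\<rho>..\<rho>} x * l (t, x)) \<partial>lborel)"
      using li l0 p t by (intro nn_integral_eq_integral) (auto simp: set_integrable_def)
    also have "(\<integral>x. 2 * (p + 1) * (indicator {-\<rho>..\<rho>} x * l (t, x)) \<partial>lborel) = 2 * (p + 1) * L t"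
      by (simp add: L_def set_lebesgue_integral_def)
    also have "\<dots> = K * ((p - 1) / 2 * L t)" using K(2) by simp
    also have "ennreal \<dots> \<le> ennreal (K * (N t - B t))"
      using key[OF t] K(1) by (intro ennreal_leI mult_left_mono)
    finally show ?thesis .
  qed
  have NB: "0 \<le> N t - B t" if "t \<in> {0..\<tau>}" for t
    using key[OF that] L0[of t] that p by (intro order_trans[OF _ key[OF that]]) auto
  have "(\<integral>\<^sup>+t\<in>{0..\<tau>}. (\<integral>\<^sup>+x\<in>{- t - 1..t + 1}.
      ennreal (((t + 1)\<^sup>2 - x\<^sup>2) * \<bar>u (t, x)\<bar> powr (p + 1) / (t + 1) ^ 3) \<partial>lborel) \<partial>lborel)
      \<le> (\<integral>\<^sup>+t. ennreal (K * (indicator {0..\<tau>} t * (N t - B t))) \<partial>lborel)"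
    using inner by (intro nn_integral_mono) (auto simp: indicator_def)
  also have "\<dots> = ennreal (\<integral>t. K * (indicator {0..\<tau>} t * (N t - B t)) \<partial>lborel)"
    using set_integral_diff(1)[OF Nint Bint] NB K(1)
    by (intro nn_integral_eq_integral) (auto simp: set_integrable_def indicator_def)
  also have "(\<integral>t. K * (indicator {0..\<tau>} t * (N t - B t)) \<partial>lborel) = K * ((LINT t:{0..\<tau>}|lborel. N t) - (LINT t:{0..\<tau>}|lborel. B t))"
    using set_integral_diff(2)[OF Nint Bint] by (simp add: set_lebesgue_integral_def)
  also have "\<dots> = K * ((LINT t:{0..\<tau>}|lborel. N t) + Q 0 - Q \<tau>)" using id by simp
  \<comment> \<open>The time integral of \<open>B\<close> has been replaced by the two boundary
    terms. Adding up, \<open>5 (p + 2) + 2 (p + 4) = 7 p + 18\<close> and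
    \<open>10 + 1 + 1 = 12\<close>.\<close>
  also have "ennreal \<dots> \<le> ennreal (K * (((p + 2) * 5 * E' + 10) + ((p + 4) * E' + 1) + ((p + 4) * E' + 1)))"
  proof (intro ennreal_leI mult_left_mono K(1))
    have "Q 0 \<le> (p + 4) * E' + 1" "- Q \<tau> \<le> (p + 4) * E' + 1"
      using Qle[of 0] Qle[of \<tau>] \<tau> by auto
    then show "(LINT t:{0..\<tau>}|lborel. N t) + Q 0 - Q \<tau>
        \<le> ((p + 2) * 5 * E' + 10) + ((p + 4) * E' + 1) + ((p + 4) * E' + 1)"
      using Nle by linarith
  qed
  also have "K * (((p + 2) * 5 * E' + 10) + ((p + 4) * E' + 1) + ((p + 4) * E' + 1)) =
      4 * (p + 1) / (p - 1) * ((7 * p + 18) * (4 * E + 2) + 12)"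
    unfolding K_def E'_def by (simp add: algebra_simps)
  finally show ?thesis .
qed

end

section \<open>Mollification in space-time\<close>

text \<open>A product kernel: the widths in time and space can be chosen independently, and a
  derivative in one variable falls on one factor only.\<close>

definition conv :: "(real \<Rightarrow> real) \<Rightarrow> (real \<Rightarrow> real) \<Rightarrow> (real \<times> real \<Rightarrow> real) \<Rightarrow> real \<times> real \<Rightarrow> real" where
  "conv k l G z = (LINT w|lborel. G w * (k (fst z - fst w) * l (snd z - snd w)))"

text \<open>The properties common to mollifiers of width at most 1 and their derivatives; the
  support radius 1 fixes the size of the boxes below.\<close>

definition kernel :: "(real \<Rightarrow> real) \<Rightarrow> bool" where
  "kernel k \<longleftrightarrow> continuous_on UNIV k \<and> (\<forall>x. \<bar>x\<bar> > 1 \<longrightarrow> k x = 0)"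

lemma kernel_bounded:
  assumes "kernel k"
  obtains M where "M \<ge> 0" "\<And>x. \<bar>k x\<bar> \<le> M"
proof -
  have "bounded (k ` {-1..1})"
    using assms continuous_on_subset unfolding kernel_def
    by (intro compact_imp_bounded compact_continuous_image) auto
  then obtain M where "\<And>x. x \<in> {-1..1} \<Longrightarrow> \<bar>k x\<bar> \<le> M"
    unfolding bounded_iff by (metis imageI real_norm_def)
  moreover have "k x = 0" if "x \<notin> {-1..1}" for x
    using that assms by (auto simp: kernel_def)
  ultimately have "\<bar>k x\<bar> \<le> max M 0" for x by (cases "x \<in> {-1..1}") force+
  then show ?thesis using that[of "max M 0"] by auto
qed

lemma continuous_on_tensor_kernel:
  assumes "kernel k" "kernel l" "continuous_on S a" "continuous_on S b" "continuous_on S c"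
  shows "continuous_on S (\<lambda>z. c z * (k (a z) * l (b z)))"
proof -
  have "continuous_on S (\<lambda>z. k (a z))" "continuous_on S (\<lambda>z. l (b z))"
    using assms continuous_on_compose2[of UNIV k S a] continuous_on_compose2[of UNIV l S b]
    by (auto simp: kernel_def)
  with assms(5) show ?thesis by (intro continuous_on_mult)
qed

text \<open>For all \<open>z\<close> within 1 of \<open>(t, x)\<close> the domain of integration can
  be frozen to one compact box, as continuity of parameter integrals and the Leibniz rule require.
  The half-width 2 is this 1 plus the radius of the kernels.\<close>

lemma conv_eq_integral:
  assumes k: "kernel k" "kernel l" and G: "continuous_on UNIV G"
    and z: "\<bar>fst z - t\<bar> \<le> 1" "\<bar>snd z - x\<bar> \<le> 1"
  shows "conv k l G z =
    integral (cbox (t - 2, x - 2) (t + 2, x + 2)) (\<lambda>w. G w * (k (fst z - fst w) * l (snd z - snd w)))"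
proof -
  define h where "h w = G w * (k (fst z - fst w) * l (snd z - snd w))" for w
  define S where "S = cbox (t - 2, x - 2) (t + 2, x + 2)"
  have "continuous_on S h"
    unfolding h_def
    by (intro continuous_on_tensor_kernel k continuous_on_subset[OF G] continuous_intros) simp
  then have int: "set_integrable lborel S h"
    unfolding S_def set_integrable_def by (intro borel_integrable_compact) auto
  have "h w = 0" if "w \<notin> S" for w
  proof -
    have "\<not> (\<bar>fst w - t\<bar> \<le> 2 \<and> \<bar>snd w - x\<bar> \<le> 2)"
      using that by (cases w) (auto simp: S_def cbox_Pair_eq abs_le_iff)
    then have "\<bar>fst z - fst w\<bar> > 1 \<or> \<bar>snd z - snd w\<bar> > 1" using z by linarith
    then show ?thesis using k by (auto simp: h_def kernel_def)
  qed
  then have "indicator S w *\<^sub>R h w = h w" for w by (cases "w \<in> S") simp_all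
  then have "conv k l G z = (LINT w:S|lborel. h w)"
    by (simp only: set_lebesgue_integral_def conv_def h_def[symmetric])
  also have "\<dots> = integral S h" using set_borel_integral_eq_integral(2)[OF int] .
  finally show ?thesis by (simp add: S_def h_def[abs_def])
qed

lemma continuous_on_conv:
  assumes k: "kernel k" "kernel l" and G: "continuous_on UNIV G"
  shows "continuous_on UNIV (conv k l G)"
proof (intro continuous_at_imp_continuous_on ballI)
  fix z0 :: "real \<times> real"
  define t x where "t = fst z0" and "x = snd z0"
  let ?U = "{t - 1<..<t + 1} \<times> {x - 1<..<x + 1}"
  have "continuous_on ?U (\<lambda>z. integral (cbox (t - 2, x - 2) (t + 2, x + 2))
      (\<lambda>w. G w * (k (fst z - fst w) * l (snd z - snd w))))"
  proof (rule integral_continuous_on_param)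
    have G': "continuous_on S (\<lambda>y. G (snd y))" for S :: "((real \<times> real) \<times> real \<times> real) set"
      by (rule continuous_on_compose2[OF G]) (auto intro: continuous_intros)
    show "continuous_on (?U \<times> cbox (t - 2, x - 2) (t + 2, x + 2))
        (\<lambda>(z, w). G w * (k (fst z - fst w) * l (snd z - snd w)))"
      unfolding case_prod_unfold
      by (intro continuous_on_tensor_kernel k G' continuous_intros)
  qed
  then have "continuous_on ?U (conv k l G)"
    by (rule continuous_on_eq) (rule conv_eq_integral[OF k G, symmetric], auto)
  then show "isCont (conv k l G) z0"
    by (rule continuous_on_interior) (auto simp: interior_open open_Times t_def x_def mem_Times_iff)
qed

section \<open>Differentiation of the mollification\<close>

lemma conv_has_derivative_t:
  assumes k: "kernel k" "kernel k'" "kernel l" and G: "continuous_on UNIV G"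
    and d: "\<And>s. (k has_real_derivative k' s) (at s)"
  shows "((\<lambda>t. conv k l G (t, x)) has_real_derivative conv k' l G (t, x)) (at t)"
proof -
  let ?B = "cbox (t - 2, x - 2) (t + 2, x + 2)" and ?U = "{t - 1<..<t + 1}"
  have "((\<lambda>s. integral ?B (\<lambda>w. G w * (k (s - fst w) * l (x - snd w))))
      has_real_derivative integral ?B (\<lambda>w. G w * (k' (t - fst w) * l (x - snd w)))) (at t within ?U)"
  proof (rule leibniz_rule_field_derivative)
    show "((\<lambda>s. G w * (k (s - fst w) * l (x - snd w))) has_real_derivative
        G w * (k' (s - fst w) * l (x - snd w))) (at s within ?U)" for s w
    proof -
      have "((\<lambda>s. k (s - fst w)) has_real_derivative k' (s - fst w) * (1 - 0)) (at s within ?U)"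
        by (intro DERIV_chain2[OF d] DERIV_diff DERIV_ident DERIV_const)
      from DERIV_cmult[OF DERIV_cmult_right[OF this, of "l (x - snd w)"], of "G w"]
      show ?thesis by simp
    qed
    show "(\<lambda>w. G w * (k (s - fst w) * l (x - snd w))) integrable_on ?B" for s
      by (intro integrable_continuous continuous_on_tensor_kernel k continuous_on_subset[OF G] continuous_intros) simp
    show "continuous_on (?U \<times> ?B) (\<lambda>(s, w). G w * (k' (s - fst w) * l (x - snd w)))"
    proof -
      have "continuous_on (?U \<times> ?B) (\<lambda>y. G (snd y))"
        by (rule continuous_on_compose2[OF G]) (auto intro: continuous_intros)
      then show ?thesis
        unfolding case_prod_unfold by (intro continuous_on_tensor_kernel k continuous_intros)
    qed
  qed simp_all
  moreover have "integral ?B (\<lambda>w. G w * (k' (t - fst w) * l (x - snd w))) = conv k' l G (t, x)"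
    using conv_eq_integral[OF k(2,3) G, of "(t, x)" t x] by simp
  ultimately have "((\<lambda>s. integral ?B (\<lambda>w. G w * (k (s - fst w) * l (x - snd w))))
      has_real_derivative conv k' l G (t, x)) (at t)"
    using at_within_open[of t ?U] by simp
  then show ?thesis
  proof (rule has_field_derivative_transform_within_open[of _ _ _ ?U])
    show "integral ?B (\<lambda>w. G w * (k (s - fst w) * l (x - snd w))) = conv k l G (s, x)" if "s \<in> ?U" for s
      using conv_eq_integral[OF k(1,3) G, of "(s, x)" t x] that by (simp add: abs_le_iff)
  qed simp_all
qed

lemma conv_has_derivative_x:
  assumes k: "kernel k" "kernel l" "kernel l'" and G: "continuous_on UNIV G"
    and d: "\<And>s. (l has_real_derivative l' s) (at s)"
  shows "((\<lambda>x. conv k l G (t, x)) has_real_derivative conv k l' G (t, x)) (at x)"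
proof -
  let ?B = "cbox (t - 2, x - 2) (t + 2, x + 2)" and ?U = "{x - 1<..<x + 1}"
  have "((\<lambda>s. integral ?B (\<lambda>w. G w * (k (t - fst w) * l (s - snd w))))
      has_real_derivative integral ?B (\<lambda>w. G w * (k (t - fst w) * l' (x - snd w)))) (at x within ?U)"
  proof (rule leibniz_rule_field_derivative)
    show "((\<lambda>s. G w * (k (t - fst w) * l (s - snd w))) has_real_derivative
        G w * (k (t - fst w) * l' (s - snd w))) (at s within ?U)" for s w
    proof -
      have "((\<lambda>s. l (s - snd w)) has_real_derivative l' (s - snd w) * (1 - 0)) (at s within ?U)"
        by (intro DERIV_chain2[OF d] DERIV_diff DERIV_ident DERIV_const)
      from DERIV_cmult[OF DERIV_cmult[OF this, of "k (t - fst w)"], of "G w"]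
      show ?thesis by simp
    qed
    show "(\<lambda>w. G w * (k (t - fst w) * l (s - snd w))) integrable_on ?B" for s
      by (intro integrable_continuous continuous_on_tensor_kernel k continuous_on_subset[OF G] continuous_intros) simp
    show "continuous_on (?U \<times> ?B) (\<lambda>(s, w). G w * (k (t - fst w) * l' (s - snd w)))"
    proof -
      have "continuous_on (?U \<times> ?B) (\<lambda>y. G (snd y))"
        by (rule continuous_on_compose2[OF G]) (auto intro: continuous_intros)
      then show ?thesis
        unfolding case_prod_unfold by (intro continuous_on_tensor_kernel k continuous_intros)
    qed
  qed simp_all
  moreover have "integral ?B (\<lambda>w. G w * (k (t - fst w) * l' (x - snd w))) = conv k l' G (t, x)"
    using conv_eq_integral[OF k(1,3) G, of "(t, x)" t x] by simp
  ultimately have "((\<lambda>s. integral ?B (\<lambda>w. G w * (k (t - fst w) * l (s - snd w))))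
      has_real_derivative conv k l' G (t, x)) (at x)"
    using at_within_open[of x ?U] by simp
  then show ?thesis
  proof (rule has_field_derivative_transform_within_open[of _ _ _ ?U])
    show "integral ?B (\<lambda>w. G w * (k (t - fst w) * l (s - snd w))) = conv k l G (t, s)" if "s \<in> ?U" for s
      using conv_eq_integral[OF k(1,2) G, of "(t, s)" t x] that by (simp add: abs_le_iff)
  qed simp_all
qed

lemma deriv_eq_0_outside:
  assumes "smooth k" "\<And>x. \<bar>x\<bar> > \<epsilon> \<Longrightarrow> k x = 0" "\<bar>x\<bar> > \<epsilon>"
  shows "deriv k x = 0"
proof (rule DERIV_unique[OF smooth_DERIV[OF assms(1)]])
  have "open {x. \<epsilon> < \<bar>x::real\<bar>}" by (intro open_Collect_less continuous_intros)
  then show "(k has_real_derivative 0) (at x)"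
    using assms by (intro has_field_derivative_transform_within_open[OF DERIV_const[of 0]]) auto
qed

section \<open>Reflected and translated kernels as test functions\<close>

lemma smooth_tensor:
  fixes k l :: "real \<Rightarrow> real"
  assumes "smooth k" "smooth l"
  shows "smooth (\<lambda>w. k (t - fst w) * l (x - snd w))"
proof -
  have "smooth (\<lambda>w. k (t + - fst w))" "smooth (\<lambda>w. l (x + - snd w))"
    by (intro smooth_affine assms bounded_linear_minus bounded_linear_fst bounded_linear_snd)+
  then show ?thesis by (auto intro: smooth_mult)
qed

lemma test_fun_tensor:
  assumes "smooth k" "smooth l" "kernel k" "kernel l"
  shows "test_fun (\<lambda>w. k (t - fst w) * l (x - snd w))"
proof -
  have "{w. k (t - fst w) * l (x - snd w) \<noteq> 0} \<subseteq> cbox (t - 1, x - 1) (t + 1, x + 1)"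
  proof
    fix w assume "w \<in> {w. k (t - fst w) * l (x - snd w) \<noteq> 0}"
    then have "\<not> 1 < \<bar>t - fst w\<bar>" "\<not> 1 < \<bar>x - snd w\<bar>" using assms(3,4) by (auto simp: kernel_def)
    then show "w \<in> cbox (t - 1, x - 1) (t + 1, x + 1)"
      by (cases w) (auto simp: cbox_Pair_eq)
  qed
  then show ?thesis
    using smooth_tensor[OF assms(1,2)] bounded_subset[OF bounded_cbox]
    by (auto simp: test_fun_def smooth_def compact_closure)
qed

lemma test_fun_reflect:
  assumes "smooth k" "kernel k"
  shows "test_fun (\<lambda>y. k (x - y))"
proof -
  have "smooth (\<lambda>y. k (x + - y))"
    by (intro smooth_affine assms bounded_linear_minus bounded_linear_ident)
  moreover have "{y. k (x - y) \<noteq> 0} \<subseteq> {x - 1..x + 1}"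
  proof
    fix y assume "y \<in> {y. k (x - y) \<noteq> 0}"
    then have "\<not> 1 < \<bar>x - y\<bar>" using assms(2) by (auto simp: kernel_def)
    then show "y \<in> {x - 1..x + 1}" by auto
  qed
  then have "bounded {y. k (x - y) \<noteq> 0}" by (rule bounded_subset[rotated]) simp
  ultimately show ?thesis
    by (simp add: test_fun_def smooth_def compact_closure)
qed

text \<open>The scalar \<open>c\<close> absorbs the sign from the reflection, so the rule can be
  applied to its own result for second derivatives.\<close>

lemma dir_deriv_tensor:
  assumes "smooth k" "smooth l"
  shows "dir_deriv (1, 0) (\<lambda>w. c * (k (t - fst w) * l (x - snd w))) =
      (\<lambda>w. (- c) * (deriv k (t - fst w) * l (x - snd w)))"
    and "dir_deriv (0, 1) (\<lambda>w. c * (k (t - fst w) * l (x - snd w))) =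
      (\<lambda>w. (- c) * (k (t - fst w) * deriv l (x - snd w)))"
proof -
  have k: "(k has_derivative (\<lambda>h. h * deriv k s)) (at s)" and l: "(l has_derivative (\<lambda>h. h * deriv l s)) (at s)" for s
    using smooth_DERIV[OF assms(1)] smooth_DERIV[OF assms(2)]
    by (simp_all add: has_field_derivative_def mult_commute_abs)
  have "((\<lambda>w. c * (k (t - fst w) * l (x - snd w))) has_derivative
      (\<lambda>e. c * (k (t - fst w) * (- snd e * deriv l (x - snd w)) + (- fst e * deriv k (t - fst w)) * l (x - snd w)))) (at w)" for w
    by (auto intro!: derivative_eq_intros has_derivative_compose[OF _ k] has_derivative_compose[OF _ l])
  from dir_deriv_eq[OF this]
  show "dir_deriv (1, 0) (\<lambda>w. c * (k (t - fst w) * l (x - snd w))) =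
      (\<lambda>w. (- c) * (deriv k (t - fst w) * l (x - snd w)))"
    "dir_deriv (0, 1) (\<lambda>w. c * (k (t - fst w) * l (x - snd w))) =
      (\<lambda>w. (- c) * (k (t - fst w) * deriv l (x - snd w)))"
    by (auto simp: fun_eq_iff)
qed

section \<open>Local integrability and iterated integrals\<close>

lemma locally_integrable_measurable:
  assumes "locally_integrable f"
  shows "f \<in> borel_measurable borel"
proof (rule borel_measurable_LIMSEQ_real)
  fix n :: nat
  have "set_integrable lborel (cball 0 (real n)) f"
    using assms compact_cball by (auto simp: locally_integrable_def)
  then show "(\<lambda>x. indicator (cball 0 (real n)) x * f x) \<in> borel_measurable borel"
    by (auto simp: set_integrable_def dest: borel_measurable_integrable)
next
  fix x :: 'a
  have "\<forall>\<^sub>F n in sequentially. f x = indicator (cball 0 (real n)) x * f x"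
    using eventually_ge_at_top[of "nat \<lceil>norm x\<rceil>"]
    by eventually_elim (auto simp: indicator_def)
  then show "(\<lambda>n. indicator (cball 0 (real n)) x * f x) \<longlonglongrightarrow> f x"
    by (rule Lim_transform_eventually[OF tendsto_const])
qed

lemma integrable_mult_compact_support:
  fixes f h :: "'a::euclidean_space \<Rightarrow> real"
  assumes "locally_integrable f" "compact K" "h \<in> borel_measurable borel"
    and "\<And>x. \<bar>h x\<bar> \<le> M" "\<And>x. x \<notin> K \<Longrightarrow> h x = 0"
  shows "integrable lborel (\<lambda>x. f x * h x)"
proof (rule Bochner_Integration.integrable_bound)
  show "integrable lborel (\<lambda>x. M * (indicator K x *\<^sub>R f x))"
    using assms(1,2) by (auto simp: locally_integrable_def set_integrable_def)
  show "(\<lambda>x. f x * h x) \<in> borel_measurable lborel"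
    using locally_integrable_measurable[OF assms(1)] assms(3) by simp
  have "\<bar>f x\<bar> * \<bar>h x\<bar> \<le> \<bar>f x\<bar> * \<bar>M\<bar>" for x
    using assms(4)[of x] by (intro mult_left_mono) auto
  then show "AE x in lborel. norm (f x * h x) \<le> norm (M * (indicator K x *\<^sub>R f x))"
    using assms(5) by (intro AE_I2) (auto simp: indicator_def abs_mult mult.commute)
qed

lemma continuous_locally_integrable: "continuous_on UNIV f \<Longrightarrow> locally_integrable f"
  unfolding locally_integrable_def set_integrable_def
  by (intro allI impI borel_integrable_compact) (auto intro: continuous_on_subset)

lemma integrable_tensor:
  assumes "locally_integrable G" and k: "kernel k" "kernel l"
  shows "integrable lborel (\<lambda>w. G w * (k (t - fst w) * l (x - snd w)))"
proof -
  obtain M where M: "M \<ge> 0" "\<And>s. \<bar>k s\<bar> \<le> M" using kernel_bounded[OF k(1)] by blast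
  obtain N where N: "N \<ge> 0" "\<And>s. \<bar>l s\<bar> \<le> N" using kernel_bounded[OF k(2)] by blast
  show ?thesis
  proof (rule integrable_mult_compact_support[OF assms(1), where M = "M * N"
        and K = "cbox (t - 1, x - 1) (t + 1, x + 1)"])
    show "(\<lambda>w. k (t - fst w) * l (x - snd w)) \<in> borel_measurable borel"
      using continuous_on_tensor_kernel[OF k, of UNIV "\<lambda>w. t - fst w" "\<lambda>w. x - snd w" "\<lambda>w. 1"]
      by (intro borel_measurable_continuous_onI) (simp add: continuous_intros)
    show "\<bar>k (t - fst w) * l (x - snd w)\<bar> \<le> M * N" for w
      unfolding abs_mult using M N by (intro mult_mono) auto
    show "k (t - fst w) * l (x - snd w) = 0" if "w \<notin> cbox (t - 1, x - 1) (t + 1, x + 1)" for w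
    proof -
      have "1 < \<bar>t - fst w\<bar> \<or> 1 < \<bar>x - snd w\<bar>"
        using that by (cases w) (auto simp: cbox_Pair_eq abs_if split: if_splits)
      then show ?thesis using k by (auto simp: kernel_def)
    qed
  qed simp
qed

text \<open>With space inside, the mollification averages over nearby times slices that are already
  smoothed in space. Estimates at a fixed time thus reduce to continuity in time of the smoothed
  slices.\<close>

lemma conv_iterated:
  assumes "locally_integrable G" "kernel k" "kernel l"
  shows "conv k l G (t, x) = (LINT s|lborel. k (t - s) * (LINT y|lborel. l (x - y) * G (s, y)))"
    and "integrable lborel (\<lambda>s. k (t - s) * (LINT y|lborel. l (x - y) * G (s, y)))"
proof -
  have int: "integrable (lborel \<Otimes>\<^sub>M lborel) (\<lambda>w. G w * (k (t - fst w) * l (x - snd w)))"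
    using integrable_tensor[OF assms] by (simp add: lborel_prod)
  have eq: "(LINT y|lborel. G (s, y) * (k (t - fst (s, y)) * l (x - snd (s, y)))) =
      k (t - s) * (LINT y|lborel. l (x - y) * G (s, y))" for s
    by (simp add: mult_ac flip: integral_mult_right_zero)
  show "conv k l G (t, x) = (LINT s|lborel. k (t - s) * (LINT y|lborel. l (x - y) * G (s, y)))"
    using lborel_pair.integral_fst'[OF int] unfolding eq by (simp add: conv_def lborel_prod)
  show "integrable lborel (\<lambda>s. k (t - s) * (LINT y|lborel. l (x - y) * G (s, y)))"
    using lborel_pair.integrable_fst'[OF int] unfolding eq .
qed

section \<open>Averages against mollifiers\<close>

lemma mollifier_reflect:
  assumes "mollifier \<epsilon> k"
  shows "integrable lborel (\<lambda>y. k (x - y))" "(LINT y|lborel. k (x - y)) = 1"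
proof -
  have "has_bochner_integral lborel (\<lambda>y. k (x + (- 1) * y)) (1 /\<^sub>R \<bar>- 1\<bar>)"
    using assms by (subst lborel_has_bochner_integral_real_affine_iff[symmetric]) (auto simp: mollifier_def)
  then show "integrable lborel (\<lambda>y. k (x - y))" "(LINT y|lborel. k (x - y)) = 1"
    by (auto simp: has_bochner_integral_iff)
qed

lemma mollify_close:
  assumes k: "mollifier \<epsilon> k" and int: "integrable lborel (\<lambda>y. k (x - y) * g y)"
    and close: "\<And>y. \<bar>x - y\<bar> \<le> \<epsilon> \<Longrightarrow> \<bar>g y - c\<bar> \<le> d"
  shows "\<bar>(LINT y|lborel. k (x - y) * g y) - c\<bar> \<le> d"
proof -
  note kx = mollifier_reflect[OF k, of x]
  have eq: "(\<lambda>y. k (x - y) * (g y - c)) = (\<lambda>y. k (x - y) * g y - k (x - y) * c)"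
    by (simp add: algebra_simps)
  have int': "integrable lborel (\<lambda>y. k (x - y) * (g y - c))"
    unfolding eq using int kx(1) by (intro Bochner_Integration.integrable_diff) auto
  have "(LINT y|lborel. k (x - y) * g y) - c = (LINT y|lborel. k (x - y) * (g y - c))"
    unfolding eq using int kx by simp
  also have "\<bar>\<dots>\<bar> \<le> (LINT y|lborel. \<bar>k (x - y) * (g y - c)\<bar>)"
    by (rule integral_abs_bound)
  also have "\<dots> \<le> (LINT y|lborel. k (x - y) * d)"
  proof (rule integral_mono)
    show "\<bar>k (x - y) * (g y - c)\<bar> \<le> k (x - y) * d" for y
    proof (cases "\<bar>x - y\<bar> \<le> \<epsilon>")
      case True
      then show ?thesis
        unfolding abs_mult using k close[of y] by (intro mult_mono) (auto simp: mollifier_def)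
    qed (use k in \<open>auto simp: mollifier_def\<close>)
  qed (use int' kx in auto)
  also have "\<dots> = d" using kx by simp
  finally show ?thesis .
qed

text \<open>Jensen's inequality for the probability density \<open>k (x - y)\<close> in
  \<open>y\<close>, then Tonelli, since \<open>k (x - y)\<close> also has integral 1 in
  \<open>x\<close>.\<close>

lemma mollify_square_le:
  assumes k: "mollifier \<epsilon> k" and g: "g \<in> borel_measurable borel"
    and int: "\<And>x. integrable lborel (\<lambda>y. k (x - y) * g y)"
  shows "(\<integral>\<^sup>+x. ennreal ((LINT y|lborel. k (x - y) * g y)\<^sup>2) \<partial>lborel) \<le> (\<integral>\<^sup>+y. ennreal ((g y)\<^sup>2) \<partial>lborel)"
proof -
  have k0: "0 \<le> k s" for s using k by (simp add: mollifier_def)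
  have [measurable]: "k \<in> borel_measurable borel"
    using k by (auto simp: mollifier_def has_bochner_integral_iff dest: borel_measurable_integrable)
  note [measurable] = g
  have jensen: "ennreal ((LINT y|lborel. k (x - y) * g y)\<^sup>2) \<le> (\<integral>\<^sup>+y. ennreal (k (x - y) * (g y)\<^sup>2) \<partial>lborel)" for x
  proof (cases "(\<integral>\<^sup>+y. ennreal (k (x - y) * (g y)\<^sup>2) \<partial>lborel) = \<infinity>")
    case False
    then have i2: "integrable lborel (\<lambda>y. k (x - y) * (g y)\<^sup>2)"
      using k0 by (intro integrableI_nonneg) (auto simp: less_top)
    \<comment> \<open>Jensen as nonnegativity of the variance: \<open>c\<close> is the mean, and
      integrating the square below bounds \<open>c^2\<close> by the second moment.\<close>
    define c where "c = (LINT y|lborel. k (x - y) * g y)"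
    have eq: "k (x - y) * (g y - c)\<^sup>2 = k (x - y) * (g y)\<^sup>2 - 2 * c * (k (x - y) * g y) + c\<^sup>2 * k (x - y)" for y
      by (simp add: power2_diff algebra_simps)
    have "0 \<le> (LINT y|lborel. k (x - y) * (g y - c)\<^sup>2)"
      using k0 by (intro integral_nonneg_AE AE_I2) simp
    also have "\<dots> = (LINT y|lborel. k (x - y) * (g y)\<^sup>2) - 2 * c * c + c\<^sup>2 * 1"
      unfolding eq using i2 int[of x] mollifier_reflect[OF k, of x] by (simp add: c_def)
    finally have "c\<^sup>2 \<le> (LINT y|lborel. k (x - y) * (g y)\<^sup>2)" by (simp add: power2_eq_square)
    then show ?thesis
      using nn_integral_eq_integral[OF i2] k0 by (simp add: c_def ennreal_leI)
  qed simp
  have "(\<integral>\<^sup>+x. ennreal ((LINT y|lborel. k (x - y) * g y)\<^sup>2) \<partial>lborel)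
      \<le> (\<integral>\<^sup>+x. \<integral>\<^sup>+y. ennreal (k (x - y) * (g y)\<^sup>2) \<partial>lborel \<partial>lborel)"
    by (intro nn_integral_mono jensen)
  also have "\<dots> = (\<integral>\<^sup>+y. \<integral>\<^sup>+x. ennreal (k (x - y) * (g y)\<^sup>2) \<partial>lborel \<partial>lborel)"
    by (rule lborel_pair.Fubini'[symmetric]) measurable
  also have "\<dots> = (\<integral>\<^sup>+y. ennreal ((g y)\<^sup>2) \<partial>lborel)"
  proof (rule nn_integral_cong)
    fix y
    have "has_bochner_integral lborel (\<lambda>x. k (- y + 1 * x)) (1 /\<^sub>R \<bar>1\<bar>)"
      using k by (subst lborel_has_bochner_integral_real_affine_iff[symmetric]) (auto simp: mollifier_def)
    then have "integrable lborel (\<lambda>x. k (x - y))" "(LINT x|lborel. k (x - y)) = 1"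
      by (auto simp: has_bochner_integral_iff)
    then have "(\<integral>\<^sup>+x. ennreal (k (x - y)) \<partial>lborel) = 1"
      using k0 by (simp add: nn_integral_eq_integral)
    then show "(\<integral>\<^sup>+x. ennreal (k (x - y) * (g y)\<^sup>2) \<partial>lborel) = ennreal ((g y)\<^sup>2)"
      using k0 by (simp add: ennreal_mult nn_integral_multc)
  qed
  finally show ?thesis .
qed

lemma mollifier_kernel:
  assumes "mollifier \<epsilon> k" "\<epsilon> \<le> 1"
  shows "kernel k" "kernel (deriv k)" "kernel (deriv (deriv k))"
    and "smooth k" "smooth (deriv k)" "smooth (deriv (deriv k))"
proof -
  show s: "smooth k" "smooth (deriv k)" "smooth (deriv (deriv k))"
    using assms by (auto simp: mollifier_def intro: smooth_deriv)
  have 0: "k x = 0" if "\<bar>x\<bar> > 1" for x using assms that by (auto simp: mollifier_def)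
  note 1 = deriv_eq_0_outside[OF s(1) 0]
  show "kernel k" "kernel (deriv k)" "kernel (deriv (deriv k))"
    using s 0 1 deriv_eq_0_outside[OF s(2) 1] by (auto simp: kernel_def intro: smooth_continuous_on)
qed

text \<open>The test function is the kernel reflected about \<open>z\<close>; the sign from the
  reflection cancels the one in the definition of the weak derivative.\<close>

lemma conv_weak_deriv_t:
  assumes "has_weak_deriv (1, 0) G H" "smooth k" "smooth l" "kernel k" "kernel l"
  shows "conv (deriv k) l G z = conv k l H z"
proof -
  have D: "dir_deriv (1, 0) (\<lambda>w. k (fst z - fst w) * l (snd z - snd w)) =
      (\<lambda>w. - (deriv k (fst z - fst w) * l (snd z - snd w)))"
    using dir_deriv_tensor(1)[OF assms(2,3), of 1] by simp
  have T: "test_fun (\<lambda>w. k (fst z - fst w) * l (snd z - snd w))"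
    by (rule test_fun_tensor[OF assms(2-5)])
  have W: "\<forall>\<psi>. test_fun \<psi> \<longrightarrow>
      (LINT w|lborel. G w * dir_deriv (1, 0) \<psi> w) = - (LINT w|lborel. H w * \<psi> w)"
    using assms(1) unfolding has_weak_deriv_def by (elim conjE)
  have "(LINT w|lborel. G w * - (deriv k (fst z - fst w) * l (snd z - snd w))) =
      - (LINT w|lborel. H w * (k (fst z - fst w) * l (snd z - snd w)))"
    using W[rule_format, OF T] unfolding D .
  then show ?thesis by (simp add: conv_def)
qed

text \<open>Second derivatives do not see the reflection of the kernel, so testing the weak equation
  gives the mollified one. Its source is the mollified nonlinearity; the deviation from the
  nonlinearity of the mollification becomes the residual.\<close>

lemma conv_wave:
  assumes "distributional_solution p \<phi>" and cont: "continuous_on UNIV \<phi>" and k: "mollifier \<epsilon> k" "mollifier \<epsilon>' l" "\<epsilon> \<le> 1" "\<epsilon>' \<le> 1"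
  shows "conv (deriv (deriv k)) l \<phi> z - conv k (deriv (deriv l)) \<phi> z = - conv k l (\<lambda>z. nonlin p (\<phi> z)) z"
proof -
  note K = mollifier_kernel[OF k(1,3)] and L = mollifier_kernel[OF k(2,4)]
  define \<psi> where "\<psi> w = 1 * (k (fst z - fst w) * l (snd z - snd w))" for w
  have 1: "dir_deriv (1, 0) (dir_deriv (1, 0) \<psi>) = (\<lambda>w. deriv (deriv k) (fst z - fst w) * l (snd z - snd w))"
    unfolding \<psi>_def dir_deriv_tensor(1)[OF K(4) L(4)] dir_deriv_tensor(1)[OF K(5) L(4)] by simp
  have 2: "dir_deriv (0, 1) (dir_deriv (0, 1) \<psi>) = (\<lambda>w. k (fst z - fst w) * deriv (deriv l) (snd z - snd w))"
    unfolding \<psi>_def dir_deriv_tensor(2)[OF K(4) L(4)] dir_deriv_tensor(2)[OF K(4) L(5)] by simp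
  have T: "test_fun \<psi>" unfolding \<psi>_def using test_fun_tensor[OF K(4) L(4) K(1) L(1)] by simp
  have W: "\<forall>\<psi>. test_fun \<psi> \<longrightarrow>
      (LINT w|lborel. \<phi> w * (- dir_deriv (1, 0) (dir_deriv (1, 0) \<psi>) w + dir_deriv (0, 1) (dir_deriv (0, 1) \<psi>) w))
        = (LINT w|lborel. \<bar>\<phi> w\<bar> powr (p - 1) * \<phi> w * \<psi> w)"
    using assms(1) by (simp only: distributional_solution_def)
  have "(LINT w|lborel. \<phi> w * (- (deriv (deriv k) (fst z - fst w) * l (snd z - snd w))
        + k (fst z - fst w) * deriv (deriv l) (snd z - snd w))) =
      (LINT w|lborel. \<bar>\<phi> w\<bar> powr (p - 1) * \<phi> w * \<psi> w)"
    using W[rule_format, OF T] unfolding 1 2 .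
  also have "(LINT w|lborel. \<bar>\<phi> w\<bar> powr (p - 1) * \<phi> w * \<psi> w) = conv k l (\<lambda>z. nonlin p (\<phi> z)) z"
    by (simp add: conv_def nonlin_def \<psi>_def)
  also have "(\<lambda>w. \<phi> w * (- (deriv (deriv k) (fst z - fst w) * l (snd z - snd w))
        + k (fst z - fst w) * deriv (deriv l) (snd z - snd w))) =
      (\<lambda>w. \<phi> w * (k (fst z - fst w) * deriv (deriv l) (snd z - snd w))
        - \<phi> w * (deriv (deriv k) (fst z - fst w) * l (snd z - snd w)))"
    by (simp add: algebra_simps)
  also have "(LINT w|lborel. \<phi> w * (k (fst z - fst w) * deriv (deriv l) (snd z - snd w))
        - \<phi> w * (deriv (deriv k) (fst z - fst w) * l (snd z - snd w))) =
      conv k (deriv (deriv l)) \<phi> z - conv (deriv (deriv k)) l \<phi> z"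
    unfolding conv_def using continuous_locally_integrable[OF cont] K L
    by (intro Bochner_Integration.integral_diff integrable_tensor)
  finally show ?thesis by simp
qed

lemma integrable_kernel:
  assumes "locally_integrable g" "kernel l"
  shows "integrable lborel (\<lambda>y. l (x - y) * g y)"
proof -
  obtain M where M: "M \<ge> 0" "\<And>s. \<bar>l s\<bar> \<le> M" using kernel_bounded[OF assms(2)] by blast
  have "integrable lborel (\<lambda>y. g y * l (x - y))"
  proof (rule integrable_mult_compact_support[OF assms(1)])
    have "continuous_on UNIV (\<lambda>y. l (x - y))"
      using assms(2) unfolding kernel_def
      by (intro continuous_on_compose2[of UNIV l UNIV "\<lambda>y. x - y"]) (auto intro: continuous_intros)
    then show "(\<lambda>y. l (x - y)) \<in> borel_measurable borel" by (rule borel_measurable_continuous_onI)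
    show "\<bar>l (x - y)\<bar> \<le> M" for y using M by simp
    show "l (x - y) = 0" if "y \<notin> {x - 1..x + 1}" for y
      using that assms(2) by (auto simp: kernel_def abs_if)
  qed simp
  then show ?thesis by (simp add: mult.commute)
qed

lemma continuous_slice:
  fixes G :: "real \<times> real \<Rightarrow> real"
  shows "continuous_on UNIV G \<Longrightarrow> continuous_on S (\<lambda>y. G (s, y))"
  by (rule continuous_on_compose2[of UNIV G]) (auto intro!: continuous_intros)

section \<open>Closeness of the mollification to given slices\<close>

lemma conv_close_slice:
  assumes "mollifier \<epsilon> k" "\<epsilon> \<le> 1" "kernel l" "locally_integrable G"
    and "\<And>s. \<bar>t - s\<bar> \<le> \<epsilon> \<Longrightarrow> \<bar>(LINT y|lborel. l (x - y) * G (s, y)) - c\<bar> \<le> d"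
  shows "\<bar>conv k l G (t, x) - c\<bar> \<le> d"
  unfolding conv_iterated(1)[OF assms(4) mollifier_kernel(1)[OF assms(1,2)] assms(3)]
  using conv_iterated(2)[OF assms(4) mollifier_kernel(1)[OF assms(1,2)] assms(3)] assms(5)
  by (intro mollify_close[OF assms(1)])

lemma conv_close:
  assumes k: "mollifier \<epsilon> k" "\<epsilon> \<le> 1" and l: "mollifier \<epsilon>' l" "\<epsilon>' \<le> 1" and G: "continuous_on UNIV G"
    and close: "\<And>s y. \<bar>t - s\<bar> \<le> \<epsilon> \<Longrightarrow> \<bar>x - y\<bar> \<le> \<epsilon>' \<Longrightarrow> \<bar>G (s, y) - c\<bar> \<le> d"
  shows "\<bar>conv k l G (t, x) - c\<bar> \<le> d"
proof (rule conv_close_slice[OF k mollifier_kernel(1)[OF l] continuous_locally_integrable[OF G]])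
  fix s assume s: "\<bar>t - s\<bar> \<le> \<epsilon>"
  show "\<bar>(LINT y|lborel. l (x - y) * G (s, y)) - c\<bar> \<le> d"
    using close[OF s] continuous_slice[OF G]
    by (intro mollify_close[OF l(1)] integrable_kernel[OF _ mollifier_kernel(1)[OF l]]
        continuous_locally_integrable) auto
qed

lemma abs_powr_2: "\<bar>a\<bar> powr 2 = a\<^sup>2" for a :: real
  by (cases "a = 0") auto

lemma kernel_square_integrable:
  assumes "kernel l"
  shows "integrable lborel (\<lambda>y. (l (x - y))\<^sup>2)" "(LINT y|lborel. (l (x - y))\<^sup>2) = (LINT y|lborel. (l y)\<^sup>2)"
proof -
  have l: "locally_integrable l"
    using assms by (intro continuous_locally_integrable) (simp add: kernel_def)
  have "locally_integrable (\<lambda>y. l (x - y))"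
    using assms unfolding kernel_def
    by (intro continuous_locally_integrable continuous_on_compose2[of UNIV l UNIV "\<lambda>y. x - y"])
      (auto intro: continuous_intros)
  from integrable_kernel[OF this assms, of x] show 1: "integrable lborel (\<lambda>y. (l (x - y))\<^sup>2)"
    by (simp add: power2_eq_square)
  have "has_bochner_integral lborel (\<lambda>y. (l (x - (x + (- 1) * y)))\<^sup>2) ((LINT y|lborel. (l (x - y))\<^sup>2) /\<^sub>R \<bar>- 1\<bar>)"
    using 1 by (subst lborel_has_bochner_integral_real_affine_iff[symmetric, where t = x and c = "- 1" and f = "\<lambda>y. (l (x - y))\<^sup>2"])
      (auto simp: has_bochner_integral_iff)
  then show "(LINT y|lborel. (l (x - y))\<^sup>2) = (LINT y|lborel. (l y)\<^sup>2)"
    by (simp add: has_bochner_integral_iff)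
qed

lemma integrable_kernel_L2:
  assumes l: "kernel l" and g: "g \<in> borel_measurable borel" "integrable lborel (\<lambda>y. (g y)\<^sup>2)"
  shows "integrable lborel (\<lambda>y. l (x - y) * g y)"
proof (rule Bochner_Integration.integrable_bound)
  show "integrable lborel (\<lambda>y. (l (x - y))\<^sup>2 + (g y)\<^sup>2)"
    using kernel_square_integrable(1)[OF l] g(2) by (rule Bochner_Integration.integrable_add)
  have "l \<in> borel_measurable borel" using l by (simp add: kernel_def borel_measurable_continuous_onI)
  then show "(\<lambda>y. l (x - y) * g y) \<in> borel_measurable lborel" using g(1) by measurable
  have "\<bar>a * b\<bar> \<le> a\<^sup>2 + b\<^sup>2" for a b :: real
  proof -
    have "2 * (\<bar>a\<bar> * \<bar>b\<bar>) \<le> a\<^sup>2 + b\<^sup>2"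
      using sum_squares_bound[of "\<bar>a\<bar>" "\<bar>b\<bar>"] by (simp add: mult.assoc)
    moreover have "0 \<le> \<bar>a\<bar> * \<bar>b\<bar>" by simp
    ultimately show ?thesis unfolding abs_mult by linarith
  qed
  then show "AE y in lborel. norm (l (x - y) * g y) \<le> norm ((l (x - y))\<^sup>2 + (g y)\<^sup>2)"
    by (simp add: AE_I2)
qed

lemma C_t_L2_slice:
  assumes "C_t_Lq 2 F"
  shows "(\<lambda>y. F (s, y)) \<in> borel_measurable borel" "integrable lborel (\<lambda>y. (F (s, y))\<^sup>2)"
proof -
  have [measurable]: "F \<in> borel_measurable (borel \<Otimes>\<^sub>M borel)"
    using assms by (simp add: C_t_Lq_def borel_prod)
  show m: "(\<lambda>y. F (s, y)) \<in> borel_measurable borel" by measurable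
  have "(\<integral>\<^sup>+y. ennreal ((F (s, y))\<^sup>2) \<partial>lborel) < \<infinity>"
    using assms by (simp add: C_t_Lq_def abs_powr_2)
  then show "integrable lborel (\<lambda>y. (F (s, y))\<^sup>2)"
    using m by (intro integrableI_nonneg) auto
qed

text \<open>Young's inequality bounds the pairing with a translate of \<open>l\<close> by the L^2
  norms alone, and these are invariant under translation; hence \<epsilon> does not depend on
  \<open>x\<close>.\<close>

lemma L2_slice_close:
  assumes F: "C_t_Lq 2 F" and l: "kernel l" and d: "d > 0"
  shows "\<exists>\<epsilon>>0. \<forall>s x. \<bar>s\<bar> \<le> \<epsilon> \<longrightarrow>
    \<bar>(LINT y|lborel. l (x - y) * F (s, y)) - (LINT y|lborel. l (x - y) * F (0, y))\<bar> \<le> d"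
proof -
  define A where "A = (LINT y|lborel. (l y)\<^sup>2)"
  have A: "0 \<le> A" unfolding A_def by (intro integral_nonneg_AE AE_I2) simp
  \<comment> \<open>Then \<open>q * A <= d\<close>, and a squared distance of slices below
    \<open>q * d\<close> makes each half of Young's inequality at most \<open>d / 2\<close>.\<close>
  define q where "q = d / (A + 1)"
  have q: "q > 0" "q * A \<le> d" using A d by (auto simp: q_def field_simps)
  have "((\<lambda>s. \<integral>\<^sup>+y. ennreal ((F (s, y) - F (0, y))\<^sup>2) \<partial>lborel) \<longlongrightarrow> 0) (at 0)"
    using F by (simp add: C_t_Lq_def abs_powr_2)
  then have "\<forall>\<^sub>F s in at 0. (\<integral>\<^sup>+y. ennreal ((F (s, y) - F (0, y))\<^sup>2) \<partial>lborel) < ennreal (q * d)"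
    using q d by (intro order_tendstoD) auto
  then obtain h where h: "h > 0" "\<And>s. s \<noteq> 0 \<Longrightarrow> \<bar>s\<bar> < h \<Longrightarrow>
      (\<integral>\<^sup>+y. ennreal ((F (s, y) - F (0, y))\<^sup>2) \<partial>lborel) < ennreal (q * d)"
    by (auto simp: eventually_at dist_real_def)
  have "\<bar>(LINT y|lborel. l (x - y) * F (s, y)) - (LINT y|lborel. l (x - y) * F (0, y))\<bar> \<le> d"
    if s: "\<bar>s\<bar> \<le> h / 2" for s x
  proof (cases "s = 0")
    \<comment> \<open>The limit \<open>at 0\<close> says nothing about \<open>s = 0\<close> itself,
      where the difference vanishes.\<close>
    case False
    define D where "D y = F (s, y) - F (0, y)" for y
    note Fs = C_t_L2_slice[OF F]
    have m: "D \<in> borel_measurable borel" unfolding D_def using Fs(1) by simp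
    have less: "(\<integral>\<^sup>+y. ennreal ((D y)\<^sup>2) \<partial>lborel) < ennreal (q * d)"
      unfolding D_def using h(2)[OF False] s h(1) by linarith
    then have D2: "integrable lborel (\<lambda>y. (D y)\<^sup>2)"
      using m by (intro integrableI_nonneg) (auto simp: less_top intro: order_less_trans)
    then have "(LINT y|lborel. (D y)\<^sup>2) < q * d"
      using less nn_integral_eq_integral[OF D2] q d by (simp add: ennreal_less_iff)
    note int = integrable_kernel_L2[OF l Fs, of x] integrable_kernel_L2[OF l m D2, of x]
    have "(LINT y|lborel. l (x - y) * F (s, y)) - (LINT y|lborel. l (x - y) * F (0, y))
        = (LINT y|lborel. l (x - y) * D y)"
      using int by (simp add: D_def algebra_simps)
    also have "\<bar>\<dots>\<bar> \<le> (LINT y|lborel. \<bar>l (x - y) * D y\<bar>)" by (rule integral_abs_bound)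
    also have "\<dots> \<le> (LINT y|lborel. (q / 2) * (l (x - y))\<^sup>2 + (1 / (2 * q)) * (D y)\<^sup>2)"
    proof (rule integral_mono)
      show "\<bar>l (x - y) * D y\<bar> \<le> (q / 2) * (l (x - y))\<^sup>2 + (1 / (2 * q)) * (D y)\<^sup>2" for y
        using young_weighted[of q 1 "1 / q" "l (x - y)" "D y"] q by (simp add: abs_mult field_simps)
    qed (use int kernel_square_integrable(1)[OF l] D2 in auto)
    also have "\<dots> = (q / 2) * A + (1 / (2 * q)) * (LINT y|lborel. (D y)\<^sup>2)"
      using kernel_square_integrable[OF l, of x] D2 by (simp add: A_def)
    also have "\<dots> \<le> d / 2 + (1 / (2 * q)) * (q * d)"
      using q \<open>_ < q * d\<close> by (intro add_mono mult_left_mono) auto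
    also have "\<dots> = d" using q by simp
    finally show ?thesis .
  qed (use d in simp)
  then show ?thesis using h(1) by (intro exI[of _ "h / 2"]) auto
qed

text \<open>Meant for \<open>l\<close> the derivative of a mollifier: with the derivative on the
  kernel, uniform continuity of \<open>G\<close> on a compact set suffices, whence the bound on
  \<open>x\<close>.\<close>

lemma continuous_slice_close:
  fixes G :: "real \<times> real \<Rightarrow> real"
  assumes G: "continuous_on UNIV G" and l: "kernel l" and d: "d > 0"
  shows "\<exists>\<epsilon>>0. \<forall>s x. \<bar>s\<bar> \<le> \<epsilon> \<longrightarrow> \<bar>x\<bar> \<le> R \<longrightarrow>
    \<bar>(LINT y|lborel. l (x - y) * G (s, y)) - (LINT y|lborel. l (x - y) * G (0, y))\<bar> \<le> d"
proof -
  obtain M where M: "M \<ge> 0" "\<And>s. \<bar>l s\<bar> \<le> M" using kernel_bounded[OF l] by blast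
  let ?K = "{-1..1::real} \<times> {-R - 1..R + 1}"
  \<comment> \<open>The kernel is at most \<open>M\<close> on an interval of length 2, so an
    oscillation \<eta> of \<open>G\<close> costs at most \<open>2 * M * \<eta>\<close>.\<close>
  define \<eta> where "\<eta> = d / (2 * (M + 1))"
  have \<eta>: "\<eta> > 0" "2 * M * \<eta> \<le> d" using d M by (auto simp: \<eta>_def field_simps)
  have "uniformly_continuous_on ?K G"
    by (intro compact_uniformly_continuous continuous_on_subset[OF G] compact_Times) auto
  then obtain h where h: "h > 0" "\<And>z w. z \<in> ?K \<Longrightarrow> w \<in> ?K \<Longrightarrow> dist w z < h \<Longrightarrow> dist (G w) (G z) < \<eta>"
    unfolding uniformly_continuous_on_def using \<eta>(1) by meson
  have "\<bar>(LINT y|lborel. l (x - y) * G (s, y)) - (LINT y|lborel. l (x - y) * G (0, y))\<bar> \<le> d"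
    if s: "\<bar>s\<bar> \<le> min 1 (h / 2)" and x: "\<bar>x\<bar> \<le> R" for s x
  proof -
    have int: "integrable lborel (\<lambda>y. l (x - y) * G (s, y))" for s
      by (intro integrable_kernel continuous_locally_integrable continuous_slice G l)
    have "(LINT y|lborel. l (x - y) * G (s, y)) - (LINT y|lborel. l (x - y) * G (0, y))
        = (LINT y|lborel. l (x - y) * (G (s, y) - G (0, y)))"
      using int by (simp add: algebra_simps)
    also have "\<bar>\<dots>\<bar> \<le> (LINT y|lborel. \<bar>l (x - y) * (G (s, y) - G (0, y))\<bar>)" by (rule integral_abs_bound)
    also have "\<dots> \<le> (LINT y|lborel. indicator {x - 1..x + 1} y *\<^sub>R (M * \<eta>))"
    proof (rule integral_mono)
      show "integrable lborel (\<lambda>y. \<bar>l (x - y) * (G (s, y) - G (0, y))\<bar>)"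
        using Bochner_Integration.integrable_diff[OF int[of s] int[of 0]] by (simp add: right_diff_distrib)
      show "integrable lborel (\<lambda>y. indicator {x - 1..x + 1} y *\<^sub>R (M * \<eta>))" by simp
      fix y
      show "\<bar>l (x - y) * (G (s, y) - G (0, y))\<bar> \<le> indicator {x - 1..x + 1} y *\<^sub>R (M * \<eta>)"
      proof (cases "y \<in> {x - 1..x + 1}")
        case True
        then have "(s, y) \<in> ?K" "(0, y) \<in> ?K" using s x by (auto simp: abs_le_iff)
        moreover have "dist (s, y) (0, y) < h" using s h(1) by (simp add: dist_Pair_Pair)
        ultimately have "dist (G (s, y)) (G (0, y)) < \<eta>" by (intro h(2))
        then have "\<bar>G (s, y) - G (0, y)\<bar> \<le> \<eta>" by (simp add: dist_real_def)
        then have "\<bar>l (x - y) * (G (s, y) - G (0, y))\<bar> \<le> M * \<eta>"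
          unfolding abs_mult using M by (intro mult_mono) auto
        then show ?thesis using True by simp
      next
        case False
        then have "1 < \<bar>x - y\<bar>" by auto
        then show ?thesis using l False by (simp add: kernel_def)
      qed
    qed
    also have "\<dots> = 2 * M * \<eta>" by simp
    finally show ?thesis using \<eta>(2) by simp
  qed
  then show ?thesis using h(1) by (intro exI[of _ "min 1 (h / 2)"]) auto
qed

section \<open>Regularization of finite energy solutions\<close>

text \<open>\<open>\<phi>\<^sub>1\<close> matters only up to null sets, and the Borel function
  \<open>h\<close> represents it. The energy contains the potential twice; one copy is kept, while
  the squares keep their full coefficient, to be halved later.\<close>

lemma energy_parts:
  assumes "p > 1" and g: "has_weak_deriv 1 \<phi>\<^sub>0 g" "g = (SOME g. has_weak_deriv 1 \<phi>\<^sub>0 g)"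
    and cont: "continuous_on UNIV \<phi>\<^sub>0" and h: "h \<in> borel_measurable borel" "AE x in lborel. h x = \<phi>\<^sub>1 x"
  shows "(\<integral>\<^sup>+x. ennreal ((g x)\<^sup>2) \<partial>lborel) + (\<integral>\<^sup>+x. ennreal ((h x)\<^sup>2) \<partial>lborel)
    + (\<integral>\<^sup>+x. ennreal (potential p (\<phi>\<^sub>0 x)) \<partial>lborel) \<le> energy p \<phi>\<^sub>0 \<phi>\<^sub>1"
proof -
  have [measurable]: "g \<in> borel_measurable borel"
    using g(1) locally_integrable_measurable by (auto simp: has_weak_deriv_def)
  have [measurable]: "(\<lambda>x. potential p (\<phi>\<^sub>0 x)) \<in> borel_measurable borel"
    using assms(1) by (intro borel_measurable_continuous_onI continuous_on_potential cont)
  note [measurable] = h(1)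
  have "energy p \<phi>\<^sub>0 \<phi>\<^sub>1 = (\<integral>\<^sup>+x. ennreal (\<bar>g x\<bar>\<^sup>2 + \<bar>\<phi>\<^sub>1 x\<bar>\<^sup>2 + 2 / (p + 1) * \<bar>\<phi>\<^sub>0 x\<bar> powr (p + 1)) \<partial>lborel)"
    using g by (auto simp: energy_def)
  also have "\<dots> \<ge> (\<integral>\<^sup>+x. ennreal ((g x)\<^sup>2) + ennreal ((h x)\<^sup>2) + ennreal (potential p (\<phi>\<^sub>0 x)) \<partial>lborel)"
  proof (rule nn_integral_mono_AE)
    show "AE x in lborel. ennreal ((g x)\<^sup>2) + ennreal ((h x)\<^sup>2) + ennreal (potential p (\<phi>\<^sub>0 x))
        \<le> ennreal (\<bar>g x\<bar>\<^sup>2 + \<bar>\<phi>\<^sub>1 x\<bar>\<^sup>2 + 2 / (p + 1) * \<bar>\<phi>\<^sub>0 x\<bar> powr (p + 1))"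
      using h(2)
    proof eventually_elim
      case (elim x)
      have "potential p (\<phi>\<^sub>0 x) \<le> 2 / (p + 1) * \<bar>\<phi>\<^sub>0 x\<bar> powr (p + 1)"
        using assms(1) by (simp add: potential_def divide_right_mono)
      moreover have "0 \<le> potential p (\<phi>\<^sub>0 x)" by (rule potential_nonneg[OF assms(1)])
      ultimately show ?case
        using elim by (simp add: ennreal_leI flip: ennreal_plus)
    qed
  qed
  finally show ?thesis by (simp add: nn_integral_add)
qed

text \<open>The term \<open>3 * d\<close> collects one error each from the time derivative, the
  space derivative and the potential; over length \<open>2 * R\<close> together they cost at most
  1.\<close>

lemma initial_energy_le:
  fixes E :: ennreal and a b v w e :: "real \<Rightarrow> real"
  assumes R: "0 < R" and d: "0 < d" "2 * R * (3 * d) \<le> 1" "d \<le> 1" and e: "continuous_on {-R..R} e" "\<And>x. 0 \<le> e x"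
    and meas: "a \<in> borel_measurable borel" "b \<in> borel_measurable borel" "w \<in> borel_measurable borel" "\<And>x. 0 \<le> w x"
    and le: "\<And>x. \<bar>x\<bar> \<le> R \<Longrightarrow> e x \<le> (a x)\<^sup>2 + (b x)\<^sup>2 + w x + 3 * d"
    and E: "(\<integral>\<^sup>+x. ennreal ((b x)\<^sup>2) \<partial>lborel) + (\<integral>\<^sup>+x. ennreal ((a x)\<^sup>2) \<partial>lborel)
      + (\<integral>\<^sup>+x. ennreal (w x) \<partial>lborel) \<le> E" "E < \<infinity>"
  shows "(LINT x:{-R..R}|lborel. e x) \<le> enn2real E + 1"
proof -
  note [measurable] = meas(1-3)
  have int: "integrable lborel (\<lambda>x. indicator {-R..R} x * e x)"
    using borel_integrable_atLeastAtMost'[OF e(1)] by (simp add: set_integrable_def)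
  have "ennreal (LINT x:{-R..R}|lborel. e x) = (\<integral>\<^sup>+x. ennreal (indicator {-R..R} x * e x) \<partial>lborel)"
    using nn_integral_eq_integral[OF int] e(2) by (simp add: set_lebesgue_integral_def)
  also have "\<dots> \<le> (\<integral>\<^sup>+x. ennreal ((b x)\<^sup>2) + ennreal ((a x)\<^sup>2) + ennreal (w x) + ennreal (3 * d) * indicator {-R..R} x \<partial>lborel)"
  proof (rule nn_integral_mono)
    fix x
    show "ennreal (indicator {-R..R} x * e x) \<le> ennreal ((b x)\<^sup>2) + ennreal ((a x)\<^sup>2) + ennreal (w x) + ennreal (3 * d) * indicator {-R..R} x"
    proof (cases "\<bar>x\<bar> \<le> R")
      case True
      then show ?thesis
        using le[OF True] meas(4)[of x] d(1)
        by (auto simp: indicator_def abs_le_iff add_ac intro!: ennreal_leI simp flip: ennreal_plus)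
    next
      case False
      then have "x \<notin> {-R..R}" by auto
      then show ?thesis by simp
    qed
  qed
  also have "\<dots> = ((\<integral>\<^sup>+x. ennreal ((b x)\<^sup>2) \<partial>lborel) + (\<integral>\<^sup>+x. ennreal ((a x)\<^sup>2) \<partial>lborel)
      + (\<integral>\<^sup>+x. ennreal (w x) \<partial>lborel)) + ennreal (3 * d) * emeasure lborel {-R..R}"
    by (simp add: nn_integral_add nn_integral_cmult_indicator)
  also have "\<dots> \<le> E + ennreal (3 * d) * emeasure lborel {-R..R}"
    using E(1) by (rule add_right_mono)
  also have "\<dots> \<le> E + ennreal 1"
  proof (rule add_left_mono)
    have "emeasure lborel {-R..R} = ennreal (2 * R)" using R by simp
    then have "ennreal (3 * d) * emeasure lborel {-R..R} = ennreal (3 * d * (2 * R))"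
      using R d(1) by (simp only: ennreal_mult)
    also have "\<dots> \<le> ennreal 1" using d(2) by (intro ennreal_leI) (simp add: mult_ac)
    finally show "ennreal (3 * d) * emeasure lborel {-R..R} \<le> ennreal 1" .
  qed
  also have "E + ennreal 1 = ennreal (enn2real E + 1)"
    using E(2) by (simp add: ennreal_plus less_top)
  finally have "ennreal (LINT x:{-R..R}|lborel. e x) \<le> ennreal (enn2real E + 1)" .
  moreover have "0 \<le> enn2real E + 1" by simp
  ultimately show ?thesis by (simp only: ennreal_le_iff)
qed

text \<open>The mollifier in time is chosen after the one in space, and much narrower. Hence the
  derivatives of the mollification at \<open>t = 0\<close> are close to the mollifications in space of the initial data,
  whose norms are bounded by Jensen's inequality. The factor 2 lost in the squares is
  available, as the energy has no factor 1/2.\<close>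

theorem regularization:
  assumes p: "p > 1" and \<phi>: "finite_energy_solution p \<phi>\<^sub>0 \<phi>\<^sub>1 \<phi>" and R: "R > 0" and d: "d > 0"
  obtains u u_t u_x u_tt u_tx u_xx f
  where "regular_solution p d R (enn2real (energy p \<phi>\<^sub>0 \<phi>\<^sub>1) + 1) u u_t u_x u_tt u_tx u_xx f"
    and "\<And>z. z \<in> {0..R} \<times> {-R..R} \<Longrightarrow> \<bar>u z - \<phi> z\<bar> \<le> d"
proof -
  have cont: "continuous_on UNIV \<phi>" and \<phi>0: "\<And>x. \<phi> (0, x) = \<phi>\<^sub>0 x"
    and ds: "distributional_solution p \<phi>" and fin: "energy p \<phi>\<^sub>0 \<phi>\<^sub>1 < \<infinity>"
    using \<phi> by (auto simp: finite_energy_solution_def)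
  obtain \<phi>\<^sub>t where \<phi>\<^sub>t: "has_weak_deriv (1, 0) \<phi> \<phi>\<^sub>t" "C_t_Lq 2 \<phi>\<^sub>t" "AE x in lborel. \<phi>\<^sub>t (0, x) = \<phi>\<^sub>1 x"
    using \<phi> by (auto simp: finite_energy_solution_def)
  define g where "g = (SOME g. has_weak_deriv 1 \<phi>\<^sub>0 g)"
  have "\<exists>g. has_weak_deriv 1 \<phi>\<^sub>0 g"
    using fin by (auto simp: energy_def split: if_splits)
  then have g: "has_weak_deriv 1 \<phi>\<^sub>0 g" unfolding g_def by (rule someI_ex)
  then have gl: "locally_integrable g" by (simp add: has_weak_deriv_def)
  have \<phi>0c: "continuous_on UNIV \<phi>\<^sub>0"
    using continuous_slice[OF cont, of UNIV 0] by (simp add: \<phi>0)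
  define G where "G z = nonlin p (\<phi> z)" for z
  have G: "continuous_on UNIV G" unfolding G_def by (intro continuous_on_nonlin p cont)
  \<comment> \<open>The bound \<open>1 / (6 * R)\<close> keeps the error in the initial energy at
    most 1, and \<open>d0 <= 1\<close> gives \<open>d0^2 <= d0\<close> when differences are
    squared.\<close>
  define d0 where "d0 = min d (min 1 (1 / (6 * R)))"
  have d0: "0 < d0" "d0 \<le> d" "d0 \<le> 1" "2 * R * (3 * d0) \<le> 1"
  proof -
    have "d0 \<le> 1 / (6 * R)" by (simp add: d0_def)
    then show "2 * R * (3 * d0) \<le> 1" using R by (simp add: field_simps)
  qed (use d R in \<open>auto simp: d0_def\<close>)
  let ?K = "{-1..R + 1} \<times> {-R - 1..R + 1}"
  have K: "compact ?K" by (intro compact_Times compact_Icc)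
  obtain M where M: "\<And>z. z \<in> ?K \<Longrightarrow> \<bar>\<phi> z\<bar> \<le> M"
    using compact_imp_bounded[OF compact_continuous_image[OF continuous_on_subset[OF cont] K]]
    unfolding bounded_iff by (metis UNIV_I imageI real_norm_def subsetI)
  \<comment> \<open>The point \<open>b\<close> may leave \<open>[-M, M]\<close>, so the interval is
    widened by 1 and the modulus of continuity capped at 1.\<close>
  have uc: "\<exists>\<eta>>0. \<forall>a b. \<bar>a\<bar> \<le> M \<longrightarrow> \<bar>b - a\<bar> < \<eta> \<longrightarrow> \<bar>F b - F a\<bar> < c"
    if F: "continuous_on UNIV F" and c: "c > 0" for F :: "real \<Rightarrow> real" and c
  proof -
    have "uniformly_continuous_on {-M - 1..M + 1} F"
      by (intro compact_uniformly_continuous continuous_on_subset[OF F]) auto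
    then obtain h where h: "h > 0" "\<And>a b. a \<in> {-M - 1..M + 1} \<Longrightarrow> b \<in> {-M - 1..M + 1} \<Longrightarrow> dist b a < h \<Longrightarrow> dist (F b) (F a) < c"
      unfolding uniformly_continuous_on_def using c by meson
    have "\<bar>F b - F a\<bar> < c" if "\<bar>a\<bar> \<le> M" "\<bar>b - a\<bar> < min h 1" for a b
    proof -
      have "a \<in> {-M - 1..M + 1}" "b \<in> {-M - 1..M + 1}" "dist b a < h"
        using that by (auto simp: dist_real_def abs_le_iff abs_less_iff)
      from h(2)[OF this] show ?thesis by (simp add: dist_real_def)
    qed
    then show ?thesis using h(1) by (intro exI[of _ "min h 1"]) auto
  qed
  obtain \<eta>1 where \<eta>1: "\<eta>1 > 0" "\<And>a b. \<bar>a\<bar> \<le> M \<Longrightarrow> \<bar>b - a\<bar> < \<eta>1 \<Longrightarrow> \<bar>nonlin p b - nonlin p a\<bar> < d / 2"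
    using uc[OF continuous_on_nonlin[OF p continuous_on_id], of "d / 2"] d by auto
  obtain \<eta>2 where \<eta>2: "\<eta>2 > 0" "\<And>a b. \<bar>a\<bar> \<le> M \<Longrightarrow> \<bar>b - a\<bar> < \<eta>2 \<Longrightarrow> \<bar>potential p b - potential p a\<bar> < d0"
    using uc[OF continuous_on_potential[OF p continuous_on_id], of d0] d0(1) by auto
  define \<eta> where "\<eta> = min d (min (\<eta>1 / 2) (\<eta>2 / 2))"
  have \<eta>: "0 < \<eta>" "\<eta> \<le> d" "\<eta> < \<eta>1" "\<eta> < \<eta>2" using d \<eta>1(1) \<eta>2(1) by (auto simp: \<eta>_def min_def)
  have ucK: "\<exists>h>0. \<forall>z\<in>?K. \<forall>w\<in>?K. dist w z < h \<longrightarrow> dist (F w) (F z) < c"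
    if "continuous_on UNIV F" "c > 0" for F :: "real \<times> real \<Rightarrow> real" and c
    using compact_uniformly_continuous[OF continuous_on_subset[OF that(1) subset_UNIV] K] that(2)
    unfolding uniformly_continuous_on_def by blast
  obtain h1 where h1: "h1 > 0" "\<And>z w. z \<in> ?K \<Longrightarrow> w \<in> ?K \<Longrightarrow> dist w z < h1 \<Longrightarrow> dist (\<phi> w) (\<phi> z) < \<eta>"
    using ucK[OF cont \<eta>(1)] by blast
  obtain h2 where h2: "h2 > 0" "\<And>z w. z \<in> ?K \<Longrightarrow> w \<in> ?K \<Longrightarrow> dist w z < h2 \<Longrightarrow> dist (G w) (G z) < d / 2"
    using ucK[OF G, of "d / 2"] d by auto
  \<comment> \<open>Points in the support of the kernel lie within \<open>2 * \<epsilon>\<close>;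
    dividing by 3 makes this strictly smaller than \<open>h1\<close> and \<open>h2\<close>.\<close>
  define \<epsilon> where "\<epsilon> = min 1 (min (h1 / 3) (h2 / 3))"
  have \<epsilon>: "0 < \<epsilon>" "\<epsilon> \<le> 1" "3 * \<epsilon> \<le> h1" "3 * \<epsilon> \<le> h2" using h1(1) h2(1) by (auto simp: \<epsilon>_def)
  obtain l where l: "mollifier \<epsilon> l" using ex_mollifier[OF \<epsilon>(1)] by blast
  note L = mollifier_kernel[OF l \<epsilon>(2)]
  obtain e1 where e1: "e1 > 0" "\<And>s x. \<bar>s\<bar> \<le> e1 \<Longrightarrow>
      \<bar>(LINT y|lborel. l (x - y) * \<phi>\<^sub>t (s, y)) - (LINT y|lborel. l (x - y) * \<phi>\<^sub>t (0, y))\<bar> \<le> d0"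
    using L2_slice_close[OF \<phi>\<^sub>t(2) L(1) d0(1)] by blast
  obtain e2 where e2: "e2 > 0" "\<And>s x. \<bar>s\<bar> \<le> e2 \<Longrightarrow> \<bar>x\<bar> \<le> R \<Longrightarrow>
      \<bar>(LINT y|lborel. deriv l (x - y) * \<phi> (s, y)) - (LINT y|lborel. deriv l (x - y) * \<phi> (0, y))\<bar> \<le> d0"
    using continuous_slice_close[OF cont L(2) d0(1), of R] by blast
  define \<epsilon>' where "\<epsilon>' = min \<epsilon> (min e1 e2)"
  have \<epsilon>': "0 < \<epsilon>'" "\<epsilon>' \<le> 1" "\<epsilon>' \<le> \<epsilon>" "\<epsilon>' \<le> e1" "\<epsilon>' \<le> e2"
    using \<epsilon>(1,2) e1(1) e2(1) by (auto simp: \<epsilon>'_def)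
  obtain k where k: "mollifier \<epsilon>' k" using ex_mollifier[OF \<epsilon>'(1)] by blast
  note K' = mollifier_kernel[OF k \<epsilon>'(2)]
  define u where "u = conv k l \<phi>"
  have near: "(s, y) \<in> ?K \<and> dist (s, y) (t, x) < h1 \<and> dist (s, y) (t, x) < h2"
    if "(t, x) \<in> {0..R} \<times> {-R..R}" "\<bar>t - s\<bar> \<le> \<epsilon>'" "\<bar>x - y\<bar> \<le> \<epsilon>" for t x s y
  proof -
    have "dist (s, y) (t, x) \<le> \<bar>s - t\<bar> + \<bar>y - x\<bar>"
      unfolding dist_Pair_Pair dist_real_def power2_abs by (rule sqrt_sum_squares_le_sum_abs)
    then show ?thesis
      using that \<epsilon> \<epsilon>' by (auto simp: abs_le_iff)
  qed
  have u_close: "\<bar>u z - \<phi> z\<bar> \<le> \<eta>" if z: "z \<in> {0..R} \<times> {-R..R}" for z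
  proof -
    obtain t x where tx: "z = (t, x)" by (cases z)
    have "z \<in> ?K" using z R by auto
    then have "\<bar>\<phi> (s, y) - \<phi> z\<bar> \<le> \<eta>" if "\<bar>t - s\<bar> \<le> \<epsilon>'" "\<bar>x - y\<bar> \<le> \<epsilon>" for s y
      using near[of t x s y] h1(2)[of z "(s, y)"] that z tx by (simp add: dist_real_def)
    then show ?thesis
      unfolding u_def tx by (intro conv_close[OF k \<epsilon>'(2) l \<epsilon>(2) cont]) auto
  qed
  have G_close: "\<bar>conv k l G z - G z\<bar> \<le> d / 2" if z: "z \<in> {0..R} \<times> {-R..R}" for z
  proof -
    obtain t x where tx: "z = (t, x)" by (cases z)
    have "z \<in> ?K" using z R by auto
    then have "\<bar>G (s, y) - G z\<bar> \<le> d / 2" if "\<bar>t - s\<bar> \<le> \<epsilon>'" "\<bar>x - y\<bar> \<le> \<epsilon>" for s y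
      using near[of t x s y] h2(2)[of z "(s, y)"] that z tx by (simp add: dist_real_def)
    then show ?thesis
      unfolding tx by (intro conv_close[OF k \<epsilon>'(2) l \<epsilon>(2) G]) auto
  qed
  have KM: "\<bar>\<phi> z\<bar> \<le> M" if "z \<in> {0..R} \<times> {-R..R}" for z using M[of z] that R by auto
  define a where "a x = (LINT y|lborel. l (x - y) * \<phi>\<^sub>t (0, y))" for x
  define b where "b x = (LINT y|lborel. l (x - y) * g y)" for x
  have ut: "\<bar>conv (deriv k) l \<phi> (0, x) - a x\<bar> \<le> d0" for x
  proof -
    have "\<bar>conv k l \<phi>\<^sub>t (0, x) - a x\<bar> \<le> d0"
      unfolding a_def using e1(2) \<epsilon>'(4) \<phi>\<^sub>t(1)
      by (intro conv_close_slice[OF k \<epsilon>'(2) L(1)]) (auto simp: has_weak_deriv_def)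
    then show ?thesis
      using conv_weak_deriv_t[OF \<phi>\<^sub>t(1) K'(4) L(4) K'(1) L(1)] by simp
  qed
  \<comment> \<open>At time 0 the derivative on \<open>l\<close> passes directly to
    \<open>\<phi>\<^sub>0\<close>, whose weak derivative is \<open>g\<close>. This avoids comparing
    a time slice of the space-time weak derivative with \<open>g\<close>.\<close>
  have ux: "\<bar>conv k (deriv l) \<phi> (0, x) - b x\<bar> \<le> d0" if x: "\<bar>x\<bar> \<le> R" for x
  proof -
    have "((\<lambda>y. l (x - y)) has_real_derivative deriv l (x - y) * (0 - 1)) (at y)" for y
      by (intro DERIV_chain2[OF smooth_DERIV[OF L(4)]] DERIV_diff DERIV_const DERIV_ident)
    then have "((\<lambda>y. l (x - y)) has_derivative (\<lambda>e. deriv l (x - y) * (0 - 1) * e)) (at y)" for y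
      by (simp only: has_field_derivative_def)
    from dir_deriv_eq[OF this, of 1]
    have D: "dir_deriv 1 (\<lambda>y. l (x - y)) = (\<lambda>y. - deriv l (x - y))"
      by (simp add: fun_eq_iff)
    have "\<forall>\<psi>. test_fun \<psi> \<longrightarrow> (LINT y|lborel. \<phi>\<^sub>0 y * dir_deriv 1 \<psi> y) = - (LINT y|lborel. g y * \<psi> y)"
      using g unfolding has_weak_deriv_def by (elim conjE)
    from this[rule_format, OF test_fun_reflect[OF L(4) L(1), of x]]
    have "(LINT y|lborel. deriv l (x - y) * \<phi> (0, y)) = b x"
      unfolding D b_def by (simp add: \<phi>0 mult.commute)
    then show ?thesis
      using e2(2)[OF _ x] \<epsilon>'(5) continuous_locally_integrable[OF cont]
      by (intro conv_close_slice[OF k \<epsilon>'(2) L(2)]) auto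
  qed
  have meas: "a \<in> borel_measurable borel" "b \<in> borel_measurable borel"
  proof -
    have [measurable]: "l \<in> borel_measurable borel" "g \<in> borel_measurable borel"
      "(\<lambda>y. \<phi>\<^sub>t (0, y)) \<in> borel_measurable borel"
      using smooth_continuous_on[OF L(4), of UNIV] locally_integrable_measurable[OF gl] C_t_L2_slice(1)[OF \<phi>\<^sub>t(2)]
      by (auto intro: borel_measurable_continuous_onI)
    show "a \<in> borel_measurable borel" "b \<in> borel_measurable borel"
      unfolding a_def[abs_def] b_def[abs_def] by measurable
  qed
  have E: "(\<integral>\<^sup>+x. ennreal ((b x)\<^sup>2) \<partial>lborel) + (\<integral>\<^sup>+x. ennreal ((a x)\<^sup>2) \<partial>lborel)
      + (\<integral>\<^sup>+x. ennreal (potential p (\<phi>\<^sub>0 x)) \<partial>lborel) \<le> energy p \<phi>\<^sub>0 \<phi>\<^sub>1"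
  proof (rule order_trans[OF add_right_mono[OF add_mono]])
    show "(\<integral>\<^sup>+x. ennreal ((b x)\<^sup>2) \<partial>lborel) \<le> (\<integral>\<^sup>+x. ennreal ((g x)\<^sup>2) \<partial>lborel)"
      unfolding b_def by (intro mollify_square_le[OF l] locally_integrable_measurable integrable_kernel gl L)
    show "(\<integral>\<^sup>+x. ennreal ((a x)\<^sup>2) \<partial>lborel) \<le> (\<integral>\<^sup>+x. ennreal ((\<phi>\<^sub>t (0, x))\<^sup>2) \<partial>lborel)"
      unfolding a_def by (intro mollify_square_le[OF l] integrable_kernel_L2 C_t_L2_slice \<phi>\<^sub>t L)
  qed (rule energy_parts[OF p g g_def \<phi>0c C_t_L2_slice(1)[OF \<phi>\<^sub>t(2)] \<phi>\<^sub>t(3)])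
  have "regular_solution p d R (enn2real (energy p \<phi>\<^sub>0 \<phi>\<^sub>1) + 1) u (conv (deriv k) l \<phi>) (conv k (deriv l) \<phi>)
      (conv (deriv (deriv k)) l \<phi>) (conv (deriv k) (deriv l) \<phi>) (conv k (deriv (deriv l)) \<phi>) (conv k l G)"
  proof
    show "continuous_on UNIV u" "continuous_on UNIV (conv (deriv k) l \<phi>)" "continuous_on UNIV (conv k (deriv l) \<phi>)"
      "continuous_on UNIV (conv (deriv (deriv k)) l \<phi>)" "continuous_on UNIV (conv (deriv k) (deriv l) \<phi>)"
      "continuous_on UNIV (conv k (deriv (deriv l)) \<phi>)" "continuous_on UNIV (conv k l G)"
      unfolding u_def by (intro continuous_on_conv cont G K' L)+
    fix t x
    show "((\<lambda>t. u (t, x)) has_real_derivative conv (deriv k) l \<phi> (t, x)) (at t)"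
      "((\<lambda>t. conv (deriv k) l \<phi> (t, x)) has_real_derivative conv (deriv (deriv k)) l \<phi> (t, x)) (at t)"
      "((\<lambda>t. conv k (deriv l) \<phi> (t, x)) has_real_derivative conv (deriv k) (deriv l) \<phi> (t, x)) (at t)"
      unfolding u_def by (intro conv_has_derivative_t cont K' L smooth_DERIV)+
    show "((\<lambda>x. u (t, x)) has_real_derivative conv k (deriv l) \<phi> (t, x)) (at x)"
      "((\<lambda>x. conv (deriv k) l \<phi> (t, x)) has_real_derivative conv (deriv k) (deriv l) \<phi> (t, x)) (at x)"
      "((\<lambda>x. conv k (deriv l) \<phi> (t, x)) has_real_derivative conv k (deriv (deriv l)) \<phi> (t, x)) (at x)"
      unfolding u_def by (intro conv_has_derivative_x cont K' L smooth_DERIV)+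
  next
    show "conv (deriv (deriv k)) l \<phi> z - conv k (deriv (deriv l)) \<phi> z = - conv k l G z" for z
      unfolding G_def[abs_def] by (rule conv_wave[OF ds cont k l \<epsilon>'(2) \<epsilon>(2)])
    show "\<bar>conv k l G z - nonlin p (u z)\<bar> \<le> d" if z: "z \<in> {0..R} \<times> {-R..R}" for z
    proof -
      have "\<bar>nonlin p (u z) - G z\<bar> < d / 2"
        unfolding G_def using \<eta>1(2)[OF KM[OF z]] u_close[OF z] \<eta>(3) by simp
      then show ?thesis using G_close[OF z] by linarith
    qed
    show "(LINT x:{-R..R}|lborel. ((conv (deriv k) l \<phi> (0, x))\<^sup>2 + (conv k (deriv l) \<phi> (0, x))\<^sup>2) / 2
        + potential p (u (0, x))) \<le> enn2real (energy p \<phi>\<^sub>0 \<phi>\<^sub>1) + 1"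
    proof (rule initial_energy_le[OF R d0(1,4,3) _ _ meas _ _ _ E fin])
      show "continuous_on {-R..R} (\<lambda>x. ((conv (deriv k) l \<phi> (0, x))\<^sup>2 + (conv k (deriv l) \<phi> (0, x))\<^sup>2) / 2
          + potential p (u (0, x)))"
        unfolding u_def
        by (intro continuous_intros continuous_on_potential p continuous_slice continuous_on_conv K' L cont) simp
      show "(\<lambda>x. potential p (\<phi>\<^sub>0 x)) \<in> borel_measurable borel"
        by (intro borel_measurable_continuous_onI continuous_on_potential p \<phi>0c)
      fix x :: real
      show "0 \<le> potential p (\<phi>\<^sub>0 x)" by (rule potential_nonneg[OF p])
      show "0 \<le> ((conv (deriv k) l \<phi> (0, x))\<^sup>2 + (conv k (deriv l) \<phi> (0, x))\<^sup>2) / 2 + potential p (u (0, x))"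
        using potential_nonneg[OF p] by simp
      assume x: "\<bar>x\<bar> \<le> R"
      have sq: "A\<^sup>2 / 2 \<le> B\<^sup>2 + d0" if "\<bar>A - B\<bar> \<le> d0" for A B
      proof -
        have "(A - B)\<^sup>2 \<le> d0\<^sup>2" using that by (metis abs_ge_zero power2_abs power_mono)
        also have "\<dots> \<le> d0" using d0 by (simp add: power2_eq_square mult_left_le)
        finally have "(A - B)\<^sup>2 \<le> d0" .
        moreover have "A\<^sup>2 \<le> 2 * B\<^sup>2 + 2 * (A - B)\<^sup>2"
          using zero_le_power2[of "A - 2 * B"] by (simp add: power2_eq_square algebra_simps)
        ultimately show ?thesis by simp
      qed
      have z: "(0, x) \<in> {0..R} \<times> {-R..R}" using x R by auto
      have "\<bar>potential p (u (0, x)) - potential p (\<phi>\<^sub>0 x)\<bar> < d0"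
        using \<eta>2(2)[OF KM[OF z], of "u (0, x)"] u_close[OF z] \<eta>(4) by (simp add: \<phi>0)
      then show "((conv (deriv k) l \<phi> (0, x))\<^sup>2 + (conv k (deriv l) \<phi> (0, x))\<^sup>2) / 2 + potential p (u (0, x))
          \<le> (a x)\<^sup>2 + (b x)\<^sup>2 + potential p (\<phi>\<^sub>0 x) + 3 * d0"
        using sq[OF ut[of x]] sq[OF ux[OF x]] unfolding add_divide_distrib by linarith
    qed
  qed (use p d R in auto)
  moreover have "\<bar>u z - \<phi> z\<bar> \<le> d" if "z \<in> {0..R} \<times> {-R..R}" for z
    using u_close[OF that] \<eta>(2) by linarith
  ultimately show ?thesis by (rule that)
qed

section \<open>Passage to the limit\<close>

lemma approximation:
  assumes p: "p > 1" and \<phi>: "finite_energy_solution p \<phi>\<^sub>0 \<phi>\<^sub>1 \<phi>"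
  shows "\<exists>u. continuous_on UNIV u \<and>
    (\<forall>z\<in>{0..real n} \<times> {- real n..real n}. \<bar>u z - \<phi> z\<bar> \<le> 1 / (real n + 1)) \<and>
    (\<integral>\<^sup>+t\<in>{0..real n}. (\<integral>\<^sup>+x\<in>{- t - 1..t + 1}.
        ennreal (((t + 1)\<^sup>2 - x\<^sup>2) * \<bar>u (t, x)\<bar> powr (p + 1) / (t + 1) ^ 3) \<partial>lborel) \<partial>lborel)
      \<le> ennreal (4 * (p + 1) / (p - 1)
          * ((7 * p + 18) * (4 * (enn2real (energy p \<phi>\<^sub>0 \<phi>\<^sub>1) + 1) + 2) + 12))"
proof -
  define R where "R = 8 * (real n + 1)"
  define d where "d = min (1 / (real n + 1)) (1 / (2 * R\<^sup>2))"
  have R: "0 < R" "1 \<le> R" "8 * (real n + 1) \<le> R" by (auto simp: R_def)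
  have "d \<le> 1 / (2 * R\<^sup>2)" by (simp add: d_def)
  then have dR: "d * R\<^sup>2 \<le> 1 / 2" using R(1) by (simp add: field_simps)
  have d: "0 < d" "d \<le> 1 / (real n + 1)" using R(1) by (auto simp: d_def)
  obtain u u_t u_x u_tt u_tx u_xx f
    where u: "regular_solution p d R (enn2real (energy p \<phi>\<^sub>0 \<phi>\<^sub>1) + 1) u u_t u_x u_tt u_tx u_xx f"
      and close: "\<And>z. z \<in> {0..R} \<times> {-R..R} \<Longrightarrow> \<bar>u z - \<phi> z\<bar> \<le> d"
    using regularization[OF p \<phi> R(1) d(1)] by blast
  have "\<bar>u z - \<phi> z\<bar> \<le> 1 / (real n + 1)" if "z \<in> {0..real n} \<times> {- real n..real n}" for z
    using close[of z] d(2) that by (auto simp: R_def)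
  moreover have "continuous_on UNIV u"
    using u by (simp add: regular_solution_def)
  ultimately show ?thesis
    using regular_solution.weighted_estimate[OF u R(2) dR _ R(3)] by auto
qed

theorem proposition3p1:
  shows "\<exists>C :: real \<Rightarrow> real \<Rightarrow> real.
    \<forall>(p::real) \<phi>\<^sub>0 \<phi>\<^sub>1 \<phi>. p > 1 \<longrightarrow> finite_energy_solution p \<phi>\<^sub>0 \<phi>\<^sub>1 \<phi> \<longrightarrow>
      (\<integral>\<^sup>+t\<in>{0..}. (\<integral>\<^sup>+x\<in>{- t - 1..t + 1}.
          ennreal (((t + 1)\<^sup>2 - x\<^sup>2) * \<bar>\<phi> (t, x)\<bar> powr (p + 1) / (t + 1) ^ 3)
        \<partial>lborel) \<partial>lborel)
      \<le> ennreal (C p (enn2real (energy p \<phi>\<^sub>0 \<phi>\<^sub>1)))"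
proof (intro exI allI impI)
  fix p :: real and \<phi>\<^sub>0 \<phi>\<^sub>1 \<phi>
  assume p: "p > 1" and \<phi>: "finite_energy_solution p \<phi>\<^sub>0 \<phi>\<^sub>1 \<phi>"
  \<comment> \<open>The shift \<open>E + 1\<close> allows for the excess of the mollified initial
    energy.\<close>
  let ?C = "\<lambda>p E. 4 * (p + 1) / (p - 1) * ((7 * p + 18) * (4 * (E + 1) + 2) + 12)"
  define F where "F w t x = ennreal (((t + 1)\<^sup>2 - x\<^sup>2) * \<bar>w\<bar> powr (p + 1) / (t + 1) ^ 3) * indicator {- t - 1..t + 1} x"
    for w t x :: real
  define P where "P n w \<longleftrightarrow> continuous_on UNIV w \<and>
      (\<forall>z\<in>{0..real n} \<times> {- real n..real n}. \<bar>w z - \<phi> z\<bar> \<le> 1 / (real n + 1)) \<and>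
      (\<integral>\<^sup>+t\<in>{0..real n}. (\<integral>\<^sup>+x. F (w (t, x)) t x \<partial>lborel) \<partial>lborel)
        \<le> ennreal (?C p (enn2real (energy p \<phi>\<^sub>0 \<phi>\<^sub>1)))" for n w
  have "\<forall>n. \<exists>w. P n w"
    unfolding P_def F_def by (intro allI approximation[OF p \<phi>])
  then obtain u where u: "\<And>n. P n (u n)" using choice[of P] by blast
  have cont: "continuous_on UNIV (u n)"
    and close: "\<And>z. z \<in> {0..real n} \<times> {- real n..real n} \<Longrightarrow> \<bar>u n z - \<phi> z\<bar> \<le> 1 / (real n + 1)"
    and bound: "(\<integral>\<^sup>+t\<in>{0..real n}. (\<integral>\<^sup>+x. F (u n (t, x)) t x \<partial>lborel) \<partial>lborel)
      \<le> ennreal (?C p (enn2real (energy p \<phi>\<^sub>0 \<phi>\<^sub>1)))" for n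
    using u[of n] unfolding P_def by blast+
  define f where "f n t x = F (u n (t, x)) t x * indicator {0..real n} t" for n t x
  have [measurable]: "u n \<in> borel_measurable (borel \<Otimes>\<^sub>M borel)" for n
    using borel_measurable_continuous_onI[OF cont] by (simp add: borel_prod)
  have f_meas [measurable]: "(\<lambda>(t, x). f n t x) \<in> borel_measurable (borel \<Otimes>\<^sub>M borel)" for n
  proof -
    have "(\<lambda>(t, x). indicator {- t - 1..t + 1} (x :: real) :: ennreal) \<in> borel_measurable (borel \<Otimes>\<^sub>M borel)"
      unfolding indicator_def atLeastAtMost_iff case_prod_unfold by measurable
    then show ?thesis unfolding f_def F_def by measurable
  qed
  have lim: "F (\<phi> (t, x)) t x \<le> liminf (\<lambda>n. f n t x)" if t: "0 \<le> t" for t x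
  proof -
    have ev: "\<forall>\<^sub>F n in sequentially. \<bar>t\<bar> + \<bar>x\<bar> \<le> real n"
      using eventually_ge_at_top[of "nat \<lceil>\<bar>t\<bar> + \<bar>x\<bar>\<rceil>"] by eventually_elim linarith
    have "(\<lambda>n. u n (t, x)) \<longlonglongrightarrow> \<phi> (t, x)"
    proof (rule LIM_zero_cancel, rule Lim_null_comparison)
      show "\<forall>\<^sub>F n in sequentially. norm (u n (t, x) - \<phi> (t, x)) \<le> 1 / (real n + 1)"
        using ev
      proof eventually_elim
        case (elim n)
        then have "(t, x) \<in> {0..real n} \<times> {- real n..real n}" using t by auto
        then show ?case using close by simp
      qed
      show "(\<lambda>n. 1 / (real n + 1)) \<longlonglongrightarrow> 0"
        using LIMSEQ_inverse_real_of_nat by (simp add: inverse_eq_divide add.commute)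
    qed
    \<comment> \<open>The power enters through \<open>potential\<close>, which is differentiable
      everywhere, hence continuous also where the solution vanishes.\<close>
    then have "(\<lambda>n. potential p (u n (t, x))) \<longlonglongrightarrow> potential p (\<phi> (t, x))"
      by (rule isCont_tendsto_compose[OF DERIV_isCont[OF potential_has_derivative[OF p]]])
    then have "(\<lambda>n. ((t + 1)\<^sup>2 - x\<^sup>2) * ((p + 1) * potential p (u n (t, x))) / (t + 1) ^ 3)
        \<longlonglongrightarrow> ((t + 1)\<^sup>2 - x\<^sup>2) * ((p + 1) * potential p (\<phi> (t, x))) / (t + 1) ^ 3"
      by (intro tendsto_intros) (use t in auto)
    then have "(\<lambda>n. F (u n (t, x)) t x) \<longlonglongrightarrow> F (\<phi> (t, x)) t x"
      using p unfolding F_def potential_def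
      by (intro tendsto_mult_ennreal tendsto_const tendsto_ennrealI) (auto simp: indicator_def)
    then have "(\<lambda>n. f n t x) \<longlonglongrightarrow> F (\<phi> (t, x)) t x"
      by (rule Lim_transform_eventually)
        (use ev t in \<open>auto simp: f_def indicator_def elim!: eventually_mono\<close>)
    then show ?thesis by (simp add: lim_imp_Liminf)
  qed
  \<comment> \<open>Fatou's lemma is applied twice, in \<open>x\<close> at fixed \<open>t\<close>
    and then in \<open>t\<close>; the restriction to \<open>{0..real n}\<close> inside
    \<open>f\<close> disappears in the limit.\<close>
  have "(\<integral>\<^sup>+t\<in>{0..}. (\<integral>\<^sup>+x. F (\<phi> (t, x)) t x \<partial>lborel) \<partial>lborel) \<le> (\<integral>\<^sup>+t. liminf (\<lambda>n. \<integral>\<^sup>+x. f n t x \<partial>lborel) \<partial>lborel)"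
  proof (rule nn_integral_mono)
    fix t :: real
    show "(\<integral>\<^sup>+x. F (\<phi> (t, x)) t x \<partial>lborel) * indicator {0..} t \<le> liminf (\<lambda>n. \<integral>\<^sup>+x. f n t x \<partial>lborel)"
    proof (cases "0 \<le> t")
      case True
      have "(\<integral>\<^sup>+x. F (\<phi> (t, x)) t x \<partial>lborel) \<le> (\<integral>\<^sup>+x. liminf (\<lambda>n. f n t x) \<partial>lborel)"
        by (intro nn_integral_mono lim True)
      also have "\<dots> \<le> liminf (\<lambda>n. \<integral>\<^sup>+x. f n t x \<partial>lborel)"
        by (intro nn_integral_liminf) measurable
      finally show ?thesis using True by simp
    qed simp
  qed
  also have "\<dots> \<le> liminf (\<lambda>n. \<integral>\<^sup>+t. (\<integral>\<^sup>+x. f n t x \<partial>lborel) \<partial>lborel)"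
    by (intro nn_integral_liminf) measurable
  also have "\<dots> \<le> liminf (\<lambda>n. ennreal (?C p (enn2real (energy p \<phi>\<^sub>0 \<phi>\<^sub>1))))"
  proof (intro Liminf_mono always_eventually allI)
    fix n
    have "(\<integral>\<^sup>+x. f n t x \<partial>lborel) = (\<integral>\<^sup>+x. F (u n (t, x)) t x \<partial>lborel) * indicator {0..real n} t" for t
      by (auto simp: f_def indicator_def)
    then show "(\<integral>\<^sup>+t. (\<integral>\<^sup>+x. f n t x \<partial>lborel) \<partial>lborel) \<le> ennreal (?C p (enn2real (energy p \<phi>\<^sub>0 \<phi>\<^sub>1)))"
      using bound[of n] by simp
  qed
  also have "\<dots> = ennreal (?C p (enn2real (energy p \<phi>\<^sub>0 \<phi>\<^sub>1)))" by (simp add: Liminf_const)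
  finally show "(\<integral>\<^sup>+t\<in>{0..}. (\<integral>\<^sup>+x\<in>{- t - 1..t + 1}.
          ennreal (((t + 1)\<^sup>2 - x\<^sup>2) * \<bar>\<phi> (t, x)\<bar> powr (p + 1) / (t + 1) ^ 3)
        \<partial>lborel) \<partial>lborel)
      \<le> ennreal (?C p (enn2real (energy p \<phi>\<^sub>0 \<phi>\<^sub>1)))"
    unfolding F_def .
qed

end
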